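(* Let $X,\widetilde X\subset\mathbb{R}^2$ be two real analytic curves with $0\in X\cap\widetilde X$. Let $\mathrm{Smp}(\partial X')=\{a_1,\dots,a_r\}$ and $\mathrm{Smp}(\partial\widetilde X')=\{\widetilde a_1,\dots,\widetilde a_s\}$ (with distinct elements listed). Then the following statements are equivalent: (1) $(X,0)$ and $(\widetilde X,0)$ are blow-spherical homeomorphic; (2) there is a bijection $\sigma:\{1,\dots,r\}\to\{1,\dots,s\}$ such that for each $i\in\{1,\dots,r\}$, $k_X(a_i)=k_{\widetilde X}(\widetilde a_{\sigma(i)})$; (3) there is an isomorphism (of rooted trees) between the real blow-spherical trees at $0$ of $X$ and $\widetilde X$.
   Context: All real analytic sets are assumed to be pure dimensional; a real analytic curve is a real analytic set of dimension $1$. For $k\ge 1$ let $\beta_k:\mathbb{S}^{k-1}\times[0,+\infty)\to\mathbb{R}^k$, $\beta_k(x,r)=rx$. For $X\subset\mathbb{R}^n$ with $0\in X$ put $X'=\overline{\beta_n^{-1}(X\setminus\{0\})}$ and $\partial X'=X'\cap(\mathbb{S}^{n-1}\times\{0\})$. A continuous map $\varphi:(X,0)\to(Y,0)$ ($X\subset\mathbb{R}^n$, $Y\subset\mathbb{R}^p$) with $0\notin\varphi(X\setminus\{0\})$ is a blow-spherical homeomorphism if $\beta_p^{-1}\circ\varphi\circ\beta_n:X'\setminus\partial X'\to Y'\setminus\partial Y'$ extends to a homeomorphism $\varphi':X'\to Y'$; the germs $(X,0)$ and $(Y,0)$ are then called blow-spherical homeomorphic. A point $x\in\partial X'$ is a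 simple point of $\partial X'$ if there is an open $U\subset\mathbb{R}^{n+1}$ with $x\in U$ such that (a) the connected components $X_1,\dots,X_m$ of $(X'\cap U)\setminus\partial X'$ are topological manifolds with $\dim X_i=\dim X$ for all $i$; (b) the sets $(X_i\cup\partial X')\cap U$ are topological manifolds with boundary. $\mathrm{Smp}(\partial X')$ is the set of simple points of $\partial X'$. For $x\in\mathrm{Smp}(\partial X')$, $k_X(x)$ is the number of connected components of the germ $(\beta_n^{-1}(X\setminus\{0\}),x)$. The real blow-spherical tree at $0$ of a curve $X$ is the rooted tree with a root corresponding to the curve, one vertex $L_j$ for each tangent half-line $\ell_j$ of $X$ at $0$ (i.e. each half-line from $0$ contained in the tangent cone of $X$ at $0$), joined by an edge to the root, and, for each $L_j$, vertices $V_j^1,\dots,V_j^{k_j}$, each joined by an edge to $L_j$, corresponding to the half-branches of $X$ at $0$ (the connected components of the germ of $X\setminus\{0\}$ at $0$) that are tangent at $0$ to $\ell_j$. *)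

theory Defs
  imports "HOL-Analysis.Analysis"
begin

section \<open>Real analytic sets and their dimension\<close>

text \<open>Local expansion in an unconditionally convergent multivariate power series; the multi-indices
  are the functions \<^term>\<open>\<alpha> :: 'n \<Rightarrow> nat\<close>.  Used only for open \<^term>\<open>U\<close>.\<close>

definition real_analytic_on :: "(real ^ 'n \<Rightarrow> real) \<Rightarrow> (real ^ 'n) set \<Rightarrow> bool" where
  "real_analytic_on f U \<longleftrightarrow>
     (\<forall>a\<in>U. \<exists>c :: ('n \<Rightarrow> nat) \<Rightarrow> real. \<exists>e>0. \<forall>x\<in>ball a e.
        ((\<lambda>\<alpha>. c \<alpha> * (\<Prod>i\<in>UNIV. (x $ i - a $ i) ^ \<alpha> i)) has_sum f x) UNIV)"

definition real_analytic_set :: "(real ^ 'n) set \<Rightarrow> bool" where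
  "real_analytic_set X \<longleftrightarrow>
     (\<forall>a. \<exists>U F. open U \<and> a \<in> U \<and> finite F \<and> (\<forall>f\<in>F. real_analytic_on f U)
        \<and> X \<inter> U = {x\<in>U. \<forall>f\<in>F. f x = 0})"

text \<open>A \<^term>\<open>d\<close>-dimensional analytic submanifold of \<open>\<real>\<^sup>n\<close>: locally the common zero set of
  \<open>n - d\<close> analytic functions whose gradients are linearly independent at the given point
  (\<^term>\<open>G i\<close> is the gradient of \<^term>\<open>g i\<close> at \<^term>\<open>p\<close>).\<close>

definition analytic_submanifold :: "nat \<Rightarrow> (real ^ 'n) set \<Rightarrow> bool" where
  "analytic_submanifold d M \<longleftrightarrow>
     (\<forall>p\<in>M. \<exists>U (m :: nat) g G. open U \<and> p \<in> U \<and> m + d = CARD('n)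
        \<and> (\<forall>i<m. real_analytic_on (g i) U \<and> (g i has_derivative (\<lambda>h. G i \<bullet> h)) (at p))
        \<and> inj_on G {..<m} \<and> independent (G ` {..<m})
        \<and> M \<inter> U = {x\<in>U. \<forall>i<m. g i x = 0})"

definition analytic_dim :: "(real ^ 'n) set \<Rightarrow> nat" where
  "analytic_dim X = (GREATEST d. \<exists>M. M \<noteq> {} \<and> M \<subseteq> X \<and> analytic_submanifold d M)"

definition analytic_dim_at :: "(real ^ 'n) set \<Rightarrow> real ^ 'n \<Rightarrow> nat" where
  "analytic_dim_at X x =
     (GREATEST d. \<forall>W. open W \<and> x \<in> W \<longrightarrow>
        (\<exists>M. M \<noteq> {} \<and> M \<subseteq> X \<inter> W \<and> analytic_submanifold d M))"

definition pure_dimensional :: "(real ^ 'n) set \<Rightarrow> bool" where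
  "pure_dimensional X \<longleftrightarrow> (\<forall>x\<in>X. analytic_dim_at X x = analytic_dim X)"

definition real_analytic_curve :: "(real ^ 'n) set \<Rightarrow> bool" where
  "real_analytic_curve X \<longleftrightarrow>
     real_analytic_set X \<and> pure_dimensional X \<and> analytic_dim X = 1"

section \<open>Topological manifolds\<close>

text \<open>Only subsets of Euclidean spaces are considered, so Hausdorff and second countable are
  automatic.  A manifold with boundary may have empty boundary.\<close>

definition topological_manifold :: "nat \<Rightarrow> 'a::euclidean_space set \<Rightarrow> bool" where
  "topological_manifold d M \<longleftrightarrow>
     (\<forall>x\<in>M. \<exists>V W. openin (top_of_set M) V \<and> x \<in> V \<and> openin (Euclidean_space d) W
        \<and> top_of_set V homeomorphic_space subtopology (Euclidean_space d) W)"

definition topological_manifold_with_boundary :: "nat \<Rightarrow> 'a::euclidean_space set \<Rightarrow> bool" where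
  "topological_manifold_with_boundary d M \<longleftrightarrow>
     (\<forall>x\<in>M. \<exists>V W. openin (top_of_set M) V \<and> x \<in> V
        \<and> openin (subtopology (Euclidean_space d) {y. 0 \<le> y 0}) W
        \<and> top_of_set V homeomorphic_space subtopology (Euclidean_space d) W)"

section \<open>Germs and their connected components\<close>

definition germ :: "'a::topological_space set \<Rightarrow> 'a \<Rightarrow> 'a set set" where
  "germ A x = {B. \<exists>U. open U \<and> x \<in> U \<and> A \<inter> U = B \<inter> U}"

text \<open>The germs at \<^term>\<open>x\<close> that are, for every sufficiently small open neighbourhood
  \<^term>\<open>U\<close> of \<^term>\<open>x\<close>, the germ of a connected component of \<^term>\<open>A \<inter> U\<close> adherent to
  \<^term>\<open>x\<close>.  Both conditions are needed: a large \<^term>\<open>U\<close> may join two components of the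
  germ, and components of \<^term>\<open>A \<inter> U\<close> away from \<^term>\<open>x\<close> have empty germ.\<close>

definition germ_components :: "'a::topological_space set \<Rightarrow> 'a \<Rightarrow> 'a set set set" where
  "germ_components A x =
     {c. \<exists>U0. open U0 \<and> x \<in> U0 \<and>
        (\<forall>U. open U \<and> x \<in> U \<and> U \<subseteq> U0 \<longrightarrow>
           (\<exists>C \<in> components (A \<inter> U). x \<in> closure C \<and> c = germ C x))}"

section \<open>Spherical blowing-up\<close>

definition blow :: "'a::euclidean_space \<times> real \<Rightarrow> 'a" where
  "blow p = snd p *\<^sub>R fst p"

definition blow_inv :: "'a::euclidean_space \<Rightarrow> 'a \<times> real" where
  "blow_inv y = (y /\<^sub>R norm y, norm y)"

lemma homeomorphism_blow:
  "homeomorphism (sphere 0 1 \<times> {0<..}) (- {0 :: 'a::euclidean_space}) blow blow_inv"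
  by (rule homeomorphismI) (auto simp: blow_def blow_inv_def intro!: continuous_intros)

text \<open>The set \<open>\<beta>\<^sup>-\<^sup>1(X \<setminus> {0})\<close>.\<close>

definition blow_preimage :: "'a::euclidean_space set \<Rightarrow> ('a \<times> real) set" where
  "blow_preimage X = {p \<in> sphere 0 1 \<times> {0..}. blow p \<in> X - {0}}"

text \<open>\<open>X'\<close>; the closure in \<open>S\<^sup>n\<^sup>-\<^sup>1 \<times> [0,\<infinity>)\<close> and in \<open>\<real>\<^sup>n\<^sup>+\<^sup>1\<close> agree, as the former is closed.\<close>

definition strict_transform :: "'a::euclidean_space set \<Rightarrow> ('a \<times> real) set" where
  "strict_transform X = closure (blow_preimage X)"

definition strict_boundary :: "'a::euclidean_space set \<Rightarrow> ('a \<times> real) set" where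
  "strict_boundary X = strict_transform X \<inter> (sphere 0 1 \<times> {0})"

definition blow_spherical_homeomorphism ::
  "'a::euclidean_space set \<Rightarrow> 'b::euclidean_space set \<Rightarrow> ('a \<Rightarrow> 'b) \<Rightarrow> bool" where
  "blow_spherical_homeomorphism X Y \<phi> \<longleftrightarrow>
     continuous_on X \<phi> \<and> \<phi> ` X \<subseteq> Y \<and> \<phi> 0 = 0 \<and> 0 \<notin> \<phi> ` (X - {0})
     \<and> (\<exists>\<phi>' \<psi>'. homeomorphism (strict_transform X) (strict_transform Y) \<phi>' \<psi>'
          \<and> (\<forall>p \<in> strict_transform X - strict_boundary X. \<phi>' p = blow_inv (\<phi> (blow p))))"

text \<open>Maps of germs: the map is defined between representatives \<^term>\<open>X \<inter> A\<close> and
  \<^term>\<open>Y \<inter> B\<close>, with \<^term>\<open>A\<close> and \<^term>\<open>B\<close> neighbourhoods of \<open>0\<close>.  The representatives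
  are required to be closed, so that \<open>\<beta>\<close> maps \<open>X' \<setminus> \<partial>X'\<close> into the representative.\<close>

definition blow_spherical_homeomorphic ::
  "'a::euclidean_space set \<Rightarrow> 'b::euclidean_space set \<Rightarrow> bool" where
  "blow_spherical_homeomorphic X Y \<longleftrightarrow>
     (\<exists>A B \<phi>. 0 \<in> interior A \<and> 0 \<in> interior B \<and> closed (X \<inter> A) \<and> closed (Y \<inter> B)
        \<and> blow_spherical_homeomorphism (X \<inter> A) (Y \<inter> B) \<phi>)"

section \<open>Simple points and relative multiplicities\<close>

definition Smp :: "(real ^ 'n) set \<Rightarrow> ((real ^ 'n) \<times> real) set" where
  "Smp X = {x \<in> strict_boundary X. \<exists>U. open U \<and> x \<in> U
     \<and> finite (components (strict_transform X \<inter> U - strict_boundary X))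
     \<and> (\<forall>C \<in> components (strict_transform X \<inter> U - strict_boundary X).
          topological_manifold (analytic_dim X) C
          \<and> topological_manifold_with_boundary (analytic_dim X) ((C \<union> strict_boundary X) \<inter> U))}"

definition rel_mult :: "'a::euclidean_space set \<Rightarrow> 'a \<times> real \<Rightarrow> nat" where
  "rel_mult X x = card (germ_components (blow_preimage X) x)"

section \<open>The real blow-spherical tree\<close>

definition tangent_cone :: "'a::euclidean_space set \<Rightarrow> 'a set" where
  "tangent_cone X = {v. \<exists>(x :: nat \<Rightarrow> 'a) (t :: nat \<Rightarrow> real).
     (\<forall>k. x k \<in> X - {0} \<and> 0 < t k) \<and> x \<longlonglongrightarrow> 0 \<and> (\<lambda>k. x k /\<^sub>R t k) \<longlonglongrightarrow> v}"

definition tangent_half_lines :: "'a::euclidean_space set \<Rightarrow> 'a set set" where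
  "tangent_half_lines X =
     {l. (\<exists>v. v \<noteq> 0 \<and> l = {t *\<^sub>R v | t. 0 \<le> t}) \<and> l \<subseteq> tangent_cone X}"

definition half_branches :: "'a::euclidean_space set \<Rightarrow> 'a set set set" where
  "half_branches X = germ_components (X - {0}) 0"

text \<open>The tangent cone depends on the germ only, so any representative may be used.\<close>

definition half_branches_tangent :: "'a::euclidean_space set \<Rightarrow> 'a set \<Rightarrow> 'a set set set" where
  "half_branches_tangent X l = {c \<in> half_branches X. \<forall>B\<in>c. tangent_cone B = l}"

record 'v rooted_graph =
  verts :: "'v set"
  edges :: "'v set set"
  root :: 'v

definition rooted_isomorphic :: "'v rooted_graph \<Rightarrow> 'w rooted_graph \<Rightarrow> bool" where
  "rooted_isomorphic S T \<longleftrightarrow>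
     (\<exists>f. bij_betw f (verts S) (verts T) \<and> f (root S) = root T
        \<and> (\<forall>u\<in>verts S. \<forall>v\<in>verts S. {u, v} \<in> edges S \<longleftrightarrow> {f u, f v} \<in> edges T))"

datatype 'a bs_vertex = Root | Half_Line "'a set" | Half_Branch "'a set" "'a set set"

definition bs_tree :: "'a::euclidean_space set \<Rightarrow> 'a bs_vertex rooted_graph" where
  "bs_tree X =
     \<lparr> verts = {Root} \<union> {Half_Line l | l. l \<in> tangent_half_lines X}
         \<union> {Half_Branch l c | l c. l \<in> tangent_half_lines X \<and> c \<in> half_branches_tangent X l},
       edges = {{Root, Half_Line l} | l. l \<in> tangent_half_lines X}
         \<union> {{Half_Line l, Half_Branch l c} | l c.
              l \<in> tangent_half_lines X \<and> c \<in> half_branches_tangent X l},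
       root = Root \<rparr>"

end

theory Submission
  imports Defs "HOL-Complex_Analysis.Complex_Analysis"
begin

text \<open>
  The proof rests on the local structure of a plane real analytic set without interior: near the
  origin it consists, apart from the origin, of finitely many disjoint arcs \<open>r *\<^sub>R \<gamma> i r\<close>,
  parametrized by the distance \<open>r\<close> to the origin, whose directions \<open>\<gamma> i r\<close> on the unit circle
  converge as \<open>r\<close> tends to \<open>0\<close> (\<open>conic_arcs_of_curve\<close>). Once this is known, everything in the
  theorem is determined by the function that assigns to a direction \<open>v\<close> the number of arcs with
  \<open>\<gamma> i 0 = v\<close>. The boundary of the strict transform is the finite set of the limit directions; all
  of its points are simple, since the strict transform is near such a point a union of half-open
  intervals with common end point; the relative multiplicity counts these intervals. The tangent
  half-lines are the rays spanned by the limit directions, and the half-branches tangent to a ray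
  are the germs of the arcs with that direction. So the second and the third condition both say
  that the limit directions can be matched so that the numbers of arcs agree.

  A blow-spherical homeomorphism preserves these numbers because it maps boundary to boundary and
  the number of components of a germ is a topological invariant
  (\<open>blow_homeomorphic_imp_matchable\<close>). Conversely, a matching of the arcs compatible with their
  directions defines a blow-spherical homeomorphism that preserves the distance to the origin
  (\<open>matched_arcs_imp_blow_homeomorphic\<close>).

  The structure theorem is proved in polar coordinates, in which the curve becomes the zero set of
  a power series in \<open>r\<close> whose coefficients are holomorphic functions of the angle, after all
  equations are combined to a sum of squares and a power of \<open>r\<close> is divided out. Locally, in
  coordinates \<open>x\<close> and \<open>y\<close>, the leading coefficient has finite order \<open>m\<close> in \<open>y\<close>, and the real zero
  set for small \<open>x > 0\<close> is a finite union of graphs by induction on \<open>m\<close> (\<open>local_zero_arcs\<close>): the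
  derivative in \<open>y\<close> has order \<open>m - 1\<close> and thus vanishes on finitely many graphs, between which the
  function is monotone, so that its zeros are found from its signs on these graphs.

  What has to be excluded is that these signs oscillate as \<open>x\<close> tends to \<open>0\<close>
  (\<open>sign_along_zero_arc\<close>). By Weierstrass division along the derivative \<open>g\<close>, the functions modulo
  \<open>g\<close> form a module of finite rank over the convergent power series in \<open>x\<close>, so the powers of the
  given function satisfy on the zero set of \<open>g\<close> a nontrivial linear relation whose coefficients
  depend on \<open>x\<close> only (\<open>algebraic_relation_on_zero_set\<close>). In such a relation the lowest nonzero
  coefficient has no zeros for small \<open>x > 0\<close>, and then the zeros of the function along an arc form
  an open and closed set. This elementary argument stands in for resultants, discriminants or
  Puiseux series.
\<close>

section \<open>Power series whose coefficients are holomorphic functions\<close>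

text \<open>The geometric bound makes \<open>\<Sum>k. u k y * x ^ k\<close> a convergent power series in \<open>x\<close>, uniformly in
  \<open>y \<in> S\<close>. Treating the two variables asymmetrically has the advantage that division with respect
  to \<open>y\<close> becomes a recursion over the powers of \<open>x\<close> in which every step divides by the same
  function \<open>u 0\<close> of one variable.\<close>

definition power_family :: "complex set \<Rightarrow> (nat \<Rightarrow> complex \<Rightarrow> complex) \<Rightarrow> bool" where
  "power_family S u \<longleftrightarrow> (\<forall>k. u k holomorphic_on S) \<and>
     (\<exists>M R. 0 < M \<and> 0 < R \<and> (\<forall>k. \<forall>y\<in>S. norm (u k y) \<le> M * R ^ k))"

definition ev :: "(nat \<Rightarrow> complex \<Rightarrow> complex) \<Rightarrow> complex \<Rightarrow> complex \<Rightarrow> complex" where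
  "ev u x y = (\<Sum>k. u k y * x ^ k)"

text \<open>Coefficients of the product of two such series: the Cauchy product in the first variable.\<close>

definition pf_times :: "(nat \<Rightarrow> complex \<Rightarrow> complex) \<Rightarrow> (nat \<Rightarrow> complex \<Rightarrow> complex) \<Rightarrow> nat \<Rightarrow> complex \<Rightarrow> complex" where
  "pf_times u v k y = (\<Sum>i\<le>k. u i y * v (k - i) y)"

lemma power_familyI:
  assumes "\<And>k. u k holomorphic_on S" "0 < M" "0 < R"
    "\<And>k y. y \<in> S \<Longrightarrow> norm (u k y) \<le> M * R ^ k"
  shows "power_family S u"
  using assms unfolding power_family_def by blast

lemma power_family_mono: "power_family T u \<Longrightarrow> S \<subseteq> T \<Longrightarrow> power_family S u"
  unfolding power_family_def by (meson holomorphic_on_subset subset_eq)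

lemma power_family_bounds:
  assumes "power_family S u" "power_family S v"
  shows "\<exists>M R. 0 < M \<and> 0 < R \<and> (\<forall>k. \<forall>y\<in>S. norm (u k y) \<le> M * R ^ k \<and> norm (v k y) \<le> M * R ^ k)"
proof -
  obtain M R where 1: "0 < M" "0 < R" "\<And>k y. y \<in> S \<Longrightarrow> norm (u k y) \<le> M * R ^ k"
    using assms(1) unfolding power_family_def by blast
  obtain M' R' where 2: "0 < M'" "0 < R'" "\<And>k y. y \<in> S \<Longrightarrow> norm (v k y) \<le> M' * R' ^ k"
    using assms(2) unfolding power_family_def by blast
  have "norm (u k y) \<le> max M M' * max R R' ^ k" if "y \<in> S" for k y
    using 1(3)[OF that, of k] 1(1,2) 2(1,2)
    by (elim order_trans, intro mult_mono power_mono) auto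
  moreover have "norm (v k y) \<le> max M M' * max R R' ^ k" if "y \<in> S" for k y
    using 2(3)[OF that, of k] 1(1,2) 2(1,2)
    by (elim order_trans, intro mult_mono power_mono) auto
  moreover have "0 < max M M'" "0 < max R R'" using 1 2 by auto
  ultimately show ?thesis by blast
qed

lemma power_family_add:
  assumes "power_family S u" "power_family S v"
  shows "power_family S (\<lambda>k y. u k y + v k y)"
proof -
  obtain M R where *: "0 < M" "0 < R" "\<And>k y. y \<in> S \<Longrightarrow> norm (u k y) \<le> M * R ^ k"
    "\<And>k y. y \<in> S \<Longrightarrow> norm (v k y) \<le> M * R ^ k"
    using power_family_bounds[OF assms] by blast
  have "norm (u k y + v k y) \<le> (2 * M) * R ^ k" if "y \<in> S" for k y
    using norm_triangle_ineq[of "u k y" "v k y"] *(3,4)[OF that, of k] by linarith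
  then show ?thesis
    using assms *(1,2)
    by (intro power_familyI[of _ _ "2 * M" R] holomorphic_intros) (auto simp: power_family_def)
qed

lemma power_family_times:
  assumes "power_family S u" "power_family S v"
  shows "power_family S (pf_times u v)"
proof -
  obtain M R where *: "0 < M" "0 < R" "\<And>k y. y \<in> S \<Longrightarrow> norm (u k y) \<le> M * R ^ k"
    "\<And>k y. y \<in> S \<Longrightarrow> norm (v k y) \<le> M * R ^ k"
    using power_family_bounds[OF assms] by blast
  have "norm (pf_times u v k y) \<le> (M * M) * (2 * R) ^ k" if y: "y \<in> S" for k y
  proof -
    have "norm (pf_times u v k y) \<le> (\<Sum>i\<le>k. norm (u i y * v (k - i) y))"
      unfolding pf_times_def by (rule norm_sum)
    also have "\<dots> \<le> (\<Sum>i\<le>k. M * M * R ^ k)"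
    proof (rule sum_mono)
      fix i assume i: "i \<in> {..k}"
      have "R ^ k = R ^ i * R ^ (k - i)" using i by (simp flip: power_add)
      have "norm (u i y * v (k - i) y) \<le> (M * R ^ i) * (M * R ^ (k - i))"
        unfolding norm_mult using *(1,2) *(3,4)[OF y] by (intro mult_mono) auto
      also have "\<dots> = M * M * R ^ k"
        using \<open>R ^ k = _\<close> by simp
      finally show "norm (u i y * v (k - i) y) \<le> M * M * R ^ k" .
    qed
    also have "\<dots> = real (Suc k) * (M * M * R ^ k)" by simp
    also have "\<dots> \<le> 2 ^ k * (M * M * R ^ k)"
    proof (rule mult_right_mono)
      have "Suc k \<le> 2 ^ k" using less_exp[of k] by linarith
      then show "real (Suc k) \<le> 2 ^ k" by (metis numeral_power_eq_of_nat_cancel_iff of_nat_le_iff of_nat_numeral of_nat_power)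
    qed (use * in auto)
    finally show ?thesis by (simp add: power_mult_distrib mult_ac)
  qed
  moreover have "pf_times u v k holomorphic_on S" for k
    using assms unfolding pf_times_def[abs_def] power_family_def by (intro holomorphic_intros) auto
  ultimately show ?thesis
    using *(1,2) by (intro power_familyI[of _ _ "M * M" "2 * R"]) auto
qed

lemma summable_half: "summable (\<lambda>k. M * (1/2 :: real) ^ k)"
  by (intro summable_mult summable_geometric) simp

text \<open>On half of the disc on which the geometric bound guarantees convergence, the series is dominated
  by a fixed geometric series, which is the form needed for the Weierstrass test.\<close>

lemma power_family_majorant:
  assumes "power_family S u"
  shows "\<exists>e M. 0 < e \<and> 0 < M \<and>
    (\<forall>x\<in>ball 0 e. \<forall>y\<in>S. \<forall>k. norm (u k y * x ^ k) \<le> M * (1/2) ^ k)"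
proof -
  obtain M R where 1: "0 < M" "0 < R" "\<And>k y. y \<in> S \<Longrightarrow> norm (u k y) \<le> M * R ^ k"
    using assms(1) unfolding power_family_def by blast
  show ?thesis
  proof (rule exI[of _ "1 / (2 * R)"], rule exI[of _ M], intro conjI ballI allI)
    fix x y :: complex and k assume x: "x \<in> ball 0 (1 / (2 * R))" and y: "y \<in> S"
    have "norm (u k y * x ^ k) \<le> (M * R ^ k) * (1 / (2 * R)) ^ k"
      unfolding norm_mult norm_power using 1 x y by (intro mult_mono power_mono) auto
    also have "\<dots> = M * (1/2) ^ k"
      using 1 by (simp add: power_mult_distrib power_divide)
    finally show "norm (u k y * x ^ k) \<le> M * (1/2) ^ k" .
  qed (use 1 in auto)
qed

lemma eventually_nhds_0_ballI:
  fixes P :: "'a::real_normed_vector \<Rightarrow> bool"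
  assumes "0 < e" "\<And>x. x \<in> ball 0 e \<Longrightarrow> P x"
  shows "eventually P (nhds 0)"
  unfolding eventually_nhds using assms by (intro exI[of _ "ball 0 e"]) auto

lemma power_family_summable:
  assumes "power_family S u"
  shows "eventually (\<lambda>x. \<forall>y\<in>S. summable (\<lambda>k. norm (u k y * x ^ k))) (nhds 0)"
proof -
  obtain e M where *: "0 < e" "0 < M"
    "\<And>(x::complex) y k. x \<in> ball 0 e \<Longrightarrow> y \<in> S \<Longrightarrow> norm (u k y * x ^ k) \<le> M * (1/2) ^ k"
    using power_family_majorant[OF assms] by blast
  show ?thesis
  proof (rule eventually_nhds_0_ballI[OF *(1)], intro ballI)
    fix x y :: complex assume "x \<in> ball 0 e" "y \<in> S"
    then have "norm (norm (u k y * x ^ k)) \<le> M * (1/2) ^ k" for k using *(3) by simp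
    then show "summable (\<lambda>k. norm (u k y * x ^ k))"
      by (rule summable_comparison_test'[where N = 0, OF summable_half])
  qed
qed

lemma ev_add:
  assumes "power_family S u" "power_family S v"
  shows "eventually (\<lambda>x. \<forall>y\<in>S. ev (\<lambda>k y. u k y + v k y) x y = ev u x y + ev v x y) (nhds 0)"
  using power_family_summable[OF assms(1)] power_family_summable[OF assms(2)]
proof eventually_elim
  case (elim x)
  then show ?case
    by (auto simp: ev_def algebra_simps suminf_add summable_norm_cancel)
qed

lemma ev_times:
  assumes "power_family S u" "power_family S v"
  shows "eventually (\<lambda>x. \<forall>y\<in>S. ev (pf_times u v) x y = ev u x y * ev v x y) (nhds 0)"
  using power_family_summable[OF assms(1)] power_family_summable[OF assms(2)]
proof eventually_elim
  case (elim x)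
  show ?case
  proof
    fix y assume "y \<in> S"
    then have "(\<lambda>k. \<Sum>i\<le>k. (u i y * x ^ i) * (v (k - i) y * x ^ (k - i))) sums (ev u x y * ev v x y)"
      unfolding ev_def using elim by (intro Cauchy_product_sums) auto
    moreover have "(\<Sum>i\<le>k. (u i y * x ^ i) * (v (k - i) y * x ^ (k - i))) = pf_times u v k y * x ^ k" for k
      unfolding pf_times_def sum_distrib_right
      by (intro sum.cong) (auto simp: mult_ac power_add[symmetric])
    ultimately show "ev (pf_times u v) x y = ev u x y * ev v x y"
      unfolding ev_def by (simp add: sums_iff)
  qed
qed

lemma ev_continuous:
  assumes "power_family S u"
  shows "\<exists>e>0. continuous_on (ball 0 e \<times> S) (\<lambda>(x, y). ev u x y)"
proof -
  obtain e M where *: "0 < e" "0 < M"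
    "\<And>(x::complex) y k. x \<in> ball 0 e \<Longrightarrow> y \<in> S \<Longrightarrow> norm (u k y * x ^ k) \<le> M * (1/2) ^ k"
    using power_family_majorant[OF assms] by blast
  have c: "continuous_on S (u k)" for k
    using assms unfolding power_family_def by (auto intro: holomorphic_on_imp_continuous_on)
  have "uniform_limit (ball 0 e \<times> S) (\<lambda>n p. \<Sum>k<n. u k (snd p) * fst p ^ k)
          (\<lambda>p. \<Sum>k. u k (snd p) * fst p ^ k) sequentially"
    using * by (intro Weierstrass_m_test[where M = "\<lambda>k. M * (1/2) ^ k"]) (auto intro: summable_half)
  then have "continuous_on (ball 0 e \<times> S) (\<lambda>p. \<Sum>k. u k (snd p) * fst p ^ k)"
  proof (rule uniform_limit_theorem[rotated])
    show "\<forall>\<^sub>F n in sequentially. continuous_on (ball 0 e \<times> S) (\<lambda>p. \<Sum>k<n. u k (snd p) * fst p ^ k)"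
      by (intro always_eventually allI continuous_intros continuous_on_compose2[OF c]) auto
  qed simp
  then show ?thesis using * by (auto simp: ev_def case_prod_unfold)
qed

text \<open>For small \<open>x\<close> the zeros of the series in \<open>y\<close> are governed by the zeros of the leading coefficient
  \<open>u 0\<close>.\<close>

lemma ev_near_first:
  assumes "power_family S u" "0 < \<epsilon>"
  shows "eventually (\<lambda>x. \<forall>y\<in>S. norm (ev u x y - u 0 y) < \<epsilon>) (nhds 0)"
proof -
  obtain M R where 1: "0 < M" "0 < R" "\<And>k y. y \<in> S \<Longrightarrow> norm (u k y) \<le> M * R ^ k"
    using assms(1) unfolding power_family_def by blast
  define e where "e = min (1 / (2 * R)) (\<epsilon> / (2 * M * R))"
  have e: "0 < e" using 1 assms by (auto simp: e_def)
  have "eventually (\<lambda>x. x \<in> ball 0 e) (nhds (0::complex))"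
    using e by (intro eventually_nhds_in_open) auto
  with power_family_summable[OF assms(1)] show ?thesis
  proof eventually_elim
    case (elim x)
    then have x: "norm x < e" by simp
    show ?case
    proof
      fix y assume y: "y \<in> S"
      have s: "summable (\<lambda>k. u k y * x ^ k)"
        using elim y by (auto intro: summable_norm_cancel)
      have t: "ev u x y - u 0 y = (\<Sum>k. u (Suc k) y * x ^ Suc k)"
        unfolding ev_def using suminf_split_head[OF s] by simp
      have b: "norm (u (Suc k) y * x ^ Suc k) \<le> M * R * norm x * (1/2) ^ k" for k
      proof -
        have "norm (u (Suc k) y * x ^ Suc k) \<le> (M * R ^ Suc k) * (norm x * (1 / (2 * R)) ^ k)"
          unfolding norm_mult norm_power power_Suc using 1 x y unfolding e_def
          by (intro mult_mono power_mono) (auto simp flip: power_Suc)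
        also have "\<dots> = M * R * norm x * (1/2) ^ k"
          using 1 by (simp add: power_mult_distrib power_divide)
        finally show ?thesis .
      qed
      have "norm (ev u x y - u 0 y) \<le> (\<Sum>k. M * R * norm x * (1/2) ^ k)"
        unfolding t using b by (intro norm_suminf_le summable_half)
      also have "\<dots> = 2 * M * R * norm x"
        by (subst suminf_mult) (auto intro!: summable_geometric simp: suminf_geometric)
      also have "\<dots> < \<epsilon>"
        using x 1 assms unfolding e_def by (simp add: field_simps)
      finally show "norm (ev u x y - u 0 y) < \<epsilon>" .
    qed
  qed
qed

text \<open>Cauchy's inequality on discs of radius \<open>\<rho> / 2\<close> transfers the geometric bound to the derivatives,
  at the price of halving the domain.\<close>

lemma power_family_deriv:
  assumes "power_family (ball 0 \<rho>) u" "0 < \<rho>"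
  shows "power_family (ball 0 (\<rho> / 2)) (\<lambda>k. deriv (u k))"
proof -
  obtain M R where 1: "0 < M" "0 < R" "\<And>k y. y \<in> ball 0 \<rho> \<Longrightarrow> norm (u k y) \<le> M * R ^ k"
    and h: "\<And>k. u k holomorphic_on ball 0 \<rho>"
    using assms(1) unfolding power_family_def by blast
  have "norm (deriv (u k) y) \<le> (M / (\<rho> / 2)) * R ^ k" if y: "y \<in> ball 0 (\<rho> / 2)" for k y
  proof -
    have sub: "cball y (\<rho> / 2) \<subseteq> ball 0 \<rho>"
    proof
      fix z assume "z \<in> cball y (\<rho> / 2)"
      then show "z \<in> ball 0 \<rho>"
        using y norm_triangle_ineq[of y "z - y"] by (simp add: dist_norm norm_minus_commute)
    qed
    have "norm ((deriv ^^ 1) (u k) y) \<le> fact 1 * (M * R ^ k) / (\<rho> / 2) ^ 1"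
    proof (rule Cauchy_inequality)
      show "u k holomorphic_on ball y (\<rho> / 2)"
        using h sub ball_subset_cball by (meson holomorphic_on_subset)
      show "continuous_on (cball y (\<rho> / 2)) (u k)"
        using h sub by (meson holomorphic_on_subset holomorphic_on_imp_continuous_on)
      fix x assume "norm (y - x) = \<rho> / 2"
      then show "norm (u k x) \<le> M * R ^ k"
        using sub by (intro 1) (auto simp: dist_norm)
    qed (use assms in auto)
    then show ?thesis by (simp add: field_simps)
  qed
  moreover have "deriv (u k) holomorphic_on ball 0 (\<rho> / 2)" for k
    by (rule holomorphic_on_subset[OF holomorphic_deriv[OF h]]) (use assms in auto)
  ultimately show ?thesis
    using 1 assms by (intro power_familyI[of _ _ "M / (\<rho> / 2)" R]) auto
qed

lemma ev_deriv:
  assumes "power_family (ball 0 \<rho>) u" "0 < \<rho>"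
  shows "eventually (\<lambda>x. \<forall>y\<in>ball 0 (\<rho> / 2).
           (ev u x has_field_derivative ev (\<lambda>k. deriv (u k)) x y) (at y)) (nhds 0)"
proof -
  obtain e M where *: "0 < e" "0 < M"
    "\<And>(x::complex) y k. x \<in> ball 0 e \<Longrightarrow> y \<in> ball 0 (\<rho>/2) \<Longrightarrow> norm (deriv (u k) y * x ^ k) \<le> M * (1/2) ^ k"
    using power_family_majorant[OF power_family_deriv[OF assms]] by blast
  have h: "\<And>k. u k holomorphic_on ball 0 \<rho>" using assms unfolding power_family_def by blast
  have "eventually (\<lambda>x. x \<in> ball 0 e) (nhds (0::complex))"
    using * by (intro eventually_nhds_in_open) auto
  with power_family_summable[OF assms(1)] show ?thesis
  proof eventually_elim
    case (elim x)
    show ?case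
    proof
      fix y :: complex assume y: "y \<in> ball 0 (\<rho> / 2)"
      have "((\<lambda>y. \<Sum>k. u k y * x ^ k) has_field_derivative (\<Sum>k. deriv (u k) y * x ^ k)) (at y)"
      proof (rule has_field_derivative_series'(2))
        show "convex (ball (0::complex) (\<rho>/2))" by simp
        show "0 \<in> ball (0::complex) (\<rho>/2)" using assms by simp
        show "y \<in> interior (ball 0 (\<rho> / 2))" using y by (simp add: interior_open)
        show "summable (\<lambda>k. u k 0 * x ^ k)"
          using elim assms by (auto intro: summable_norm_cancel)
        show "uniformly_convergent_on (ball 0 (\<rho> / 2)) (\<lambda>n y. \<Sum>i<n. deriv (u i) y * x ^ i)"
          using *(3) elim by (intro Weierstrass_m_test'[where M = "\<lambda>k. M * (1/2) ^ k"]) (auto intro: summable_half)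
        fix n z assume z: "z \<in> ball (0::complex) (\<rho> / 2)"
        have "(u n has_field_derivative deriv (u n) z) (at z within ball 0 (\<rho>/2))"
          using holomorphic_derivI[OF h, of z n] z assms by (auto intro: DERIV_subset)
        then show "((\<lambda>y. u n y * x ^ n) has_field_derivative deriv (u n) z * x ^ n) (at z within ball 0 (\<rho> / 2))"
          by (rule DERIV_cmult_right)
      qed
      then show "(ev u x has_field_derivative ev (\<lambda>k. deriv (u k)) x y) (at y)"
        unfolding ev_def[abs_def] .
    qed
  qed
qed

section \<open>Division with remainder along a function of finite order\<close>

text \<open>A variant of the Schwarz lemma: for \<open>norm y \<ge> \<rho> / 2\<close> the quotient is bounded directly, and the
  maximum modulus principle carries the bound to the inner disc. The constant \<open>4 / \<rho>\<close> does not
  depend on the dividend, which the later recursion requires.\<close>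

lemma divide_by_variable:
  assumes "w holomorphic_on ball 0 \<rho>" "0 < \<rho>"
  shows "\<exists>W. W holomorphic_on ball 0 \<rho> \<and> (\<forall>y\<in>ball 0 \<rho>. w y = w 0 + y * W y) \<and>
           (\<forall>B. (\<forall>y\<in>ball 0 \<rho>. norm (w y) \<le> B) \<longrightarrow> (\<forall>y\<in>ball 0 \<rho>. norm (W y) \<le> 4 / \<rho> * B))"
proof -
  define W where "W = (\<lambda>y. if y = 0 then deriv w 0 else (w y - w 0) / (y - 0))"
  have hol: "W holomorphic_on ball 0 \<rho>"
    unfolding W_def using assms by (intro pole_lemma) (auto simp: interior_open)
  have eq: "w y = w 0 + y * W y" for y by (simp add: W_def)
  have far: "norm (W y) \<le> 4 / \<rho> * B"
    if B: "\<forall>y\<in>ball 0 \<rho>. norm (w y) \<le> B" and y: "y \<in> ball 0 \<rho>" "\<rho> / 2 \<le> norm y" for B y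
  proof -
    have "norm (w y - w 0) \<le> 2 * B"
      using norm_triangle_ineq4[of "w y" "w 0"] B y(1) assms(2)
      by (smt (verit) centre_in_ball)
    moreover have "0 < norm y" using y assms by linarith
    moreover have "0 \<le> B" using B assms(2) by (meson centre_in_ball norm_ge_zero order_trans)
    ultimately have "norm (w y - w 0) / norm y \<le> 2 * B / (\<rho> / 2)"
      using y assms by (intro frac_le) auto
    then have "norm (W y) \<le> 2 * B / (\<rho> / 2)"
      unfolding W_def using \<open>0 < norm y\<close> by (auto simp: norm_divide)
    then show ?thesis by (simp add: field_simps)
  qed
  have "norm (W y) \<le> 4 / \<rho> * B"
    if B: "\<forall>y\<in>ball 0 \<rho>. norm (w y) \<le> B" and y: "y \<in> ball 0 \<rho>" for B y
  proof (cases "\<rho> / 2 \<le> norm y")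
    case True then show ?thesis using far B y by blast
  next
    case False
    have sub: "cball 0 (\<rho> / 2) \<subseteq> ball (0::complex) \<rho>" using assms by auto
    show ?thesis
    proof (rule maximum_modulus_frontier[where S = "cball 0 (\<rho> / 2)" and f = W and \<xi> = y])
      show "W holomorphic_on interior (cball 0 (\<rho> / 2))"
        using hol sub by (meson holomorphic_on_subset interior_subset order_trans)
      show "continuous_on (closure (cball 0 (\<rho> / 2))) W"
        using hol sub by (metis closed_cball closure_closed holomorphic_on_imp_continuous_on holomorphic_on_subset)
      show "y \<in> cball 0 (\<rho> / 2)" using False by simp
      fix z assume "z \<in> frontier (cball (0::complex) (\<rho> / 2))"
      then have "norm z = \<rho> / 2" using assms by (simp add: dist_norm)
      then show "norm (W z) \<le> 4 / \<rho> * B" using assms by (intro far[OF B]) auto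
    qed auto
  qed
  then show ?thesis using hol eq by blast
qed

lemma divide_by_power:
  assumes "0 < \<rho>"
  shows "\<exists>C>0. \<forall>w. w holomorphic_on ball 0 \<rho> \<longrightarrow> (\<exists>W r. W holomorphic_on ball 0 \<rho> \<and>
           (\<forall>y\<in>ball 0 \<rho>. w y = (\<Sum>j<m. r j * y ^ j) + y ^ m * W y) \<and>
           (\<forall>B. (\<forall>y\<in>ball 0 \<rho>. norm (w y) \<le> B) \<longrightarrow>
              (\<forall>y\<in>ball 0 \<rho>. norm (W y) \<le> C * B) \<and> (\<forall>j<m. norm (r j) \<le> C * B)))"
proof (induction m)
  case 0
  show ?case by (intro exI[of _ 1]) auto
next
  case (Suc m)
  then obtain C where C: "C > 0" "\<forall>w. w holomorphic_on ball 0 \<rho> \<longrightarrow> (\<exists>W r. W holomorphic_on ball 0 \<rho> \<and>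
           (\<forall>y\<in>ball 0 \<rho>. w y = (\<Sum>j<m. r j * y ^ j) + y ^ m * W y) \<and>
           (\<forall>B. (\<forall>y\<in>ball 0 \<rho>. norm (w y) \<le> B) \<longrightarrow>
              (\<forall>y\<in>ball 0 \<rho>. norm (W y) \<le> C * B) \<and> (\<forall>j<m. norm (r j) \<le> C * B)))"
    by blast
  define C' where "C' = max C (4 / \<rho> * C)"
  have C': "0 < C'" "C \<le> C'" "4 / \<rho> * C \<le> C'" using C by (auto simp: C'_def)
  show ?case
  proof (rule exI[of _ C'], intro conjI C' allI impI)
    fix w assume w: "w holomorphic_on ball 0 \<rho>"
    obtain W r where W: "W holomorphic_on ball 0 \<rho>"
      "\<And>y. y\<in>ball 0 \<rho> \<Longrightarrow> w y = (\<Sum>j<m. r j * y ^ j) + y ^ m * W y"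
      "\<forall>B. (\<forall>y\<in>ball 0 \<rho>. norm (w y) \<le> B) \<longrightarrow>
              (\<forall>y\<in>ball 0 \<rho>. norm (W y) \<le> C * B) \<and> (\<forall>j<m. norm (r j) \<le> C * B)"
      using C(2) w by blast
    obtain V where V: "V holomorphic_on ball 0 \<rho>" "\<And>y. y\<in>ball 0 \<rho> \<Longrightarrow> W y = W 0 + y * V y"
      "\<forall>B. (\<forall>y\<in>ball 0 \<rho>. norm (W y) \<le> B) \<longrightarrow> (\<forall>y\<in>ball 0 \<rho>. norm (V y) \<le> 4 / \<rho> * B)"
      using divide_by_variable[OF W(1) assms] by blast
    define r' where "r' = r(m := W 0)"
    have "w y = (\<Sum>j<Suc m. r' j * y ^ j) + y ^ Suc m * V y" if y: "y \<in> ball 0 \<rho>" for y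
    proof -
      have "(\<Sum>j<m. r' j * y ^ j) = (\<Sum>j<m. r j * y ^ j)" unfolding r'_def by (intro sum.cong) auto
      then show ?thesis using W(2)[OF y] V(2)[OF y] by (simp add: r'_def algebra_simps)
    qed
    moreover have "(\<forall>y\<in>ball 0 \<rho>. norm (V y) \<le> C' * B) \<and> (\<forall>j<Suc m. norm (r' j) \<le> C' * B)"
      if B: "\<forall>y\<in>ball 0 \<rho>. norm (w y) \<le> B" for B
    proof -
      have B0: "0 \<le> B" using B assms by (meson centre_in_ball norm_ge_zero order_trans)
      have le: "C * B \<le> C' * B" "4 / \<rho> * C * B \<le> C' * B"
        using mult_right_mono[OF C'(2) B0] mult_right_mono[OF C'(3) B0] by simp_all
      have *: "(\<forall>y\<in>ball 0 \<rho>. norm (W y) \<le> C * B)" "(\<forall>j<m. norm (r j) \<le> C * B)" using W(3) B by blast+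
      then have "\<forall>y\<in>ball 0 \<rho>. norm (V y) \<le> 4 / \<rho> * (C * B)" using V(3) by blast
      moreover have "norm (W 0) \<le> C * B" using * assms by simp
      ultimately show ?thesis using * le unfolding r'_def
        by (fastforce simp: less_Suc_eq)
    qed
    ultimately show "\<exists>W r. W holomorphic_on ball 0 \<rho> \<and>
           (\<forall>y\<in>ball 0 \<rho>. w y = (\<Sum>j<Suc m. r j * y ^ j) + y ^ Suc m * W y) \<and>
           (\<forall>B. (\<forall>y\<in>ball 0 \<rho>. norm (w y) \<le> B) \<longrightarrow>
              (\<forall>y\<in>ball 0 \<rho>. norm (W y) \<le> C' * B) \<and> (\<forall>j<Suc m. norm (r j) \<le> C' * B))"
      using V(1) by blast
  qed
qed

text \<open>Near \<open>0\<close> a function of order \<open>m\<close> is \<open>y ^ m\<close> times a unit, and the inverse of the unit is bounded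
  on a small disc.\<close>

lemma finite_order_factor:
  assumes "f holomorphic_on ball 0 \<rho>" "0 < \<rho>" "(deriv ^^ n) f 0 \<noteq> 0"
  obtains m e s E where "0 < s" "s \<le> \<rho>" "0 < E" "e holomorphic_on ball 0 s"
    "\<forall>y\<in>ball 0 s. f y = y ^ m * e y \<and> e y \<noteq> 0 \<and> norm (inverse (e y)) \<le> E"
proof -
  define m where "m = (LEAST n. (deriv ^^ n) f 0 \<noteq> 0)"
  have m: "(deriv ^^ m) f 0 \<noteq> 0" "\<And>i. i < m \<Longrightarrow> (deriv ^^ i) f 0 = 0"
    unfolding m_def using LeastI[of "\<lambda>n. (deriv ^^ n) f 0 \<noteq> 0", OF assms(3)]
      not_less_Least[of _ "\<lambda>n. (deriv ^^ n) f 0 \<noteq> 0"] by blast+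
  obtain e r where e: "0 < r" "e holomorphic_on ball 0 r" "\<forall>y\<in>ball 0 r. f y = y ^ m * e y" "e 0 \<noteq> 0"
  proof (cases "m = 0")
    case True
    then show thesis using m(1) assms by (intro that[of \<rho> f]) auto
  next
    case False
    with m(2)[of 0] have f0: "f 0 = 0" by simp
    obtain g r where g: "0 < r" "g holomorphic_on ball 0 r"
      "\<And>w. w \<in> ball 0 r \<Longrightarrow> f w - f 0 = (w - 0) ^ m * g w" "\<And>w. w \<in> ball 0 r \<Longrightarrow> g w \<noteq> 0"
      by (rule holomorphic_factor_order_of_zero[OF assms(1) open_ball _ _ m(1)]) (use False m(2) assms(2) in auto)
    show thesis using g f0 by (intro that[of r g]) auto
  qed
  have cont: "continuous_on (ball 0 r) e" using e by (intro holomorphic_on_imp_continuous_on)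
  then have "isCont e 0" using e by (simp add: continuous_on_eq_continuous_at)
  then have "eventually (\<lambda>y. dist (e y) (e 0) < norm (e 0) / 2) (nhds 0)"
    using e(4) by (intro tendstoD) (auto simp: isCont_def tendsto_at_iff_tendsto_nhds)
  then obtain d where d: "0 < d" "\<And>y. norm y < d \<Longrightarrow> norm (e y - e 0) < norm (e 0) / 2"
    unfolding eventually_nhds_metric dist_norm by auto
  define s where "s = min d (min r \<rho>)"
  have low: "norm (e 0) / 2 \<le> norm (e y)" if "y \<in> ball 0 s" for y
  proof -
    have "norm (e 0) \<le> norm (e y) + norm (e y - e 0)"
      using norm_triangle_ineq[of "e y" "e 0 - e y"] by (simp add: norm_minus_commute)
    then show ?thesis using d(2)[of y] that by (simp add: s_def)
  qed
  show thesis
  proof (rule that[of s "2 / norm (e 0)" e m])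
    show "e holomorphic_on ball 0 s" using e(2) by (rule holomorphic_on_subset) (auto simp: s_def)
    show "\<forall>y\<in>ball 0 s. f y = y ^ m * e y \<and> e y \<noteq> 0 \<and> norm (inverse (e y)) \<le> 2 / norm (e 0)"
    proof
      fix y assume y: "y \<in> ball (0::complex) s"
      have "0 < norm (e y)" using low[OF y] e(4) by (smt (verit) half_gt_zero zero_less_norm_iff)
      moreover have "norm (inverse (e y)) \<le> 2 / norm (e 0)"
        using low[OF y] \<open>0 < norm (e y)\<close> e(4) by (simp add: norm_inverse inverse_eq_divide norm_divide field_simps)
      ultimately show "f y = y ^ m * e y \<and> e y \<noteq> 0 \<and> norm (inverse (e y)) \<le> 2 / norm (e 0)"
        using e(3) y by (auto simp: s_def)
    qed
  qed (use d e assms in \<open>auto simp: s_def\<close>)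
qed

text \<open>Splitting off the Taylor polynomial of degree less than \<open>m\<close> and dividing the rest by the unit
  gives quotient and remainder bounded by a constant multiple of the dividend.\<close>

lemma divide_by_finite_order:
  assumes "f holomorphic_on ball 0 \<rho>" "0 < \<rho>" "(deriv ^^ n) f 0 \<noteq> 0"
  shows "\<exists>m s C D r. 0 < s \<and> s \<le> \<rho> \<and> 0 < C \<and>
         (\<forall>w. w holomorphic_on ball 0 s \<longrightarrow>
           D w holomorphic_on ball 0 s \<and>
           (\<forall>y\<in>ball 0 s. w y = D w y * f y + (\<Sum>j<m. r w j * y ^ j)) \<and>
           (\<forall>B. (\<forall>y\<in>ball 0 s. norm (w y) \<le> B) \<longrightarrow>
              (\<forall>y\<in>ball 0 s. norm (D w y) \<le> C * B) \<and> (\<forall>j<m. norm (r w j) \<le> C * B)))"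
proof -
  obtain m e s E where e: "0 < s" "s \<le> \<rho>" "0 < E" "e holomorphic_on ball 0 s"
    "\<forall>y\<in>ball 0 s. f y = y ^ m * e y \<and> e y \<noteq> 0 \<and> norm (inverse (e y)) \<le> E"
    using finite_order_factor[OF assms] by metis
  define P where "P = (\<lambda>C w W r. W holomorphic_on ball 0 s \<and>
           (\<forall>y\<in>ball 0 s. w y = (\<Sum>j<m. r j * y ^ j) + y ^ m * W y) \<and>
           (\<forall>B. (\<forall>y\<in>ball 0 s. norm (w y) \<le> B) \<longrightarrow>
              (\<forall>y\<in>ball 0 s. norm (W y) \<le> C * B) \<and> (\<forall>j<m. norm (r j :: complex) \<le> C * B)))"
  obtain C where C: "C > 0" "\<forall>w. w holomorphic_on ball 0 s \<longrightarrow> (\<exists>W r. P C w W r)"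
    using divide_by_power[OF e(1), of m] unfolding P_def by blast
  define p where "p = (\<lambda>w. SOME p. P C w (fst p) (snd p))"
  define W where "W = (\<lambda>w. fst (p w))"
  define r where "r = (\<lambda>w. snd (p w))"
  have "P C w (W w) (r w)" if w: "w holomorphic_on ball 0 s" for w
  proof -
    have "\<exists>p. P C w (fst p) (snd p)" using C(2) w by (metis fst_conv snd_conv)
    then show ?thesis unfolding W_def r_def p_def by (rule someI_ex)
  qed
  then have W: "\<And>w. w holomorphic_on ball 0 s \<Longrightarrow> W w holomorphic_on ball 0 s"
    "\<And>w y. w holomorphic_on ball 0 s \<Longrightarrow> y\<in>ball 0 s \<Longrightarrow> w y = (\<Sum>j<m. r w j * y ^ j) + y ^ m * W w y"
    "\<And>w B. w holomorphic_on ball 0 s \<Longrightarrow> \<forall>y\<in>ball 0 s. norm (w y) \<le> B \<Longrightarrow>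
              (\<forall>y\<in>ball 0 s. norm (W w y) \<le> C * B) \<and> (\<forall>j<m. norm (r w j) \<le> C * B)"
    unfolding P_def by blast+
  define D where "D = (\<lambda>w y. W w y * inverse (e y))"
  define K where "K = max C (C * E)"
  have B0: "0 \<le> B" if "\<forall>y\<in>ball 0 s. norm (w y :: complex) \<le> B" for w B
    using that e(1) by (meson centre_in_ball norm_ge_zero order_trans)
  have K: "0 < K" using C by (auto simp: K_def)
  have "D w holomorphic_on ball 0 s \<and>
           (\<forall>y\<in>ball 0 s. w y = D w y * f y + (\<Sum>j<m. r w j * y ^ j)) \<and>
           (\<forall>B. (\<forall>y\<in>ball 0 s. norm (w y) \<le> B) \<longrightarrow>
              (\<forall>y\<in>ball 0 s. norm (D w y) \<le> K * B) \<and> (\<forall>j<m. norm (r w j) \<le> K * B))"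
    if w: "w holomorphic_on ball 0 s" for w
  proof (intro conjI ballI allI impI)
    show "D w holomorphic_on ball 0 s"
      unfolding D_def using W(1)[OF w] e by (intro holomorphic_intros) auto
    show "w y = D w y * f y + (\<Sum>j<m. r w j * y ^ j)" if y: "y \<in> ball 0 s" for y
      using W(2)[OF w y] e(5) y by (auto simp: D_def)
  next
    fix B assume B: "\<forall>y\<in>ball 0 s. norm (w y) \<le> B"
    have le: "C * B \<le> K * B" "C * E * B \<le> K * B"
      using B0[OF B] by (auto simp: K_def intro: mult_right_mono)
    show "norm (D w y) \<le> K * B" if y: "y \<in> ball 0 s" for y
    proof -
      have "norm (D w y) \<le> (C * B) * E"
        unfolding D_def norm_mult using W(3)[OF w B] e(5) y C B0[OF B] by (intro mult_mono) auto
      then show ?thesis using le by (simp add: mult_ac)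
    qed
    show "norm (r w j) \<le> K * B" if "j < m" for j
      using W(3)[OF w B] that le by fastforce
  qed
  then show ?thesis using K e(1,2) by blast
qed

text \<open>Comparing the coefficients of \<open>x ^ k\<close> in \<open>h = q * g + r\<close>, the coefficient \<open>q k\<close> is the quotient,
  computed by the one-variable division \<open>D\<close> along \<open>g 0\<close>, of what remains of \<open>h k\<close> after the
  earlier quotients are subtracted.\<close>

fun division_quotients ::
  "((complex \<Rightarrow> complex) \<Rightarrow> complex \<Rightarrow> complex) \<Rightarrow> (nat \<Rightarrow> complex \<Rightarrow> complex) \<Rightarrow> (nat \<Rightarrow> complex \<Rightarrow> complex) \<Rightarrow> nat \<Rightarrow> complex \<Rightarrow> complex" where
  "division_quotients D g h k = D (\<lambda>y. h k y - (\<Sum>i<k. division_quotients D g h i y * g (k - i) y))"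

declare division_quotients.simps [simp del]

lemma geometric_sum_ratio:
  fixes R S :: real
  assumes "0 < R" "R < S"
  shows "(\<Sum>i<k. S ^ i * R ^ (k - i)) \<le> R / (S - R) * S ^ k"
proof (induction k)
  case 0 show ?case using assms by simp
next
  case (Suc k)
  have "(\<Sum>i<Suc k. S ^ i * R ^ (Suc k - i)) = R * (\<Sum>i<k. S ^ i * R ^ (k - i)) + S ^ k * R"
    by (simp add: sum_distrib_left Suc_diff_le mult_ac)
  also have "\<dots> \<le> R * (R / (S - R) * S ^ k) + S ^ k * R"
    using Suc assms by (intro add_mono mult_left_mono) auto
  also have "\<dots> = R / (S - R) * S ^ Suc k"
    using assms by (simp add: field_simps)
  finally show ?case .
qed

text \<open>Weierstrass division: modulo \<open>g\<close> every series is a polynomial in \<open>y\<close> of bounded degree whose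
  coefficients are convergent power series in \<open>x\<close>. The quotients and remainders are determined
  recursively, and the point is that the recursion preserves a geometric bound.\<close>

lemma power_family_division:
  assumes g: "power_family (ball 0 \<rho>) g" and "0 < \<rho>" and ord: "(deriv ^^ n) (g 0) 0 \<noteq> 0"
  obtains m s where "0 < s" "s \<le> \<rho>"
    "\<And>h. power_family (ball 0 \<rho>) h \<Longrightarrow> \<exists>q r M R. power_family (ball 0 s) q \<and> 0 < M \<and> 0 < R \<and>
       (\<forall>k. \<forall>j<m. norm (r k j) \<le> M * R ^ k) \<and>
       (\<forall>k. \<forall>y\<in>ball 0 s. h k y = pf_times q g k y + (\<Sum>j<m. r k j * y ^ j))"
proof -
  have g0: "g 0 holomorphic_on ball 0 \<rho>" using g by (simp add: power_family_def)
  obtain m s C D r where s: "0 < s" "s \<le> \<rho>" and C: "0 < C"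
    and D: "(\<forall>w. w holomorphic_on ball 0 s \<longrightarrow>
           D w holomorphic_on ball 0 s \<and>
           (\<forall>y\<in>ball 0 s. w y = D w y * g 0 y + (\<Sum>j<m. r w j * y ^ j)) \<and>
           (\<forall>B. (\<forall>y\<in>ball 0 s. norm (w y) \<le> B) \<longrightarrow>
              (\<forall>y\<in>ball 0 s. norm (D w y) \<le> C * B) \<and> (\<forall>j<m. norm (r w j) \<le> C * B)))"
    using divide_by_finite_order[OF g0 \<open>0 < \<rho>\<close> ord] by (elim exE conjE) (rule that)
  have D1: "D w holomorphic_on ball 0 s" if "w holomorphic_on ball 0 s" for w using D that by blast
  have D2: "w y = D w y * g 0 y + (\<Sum>j<m. r w j * y ^ j)" if "w holomorphic_on ball 0 s" "y \<in> ball 0 s" for w y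
    using D that by blast
  have D3: "norm (D w y) \<le> C * B"
    if "w holomorphic_on ball 0 s" "\<forall>y\<in>ball 0 s. norm (w y) \<le> B" "y \<in> ball 0 s" for w B y
    using D that by blast
  have D4: "norm (r w j) \<le> C * B"
    if "w holomorphic_on ball 0 s" "\<forall>y\<in>ball 0 s. norm (w y) \<le> B" "j < m" for w B j
    using D that by blast
  have "\<exists>q r M R. power_family (ball 0 s) q \<and> 0 < M \<and> 0 < R \<and>
       (\<forall>k. \<forall>j<m. norm (r k j) \<le> M * R ^ k) \<and>
       (\<forall>k. \<forall>y\<in>ball 0 s. h k y = pf_times q g k y + (\<Sum>j<m. r k j * y ^ j))"
    if h: "power_family (ball 0 \<rho>) h" for h
  proof -
    define q where "q = division_quotients D g h"
    define w where "w = (\<lambda>k y. h k y - (\<Sum>i<k. q i y * g (k - i) y))"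
    have q: "q k = D (w k)" for k
      unfolding q_def w_def by (subst division_quotients.simps) simp
    have gs: "power_family (ball 0 s) g" and hs: "power_family (ball 0 s) h"
      using s by (auto intro: power_family_mono[OF g] power_family_mono[OF h])
    have qh: "q k holomorphic_on ball 0 s" for k
    proof (induction k rule: less_induct)
      case (less k)
      then have "w k holomorphic_on ball 0 s"
        unfolding w_def using gs hs by (intro holomorphic_intros) (auto simp: power_family_def)
      then show ?case unfolding q by (rule D1)
    qed
    then have wh: "w k holomorphic_on ball 0 s" for k
      unfolding w_def using gs hs by (intro holomorphic_intros) (auto simp: power_family_def)
    obtain M R where MR: "0 < M" "0 < R" "\<And>k y. y \<in> ball 0 s \<Longrightarrow> norm (g k y) \<le> M * R ^ k"
      "\<And>k y. y \<in> ball 0 s \<Longrightarrow> norm (h k y) \<le> M * R ^ k"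
      using power_family_bounds[OF gs hs] by blast
    \<comment> \<open>The ratio is chosen such that the geometric sum below contributes only half of the bound.\<close>
    define S where "S = R * (1 + 2 * C * M)"
    define K where "K = 2 * C * M"
    have K: "0 < K" using C MR by (simp add: K_def)
    have RS: "R < S" using C MR by (simp add: S_def algebra_simps)
    have ratio: "R / (S - R) = 1 / (2 * C * M)"
      using MR C by (simp add: S_def field_simps)
    have wb: "norm (w k y) \<le> 2 * M * S ^ k"
      if IH: "\<And>i y. i < k \<Longrightarrow> y \<in> ball 0 s \<Longrightarrow> norm (q i y) \<le> K * S ^ i" and y: "y \<in> ball 0 s" for k y
    proof -
      have "norm (w k y) \<le> norm (h k y) + norm (\<Sum>i<k. q i y * g (k - i) y)"
        unfolding w_def by (rule norm_triangle_ineq4)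
      also have "\<dots> \<le> M * S ^ k + (\<Sum>i<k. (K * S ^ i) * (M * R ^ (k - i)))"
      proof (rule add_mono)
        have "norm (h k y) \<le> M * R ^ k" by (rule MR(4)[OF y])
        also have "\<dots> \<le> M * S ^ k" using RS MR by (intro mult_left_mono power_mono) auto
        finally show "norm (h k y) \<le> M * S ^ k" .
        show "norm (\<Sum>i<k. q i y * g (k - i) y) \<le> (\<Sum>i<k. (K * S ^ i) * (M * R ^ (k - i)))"
          using IH[OF _ y] MR y RS K
          by (intro order_trans[OF norm_sum] sum_mono, unfold norm_mult, intro mult_mono) auto
      qed
      also have "(\<Sum>i<k. (K * S ^ i) * (M * R ^ (k - i))) = K * M * (\<Sum>i<k. S ^ i * R ^ (k - i))"
        by (simp add: sum_distrib_left mult_ac)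
      also have "M * S ^ k + \<dots> \<le> M * S ^ k + K * M * (R / (S - R) * S ^ k)"
        using geometric_sum_ratio[OF MR(2) RS] K MR by (intro add_left_mono mult_left_mono) auto
      also have "\<dots> = 2 * M * S ^ k"
        unfolding ratio K_def using C MR by (simp add: field_simps)
      finally show ?thesis .
    qed
    have qb: "\<forall>y\<in>ball 0 s. norm (q k y) \<le> K * S ^ k" for k
    proof (induction k rule: less_induct)
      case (less k)
      then have "\<forall>y\<in>ball 0 s. norm (w k y) \<le> 2 * M * S ^ k" using wb by blast
      then show ?case unfolding q using D3[OF wh] by (fastforce simp: K_def mult_ac)
    qed
    have "power_family (ball 0 s) q"
      using qh qb K RS MR by (intro power_familyI[of _ _ K S]) auto
    moreover have "norm (r (w k) j) \<le> K * S ^ k" if "j < m" for k j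
      using D4[OF wh _ that] wb qb by (fastforce simp: K_def mult_ac)
    moreover have "h k y = pf_times q g k y + (\<Sum>j<m. r (w k) j * y ^ j)" if y: "y \<in> ball 0 s" for k y
    proof -
      have "pf_times q g k y = (\<Sum>i<k. q i y * g (k - i) y) + q k y * g 0 y"
        unfolding pf_times_def by (simp add: lessThan_Suc_atMost[symmetric])
      moreover have "w k y = q k y * g 0 y + (\<Sum>j<m. r (w k) j * y ^ j)"
        unfolding q using D2[OF wh y] .
      ultimately show ?thesis unfolding w_def by (simp add: algebra_simps)
    qed
    moreover have "0 < S" using RS MR by linarith
    ultimately show ?thesis
      using K by (intro exI[of _ q] exI[of _ "\<lambda>k. r (w k)"], rule_tac exI[of _ K], rule_tac exI[of _ S]) auto
  qed
  then show thesis using that s by blast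
qed

section \<open>An algebraic relation on the zero set\<close>

text \<open>Gaussian elimination without division, so that the coefficients of the relation stay in a given
  subring \<open>A\<close>. It is applied to the ring of convergent power series inside the formal ones.\<close>

lemma linearly_dependent_over_idom:
  fixes A :: "'a::idom set" and r :: "'k \<Rightarrow> 'j \<Rightarrow> 'a"
  assumes ring: "0 \<in> A" "1 \<in> A" "\<And>a b. a \<in> A \<Longrightarrow> b \<in> A \<Longrightarrow> a + b \<in> A"
    "\<And>a b. a \<in> A \<Longrightarrow> b \<in> A \<Longrightarrow> a * b \<in> A" "\<And>a. a \<in> A \<Longrightarrow> - a \<in> A"
    and "finite J" "finite K" "card J < card K" "\<And>k j. k \<in> K \<Longrightarrow> j \<in> J \<Longrightarrow> r k j \<in> A"
  shows "\<exists>a. (\<forall>k\<in>K. a k \<in> A) \<and> (\<exists>k\<in>K. a k \<noteq> 0) \<and> (\<forall>j\<in>J. (\<Sum>k\<in>K. a k * r k j) = 0)"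
  using assms(6-)
proof (induction J arbitrary: K r rule: finite_induct)
  case empty
  then have "K \<noteq> {}" by auto
  then show ?case using ring(2) by (intro exI[of _ "\<lambda>_. 1"]) auto
next
  case (insert p J)
  show ?case
  proof (cases "\<forall>k\<in>K. r k p = 0")
    case True
    obtain a where "(\<forall>k\<in>K. a k \<in> A) \<and> (\<exists>k\<in>K. a k \<noteq> 0) \<and> (\<forall>j\<in>J. (\<Sum>k\<in>K. a k * r k j) = 0)"
      using insert.IH[of K r] insert.prems insert.hyps by auto
    then show ?thesis using True by (intro exI[of _ a]) auto
  next
    case False
    then obtain c where c: "c \<in> K" "r c p \<noteq> 0" by blast
    define K' where "K' = K - {c}"
    have K': "K = insert c K'" "c \<notin> K'" "finite K'" using c insert.prems by (auto simp: K'_def)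
    \<comment> \<open>Cross-multiplication with the pivot \<open>r c p\<close> annihilates column \<open>p\<close>.\<close>
    define r' where "r' = (\<lambda>k j. r c p * r k j + - (r k p * r c j))"
    have r': "r' k j \<in> A" if "k \<in> K'" "j \<in> J" for k j
      unfolding r'_def using that K' c insert.prems(3) by (intro ring) auto
    have "card J < card K'" using insert.prems insert.hyps K' by simp
    then obtain a where a: "\<forall>k\<in>K'. a k \<in> A" "\<exists>k\<in>K'. a k \<noteq> 0" "\<forall>j\<in>J. (\<Sum>k\<in>K'. a k * r' k j) = 0"
      using insert.IH[of K' r'] r' K' by blast
    define t where "t = (\<Sum>k\<in>K'. a k * r k p)"
    define b where "b = (\<lambda>k. if k = c then - t else a k * r c p)"
    have sumA: "sum f F \<in> A" if "finite F" "\<And>x. x \<in> F \<Longrightarrow> f x \<in> A" for f :: "'k \<Rightarrow> 'a" and F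
      using that by (induction F rule: finite_induct) (auto intro: ring)
    have "t \<in> A" unfolding t_def using a(1) insert.prems(3) K' by (intro sumA ring) auto
    then have "\<forall>k\<in>K. b k \<in> A" using a(1) insert.prems(3) c K' by (auto simp: b_def intro!: ring)
    moreover have "\<exists>k\<in>K. b k \<noteq> 0" using a(2) c K' by (auto simp: b_def)
    moreover have "(\<Sum>k\<in>K. b k * r k j) = 0" if j: "j \<in> insert p J" for j
    proof -
      have "(\<Sum>k\<in>K. b k * r k j) = - t * r c j + (\<Sum>k\<in>K'. a k * r c p * r k j)"
        unfolding K'(1) using K'(2,3) by (auto simp: b_def intro!: sum.cong)
      also have "\<dots> = (\<Sum>k\<in>K'. a k * r' k j)"
        by (simp add: t_def r'_def sum_distrib_right sum_distrib_left sum_subtractf algebra_simps)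
      also have "\<dots> = 0" using a(3) j by (auto simp: r'_def mult_ac)
      finally show ?thesis .
    qed
    ultimately show ?thesis by blast
  qed
qed


primrec pf_power :: "(nat \<Rightarrow> complex \<Rightarrow> complex) \<Rightarrow> nat \<Rightarrow> nat \<Rightarrow> complex \<Rightarrow> complex" where
  "pf_power u 0 = (\<lambda>k y. if k = 0 then 1 else 0)"
| "pf_power u (Suc n) = pf_times u (pf_power u n)"

lemma power_family_power:
  assumes "power_family S u"
  shows "power_family S (pf_power u n)"
proof (induction n)
  case 0
  show ?case by (rule power_familyI[of _ _ 1 1]) auto
next
  case (Suc n)
  then show ?case using assms by (simp add: power_family_times)
qed

lemma ev_power:
  assumes "power_family S u"
  shows "eventually (\<lambda>x. \<forall>y\<in>S. ev (pf_power u n) x y = ev u x y ^ n) (nhds 0)"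
proof (induction n)
  case 0
  have "ev (pf_power u 0) x y = 1" for x y
    unfolding ev_def using suminf_finite[of "{0}" "\<lambda>k. (if k = 0 then 1 else 0) * x ^ k"] by simp
  then show ?case by simp
next
  case (Suc n)
  from Suc ev_times[OF assms power_family_power[OF assms, of n]] show ?case
    by eventually_elim simp
qed

lemma eventually_in_disc_of_convergence:
  assumes "0 < fps_conv_radius f"
  shows "eventually (\<lambda>x. ereal (norm x) < fps_conv_radius f) (nhds (0 :: complex))"
proof -
  obtain e where "0 < ereal e" "ereal e < fps_conv_radius f" using ereal_dense2[OF assms] by blast
  then show ?thesis
    by (intro eventually_nhds_0_ballI[of e]) (auto intro: less_trans[of _ "ereal e"])
qed

lemma fps_conv_radius_geometric_bound:
  fixes c :: "nat \<Rightarrow> complex"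
  assumes "0 < R" "\<And>k. norm (c k) \<le> M * R ^ k"
  shows "0 < fps_conv_radius (Abs_fps c)"
proof -
  have "summable (\<lambda>k. c k * complex_of_real (1 / (2 * R)) ^ k)"
  proof (rule summable_comparison_test'[where N = 0, OF summable_half])
    fix k
    have "norm (c k * complex_of_real (1 / (2 * R)) ^ k) \<le> (M * R ^ k) * (1 / (2 * R)) ^ k"
      unfolding norm_mult norm_power norm_of_real
      using assms order_trans[OF norm_ge_zero assms(2)] by (intro mult_mono) auto
    also have "\<dots> = M * (1/2) ^ k" using assms by (simp add: power_mult_distrib power_divide)
    finally show "norm (c k * complex_of_real (1 / (2 * R)) ^ k) \<le> M * (1/2) ^ k" .
  qed
  then have "ereal (norm (complex_of_real (1 / (2 * R)))) \<le> conv_radius c" by (rule conv_radius_geI)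
  moreover have "0 < ereal (norm (complex_of_real (1 / (2 * R))))" using assms(1) by simp
  ultimately have "0 < conv_radius c" by (rule less_le_trans[rotated])
  moreover have "fps_nth (Abs_fps c) = c" by (simp add: fun_eq_iff)
  ultimately show ?thesis unfolding fps_conv_radius_def by simp
qed

text \<open>Evaluation of convergent power series near \<open>0\<close> commutes with the ring operations; the
  neighbourhood depends on the series involved.\<close>

lemma eval_fps_sum_mult:
  fixes a r :: "'k \<Rightarrow> complex fps"
  assumes "finite K" "\<And>k. k \<in> K \<Longrightarrow> 0 < fps_conv_radius (a k)" "\<And>k. k \<in> K \<Longrightarrow> 0 < fps_conv_radius (r k)"
  shows "0 < fps_conv_radius (\<Sum>k\<in>K. a k * r k) \<and>
    eventually (\<lambda>x. eval_fps (\<Sum>k\<in>K. a k * r k) x = (\<Sum>k\<in>K. eval_fps (a k) x * eval_fps (r k) x)) (nhds 0)"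
  using assms
proof (induction K rule: finite_induct)
  case empty
  then show ?case by simp
next
  case (insert c K)
  let ?s = "\<Sum>k\<in>K. a k * r k"
  have s: "0 < fps_conv_radius ?s" using insert by auto
  have p: "0 < fps_conv_radius (a c * r c)"
    using fps_conv_radius_mult[of "a c" "r c"] insert.prems by (meson insertI1 less_le_trans min_less_iff_conj)
  have "0 < fps_conv_radius (a c * r c + ?s)"
    using fps_conv_radius_add[of "a c * r c" ?s] s p by (meson less_le_trans min_less_iff_conj)
  moreover have "eventually (\<lambda>x. eval_fps (a c * r c + ?s) x =
      eval_fps (a c) x * eval_fps (r c) x + (\<Sum>k\<in>K. eval_fps (a k) x * eval_fps (r k) x)) (nhds 0)"
    using eventually_in_disc_of_convergence[OF s] eventually_in_disc_of_convergence[OF p]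
      eventually_in_disc_of_convergence[OF insert.prems(1)[OF insertI1]]
      eventually_in_disc_of_convergence[OF insert.prems(2)[OF insertI1]]
      insert.IH[THEN conjunct2, OF insert.prems(1) insert.prems(2), OF insertI2 insertI2, simplified]
    by eventually_elim (simp add: eval_fps_add eval_fps_mult)
  ultimately show ?case using insert.hyps by simp
qed

text \<open>Modulo \<open>g\<close>, each of the \<open>m + 1\<close> powers \<open>1, h, \<dots>, h ^ m\<close> is a combination of \<open>1, y, \<dots>, y ^ (m - 1)\<close>
  with coefficients in the ring of convergent power series in \<open>x\<close>. Hence these powers are linearly
  dependent over that ring, so on the zero set of \<open>g\<close> the values of \<open>h\<close> are algebraic over
  functions of \<open>x\<close> alone. This replaces the resultant of \<open>g\<close> and \<open>h\<close>.\<close>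

lemma algebraic_relation_on_zero_set:
  assumes g: "power_family (ball 0 \<rho>) g" and h: "power_family (ball 0 \<rho>) h"
    and "0 < \<rho>" and ord: "(deriv ^^ n) (g 0) 0 \<noteq> 0"
  obtains m s and a :: "nat \<Rightarrow> complex fps" where "0 < s" "s \<le> \<rho>" "\<exists>k\<le>m. a k \<noteq> 0"
    "\<forall>k\<le>m. 0 < fps_conv_radius (a k)"
    "eventually (\<lambda>x. \<forall>y\<in>ball 0 s. ev g x y = 0 \<longrightarrow> (\<Sum>k\<le>m. eval_fps (a k) x * ev h x y ^ k) = 0) (nhds 0)"
proof -
  obtain m s where s: "0 < s" "s \<le> \<rho>"
    and div: "\<And>h. power_family (ball 0 \<rho>) h \<Longrightarrow> \<exists>q r M R. power_family (ball 0 s) q \<and> 0 < M \<and> 0 < R \<and>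
       (\<forall>k. \<forall>j<m. norm (r k j) \<le> M * R ^ k) \<and>
       (\<forall>k. \<forall>y\<in>ball 0 s. h k y = pf_times q g k y + (\<Sum>j<m. r k j * y ^ j))"
    by (rule power_family_division[OF g \<open>0 < \<rho>\<close> ord]) (rule that)
  have gs: "power_family (ball 0 s) g" by (rule power_family_mono[OF g]) (use s in auto)
  have "\<forall>n. \<exists>r :: nat \<Rightarrow> complex fps. (\<forall>j<m. 0 < fps_conv_radius (r j)) \<and>
     eventually (\<lambda>x. \<forall>y\<in>ball 0 s. ev g x y = 0 \<longrightarrow> ev h x y ^ n = (\<Sum>j<m. eval_fps (r j) x * y ^ j)) (nhds 0)"
  proof
    fix n
    let ?h = "pf_power h n"
    have hn: "power_family (ball 0 \<rho>) ?h" by (rule power_family_power[OF h])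
    obtain q r M R where q: "power_family (ball 0 s) q" and R: "0 < R"
      and r: "\<forall>k. \<forall>j<m. norm (r k j) \<le> M * R ^ k"
      and eq: "\<forall>k. \<forall>y\<in>ball 0 s. ?h k y = pf_times q g k y + (\<Sum>j<m. r k j * y ^ j)"
      using div[OF hn] by blast
    define F where "F = (\<lambda>j. Abs_fps (\<lambda>k. r k j))"
    have F: "0 < fps_conv_radius (F j)" if "j < m" for j
      unfolding F_def using r that by (intro fps_conv_radius_geometric_bound[OF R]) auto
    have "eventually (\<lambda>x. \<forall>j\<in>{..<m}. ereal (norm x) < fps_conv_radius (F j)) (nhds (0::complex))"
      using F by (intro eventually_ball_finite) (auto intro: eventually_in_disc_of_convergence)
    with ev_power[OF h, of n] ev_times[OF q gs] power_family_summable[OF power_family_times[OF q gs]]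
    have "eventually (\<lambda>x. \<forall>y\<in>ball 0 s. ev g x y = 0 \<longrightarrow> ev h x y ^ n = (\<Sum>j<m. eval_fps (F j) x * y ^ j)) (nhds 0)"
    proof eventually_elim
      case (elim x)
      show ?case
      proof (intro ballI impI)
        fix y assume y: "y \<in> ball (0::complex) s" and z: "ev g x y = 0"
        have 1: "(\<lambda>k. pf_times q g k y * x ^ k) sums 0"
          using elim y z by (auto simp: ev_def sums_iff summable_norm_cancel)
        have 2: "(\<lambda>k. F j $ k * x ^ k) sums eval_fps (F j) x" if "j < m" for j
          unfolding eval_fps_def using elim that by (intro summable_sums summable_fps) auto
        have "(\<lambda>k. pf_times q g k y * x ^ k + (\<Sum>j<m. y ^ j * (F j $ k * x ^ k)))
            sums (0 + (\<Sum>j<m. y ^ j * eval_fps (F j) x))"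
          using 2 by (intro sums_add 1 sums_sum sums_mult) auto
        moreover have "pf_times q g k y * x ^ k + (\<Sum>j<m. y ^ j * (F j $ k * x ^ k)) = ?h k y * x ^ k" for k
          using eq y by (simp add: F_def algebra_simps sum_distrib_left)
        ultimately have "ev ?h x y = (\<Sum>j<m. y ^ j * eval_fps (F j) x)"
          unfolding ev_def by (simp add: sums_iff)
        then show "ev h x y ^ n = (\<Sum>j<m. eval_fps (F j) x * y ^ j)"
          using elim(1) y s by (auto simp: mult_ac)
      qed
    qed
    with F show "\<exists>r :: nat \<Rightarrow> complex fps. (\<forall>j<m. 0 < fps_conv_radius (r j)) \<and>
      eventually (\<lambda>x. \<forall>y\<in>ball 0 s. ev g x y = 0 \<longrightarrow> ev h x y ^ n = (\<Sum>j<m. eval_fps (r j) x * y ^ j)) (nhds 0)"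
      by blast
  qed
  from choice[OF this] obtain r :: "nat \<Rightarrow> nat \<Rightarrow> complex fps" where r: "\<And>n j. j < m \<Longrightarrow> 0 < fps_conv_radius (r n j)"
    and ev_r: "\<And>n. eventually (\<lambda>x. \<forall>y\<in>ball 0 s. ev g x y = 0 \<longrightarrow> ev h x y ^ n = (\<Sum>j<m. eval_fps (r n j) x * y ^ j)) (nhds 0)"
    by blast
  have "\<exists>a. (\<forall>k\<in>{..m}. a k \<in> {f. 0 < fps_conv_radius f}) \<and> (\<exists>k\<in>{..m}. a k \<noteq> 0) \<and>
      (\<forall>j\<in>{..<m}. (\<Sum>k\<in>{..m}. a k * r k j) = 0)"
  proof (rule linearly_dependent_over_idom)
    fix f g :: "complex fps" assume fg: "f \<in> {f. 0 < fps_conv_radius f}" "g \<in> {f. 0 < fps_conv_radius f}"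
    show "f + g \<in> {f. 0 < fps_conv_radius f}" "f * g \<in> {f. 0 < fps_conv_radius f}"
      using fps_conv_radius_add[of f g] fps_conv_radius_mult[of f g] fg
      by (auto intro: less_le_trans[where y = "min (fps_conv_radius f) (fps_conv_radius g)"])
  qed (use r in auto)
  then obtain a where a: "\<forall>k\<le>m. 0 < fps_conv_radius (a k)" "\<exists>k\<le>m. a k \<noteq> 0"
    "\<And>j. j < m \<Longrightarrow> (\<Sum>k\<le>m. a k * r k j) = 0" by auto
  have "eventually (\<lambda>x. \<forall>j\<in>{..<m}. eval_fps (\<Sum>k\<le>m. a k * r k j) x = (\<Sum>k\<le>m. eval_fps (a k) x * eval_fps (r k j) x)) (nhds 0)"
  proof (intro eventually_ball_finite ballI)
    fix j assume "j \<in> {..<m}"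
    then show "eventually (\<lambda>x. eval_fps (\<Sum>k\<le>m. a k * r k j) x = (\<Sum>k\<le>m. eval_fps (a k) x * eval_fps (r k j) x)) (nhds 0)"
      using a(1) r by (intro eval_fps_sum_mult[THEN conjunct2]) auto
  qed simp
  moreover have "eventually (\<lambda>x. \<forall>k\<in>{..m}. \<forall>y\<in>ball 0 s. ev g x y = 0 \<longrightarrow> ev h x y ^ k = (\<Sum>j<m. eval_fps (r k j) x * y ^ j)) (nhds 0)"
    using ev_r by (intro eventually_ball_finite) auto
  ultimately have "eventually (\<lambda>x. \<forall>y\<in>ball 0 s. ev g x y = 0 \<longrightarrow> (\<Sum>k\<le>m. eval_fps (a k) x * ev h x y ^ k) = 0) (nhds 0)"
  proof eventually_elim
    case (elim x)
    show ?case
    proof (intro ballI impI)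
      fix y assume y: "y \<in> ball (0::complex) s" and z: "ev g x y = 0"
      have "(\<Sum>k\<le>m. eval_fps (a k) x * ev h x y ^ k) = (\<Sum>k\<le>m. \<Sum>j<m. eval_fps (a k) x * (eval_fps (r k j) x * y ^ j))"
        using elim(2) y z by (intro sum.cong) (auto simp: sum_distrib_left)
      also have "\<dots> = (\<Sum>j<m. (\<Sum>k\<le>m. eval_fps (a k) x * eval_fps (r k j) x) * y ^ j)"
        by (subst sum.swap) (simp add: sum_distrib_right mult.assoc)
      also have "\<dots> = 0"
        using elim(1) a(3) by (intro sum.neutral) (auto simp flip: elim)
      finally show "(\<Sum>k\<le>m. eval_fps (a k) x * ev h x y ^ k) = 0" .
    qed
  qed
  then show thesis using that s a(1,2) by blast
qed

section \<open>Signs along zero arcs\<close>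

definition real_family :: "complex set \<Rightarrow> (nat \<Rightarrow> complex \<Rightarrow> complex) \<Rightarrow> bool" where
  "real_family S u \<longleftrightarrow> (\<forall>k t. complex_of_real t \<in> S \<longrightarrow> u k (of_real t) \<in> \<real>)"

text \<open>The value at real arguments; the real part loses nothing if the coefficients are real on the real
  axis.\<close>

definition real_ev :: "(nat \<Rightarrow> complex \<Rightarrow> complex) \<Rightarrow> real \<Rightarrow> real \<Rightarrow> real" where
  "real_ev u x y = Re (ev u (of_real x) (of_real y))"

lemma eventually_nhds_of_real:
  assumes "eventually P (nhds (0::complex))"
  shows "eventually (\<lambda>x. P (complex_of_real x)) (nhds 0)"
proof (rule eventually_compose_filterlim[OF assms])
  have "(complex_of_real \<longlongrightarrow> of_real 0) (nhds 0)" by (intro tendsto_of_real filterlim_ident)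
  then show "filterlim complex_of_real (nhds 0) (nhds 0)" by simp
qed

lemma eventually_nhds_imp_at_right:
  "eventually P (nhds (0::real)) \<Longrightarrow> eventually P (at_right 0)"
  unfolding at_within_def by (rule filter_leD[OF inf_le1])

lemma real_ev_eq:
  assumes "power_family S u" "real_family S u"
  shows "eventually (\<lambda>x. \<forall>y. complex_of_real y \<in> S \<longrightarrow> ev u (of_real x) (of_real y) = of_real (real_ev u x y)) (nhds 0)"
  using eventually_nhds_of_real[OF power_family_summable[OF assms(1)]]
proof eventually_elim
  case (elim x)
  show ?case
  proof (intro allI impI)
    fix y assume y: "complex_of_real y \<in> S"
    have "summable (\<lambda>k. u k (of_real y) * of_real x ^ k)"
      using elim y by (auto intro: summable_norm_cancel)
    moreover have "u k (of_real y) * of_real x ^ k \<in> \<real>" for k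
      using assms(2) y by (auto simp: real_family_def)
    then have "Im (u k (of_real y) * of_real x ^ k) = 0" for k
      by (simp only: complex_is_Real_iff)
    ultimately have "ev u (of_real x) (of_real y) \<in> \<real>"
      unfolding ev_def complex_is_Real_iff by (subst Im_suminf) (assumption, simp only: suminf_zero)
    then show "ev u (of_real x) (of_real y) = of_real (real_ev u x y)" by (simp add: real_ev_def)
  qed
qed

lemma real_ev_continuous:
  assumes "power_family (ball 0 \<rho>) u"
  shows "\<exists>e>0. continuous_on ({-e<..<e} \<times> {-\<rho><..<\<rho>}) (\<lambda>(x, y). real_ev u x y)"
proof -
  obtain d where d: "d > 0" "continuous_on (ball 0 d \<times> ball 0 \<rho>) (\<lambda>(x, y). ev u x y)"
    using ev_continuous[OF assms] by blast
  have "continuous_on ({-d<..<d} \<times> {-\<rho><..<\<rho>}) (\<lambda>p. ev u (of_real (fst p)) (of_real (snd p)))"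
  proof -
    have "continuous_on ({-d<..<d} \<times> {-\<rho><..<\<rho>}) (\<lambda>p. (\<lambda>(x, y). ev u x y) (complex_of_real (fst p), complex_of_real (snd p)))"
      by (rule continuous_on_compose2[OF d(2)]) (auto intro!: continuous_intros)
    then show ?thesis by simp
  qed
  then have c: "continuous_on ({-d<..<d} \<times> {-\<rho><..<\<rho>}) (\<lambda>(x, y). real_ev u x y)"
    unfolding real_ev_def case_prod_unfold by (rule continuous_on_Re)
  then show ?thesis using d(1) by blast
qed

lemma real_ev_deriv:
  assumes "power_family (ball 0 \<rho>) u" "0 < \<rho>"
  shows "eventually (\<lambda>x. \<forall>y. \<bar>y\<bar> < \<rho> / 2 \<longrightarrow>
           (real_ev u x has_real_derivative real_ev (\<lambda>k. deriv (u k)) x y) (at y)) (nhds 0)"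
  using eventually_nhds_of_real[OF ev_deriv[OF assms]]
proof eventually_elim
  case (elim x)
  show ?case
  proof (intro allI impI)
    fix y :: real assume "\<bar>y\<bar> < \<rho> / 2"
    then have "(ev u (of_real x) has_field_derivative ev (\<lambda>k. deriv (u k)) (of_real x) (of_real y)) (at (of_real y))"
      using elim by simp
    then show "(real_ev u x has_real_derivative real_ev (\<lambda>k. deriv (u k)) x y) (at y)"
      unfolding real_ev_def[abs_def] by (intro has_field_derivative_Re has_vector_derivative_real_field)
  qed
qed

lemma real_ev_near_first:
  assumes "power_family (ball 0 \<rho>) u" "0 < \<epsilon>"
  shows "eventually (\<lambda>x. \<forall>y. \<bar>y\<bar> < \<rho> \<longrightarrow> \<bar>real_ev u x y - Re (u 0 (of_real y))\<bar> < \<epsilon>) (nhds 0)"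
  using eventually_nhds_of_real[OF ev_near_first[OF assms]]
proof eventually_elim
  case (elim x)
  show ?case
  proof (intro allI impI)
    fix y :: real assume "\<bar>y\<bar> < \<rho>"
    then have "norm (ev u (of_real x) (of_real y) - u 0 (of_real y)) < \<epsilon>" using elim by simp
    then show "\<bar>real_ev u x y - Re (u 0 (of_real y))\<bar> < \<epsilon>"
      unfolding real_ev_def using abs_Re_le_cmod[of "ev u (of_real x) (of_real y) - u 0 (of_real y)"] by simp
  qed
qed

text \<open>A function that is real on the real axis has a real derivative there, because the imaginary part
  of its restriction is constant.\<close>

lemma real_family_deriv:
  assumes "power_family (ball 0 \<rho>) u" "real_family (ball 0 \<rho>) u"
  shows "real_family (ball 0 (\<rho> / 2)) (\<lambda>k. deriv (u k))"
  unfolding real_family_def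
proof (intro allI impI)
  fix k t assume "complex_of_real t \<in> ball 0 (\<rho> / 2)"
  then have t: "\<bar>t\<bar> < \<rho>" by auto
  have "(u k has_field_derivative deriv (u k) (of_real t)) (at (of_real t))"
    using assms(1) t unfolding power_family_def by (intro holomorphic_derivI[of _ "ball 0 \<rho>"]) auto
  then have "((\<lambda>x. Im (u k (of_real x))) has_real_derivative Im (deriv (u k) (of_real t))) (at t)"
    by (intro has_field_derivative_Im has_vector_derivative_real_field)
  moreover have "eventually (\<lambda>x. x \<in> {-\<rho><..<\<rho>}) (nhds t)"
    using t by (intro eventually_nhds_in_open) auto
  then have "eventually (\<lambda>x. Im (u k (of_real x)) = 0) (nhds t)"
    by eventually_elim (use assms(2) in \<open>auto simp: real_family_def complex_is_Real_iff\<close>)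
  ultimately have "((\<lambda>x. 0) has_real_derivative Im (deriv (u k) (of_real t))) (at t)"
    by (subst (asm) DERIV_cong_ev) auto
  then have "Im (deriv (u k) (of_real t)) = 0" using DERIV_const DERIV_unique by blast
  then show "deriv (u k) (of_real t) \<in> \<real>" by (simp add: complex_is_Real_iff)
qed

lemma sgn_constant_of_nonvanishing:
  fixes \<phi> :: "real \<Rightarrow> real"
  assumes "continuous_on {a<..<b} \<phi>" "\<And>x. x \<in> {a<..<b} \<Longrightarrow> \<phi> x \<noteq> 0"
  shows "\<exists>s. \<forall>x\<in>{a<..<b}. sgn (\<phi> x) = s"
proof (rule ccontr)
  assume "\<not> ?thesis"
  then obtain x y where xy: "x \<in> {a<..<b}" "y \<in> {a<..<b}" "sgn (\<phi> x) \<noteq> sgn (\<phi> y)" by blast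
  have "connected (\<phi> ` {a<..<b})" using assms(1) by (intro connected_continuous_image) auto
  moreover have "min (\<phi> x) (\<phi> y) \<in> \<phi> ` {a<..<b}" "max (\<phi> x) (\<phi> y) \<in> \<phi> ` {a<..<b}"
    using xy by (auto simp: min_def max_def)
  moreover have "min (\<phi> x) (\<phi> y) \<le> 0" "0 \<le> max (\<phi> x) (\<phi> y)"
    using xy(3) by (auto simp: sgn_if min_def max_def split: if_splits)
  ultimately have "0 \<in> \<phi> ` {a<..<b}"
    by (meson connected_contains_Icc[of "\<phi> ` {a<..<b}"] atLeastAtMost_iff subsetD)
  then show False using assms(2) by auto
qed

text \<open>If the lowest coefficient \<open>A l\<close> of the relation has no zeros, then \<open>\<phi> ^ l * \<psi> = 0\<close> for a
  continuous function \<open>\<psi>\<close> that equals \<open>A l \<noteq> 0\<close> wherever \<open>\<phi>\<close> vanishes. So the closed set of zeros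
  of \<open>\<phi>\<close> is also open, and \<open>\<phi>\<close> either vanishes identically or has no zeros.\<close>

lemma sgn_constant_of_algebraic_relation:
  fixes \<phi> :: "real \<Rightarrow> real" and A :: "nat \<Rightarrow> real \<Rightarrow> complex"
  assumes \<phi>: "continuous_on {0<..<\<eta>} \<phi>"
    and A: "\<And>k. k \<le> m \<Longrightarrow> continuous_on {0<..<\<eta>} (A k)"
    and rel: "\<And>x. x \<in> {0<..<\<eta>} \<Longrightarrow> (\<Sum>k\<le>m. A k x * of_real (\<phi> x) ^ k) = 0"
    and l: "l \<le> m" "\<And>x. x \<in> {0<..<\<eta>} \<Longrightarrow> A l x \<noteq> 0" "\<And>k x. k < l \<Longrightarrow> x \<in> {0<..<\<eta>} \<Longrightarrow> A k x = 0"
  shows "\<exists>s. \<forall>x\<in>{0<..<\<eta>}. sgn (\<phi> x) = s"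
proof -
  define \<psi> where "\<psi> = (\<lambda>x. \<Sum>k\<in>{l..m}. A k x * of_real (\<phi> x) ^ (k - l))"
  have c\<psi>: "continuous_on {0<..<\<eta>} \<psi>"
    unfolding \<psi>_def using A \<phi> by (intro continuous_intros) auto
  have split: "of_real (\<phi> x) ^ l * \<psi> x = 0" if x: "x \<in> {0<..<\<eta>}" for x
  proof -
    have "(\<Sum>k\<le>m. A k x * of_real (\<phi> x) ^ k) = (\<Sum>k\<in>{l..m}. A k x * of_real (\<phi> x) ^ k)"
      using l(3) x by (intro sum.mono_neutral_right) auto
    also have "\<dots> = of_real (\<phi> x) ^ l * \<psi> x"
      unfolding \<psi>_def sum_distrib_left
      by (intro sum.cong) (auto simp: mult_ac simp flip: power_add)
    finally show ?thesis using rel[OF x] by simp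
  qed
  have at_zero: "\<psi> x \<noteq> 0" if "x \<in> {0<..<\<eta>}" "\<phi> x = 0" for x
  proof -
    have "\<psi> x = (\<Sum>k\<in>{l}. A k x * of_real (\<phi> x) ^ (k - l))"
      unfolding \<psi>_def using l(1) that(2) by (intro sum.mono_neutral_right) auto
    then show ?thesis using l(2) that by simp
  qed
  \<comment> \<open>The zero set of \<open>\<phi>\<close> is the set where \<open>\<psi>\<close> does not vanish.\<close>
  define Z where "Z = {x \<in> {0<..<\<eta>}. \<phi> x \<in> {0}}"
  have "Z = {x \<in> {0<..<\<eta>}. \<psi> x \<in> - {0}}"
    unfolding Z_def using split at_zero by fastforce
  then have "openin (top_of_set {0<..<\<eta>}) Z"
    using continuous_openin_preimage_gen[OF c\<psi>, of "- {0}"]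
    by (simp add: vimage_def Int_def conj_commute open_Compl)
  moreover have "closedin (top_of_set {0<..<\<eta>}) Z"
    using continuous_closedin_preimage[OF \<phi>, of "{0}"] by (simp add: Z_def vimage_def Int_def conj_commute)
  ultimately have "Z = {} \<or> Z = {0<..<\<eta>}"
    using connected_clopen[of "{0<..<\<eta>}"] by auto
  then show ?thesis
  proof
    assume "Z = {}"
    then have "\<phi> x \<noteq> 0" if "x \<in> {0<..<\<eta>}" for x using that unfolding Z_def by blast
    then show ?thesis by (rule sgn_constant_of_nonvanishing[OF \<phi>])
  next
    assume "Z = {0<..<\<eta>}"
    then have "\<phi> x = 0" if "x \<in> {0<..<\<eta>}" for x using that unfolding Z_def by blast
    then show ?thesis by simp
  qed
qed

lemma fps_eventually_nonzero:
  fixes F :: "complex fps"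
  assumes "0 < fps_conv_radius F" "F \<noteq> 0"
  shows "eventually (\<lambda>x. eval_fps F x \<noteq> 0) (at 0)"
  by (rule has_laurent_expansion_nonzero_imp_eventually_nonzero[of _ "fps_to_fls F"])
     (use assms eval_fps_has_fps_expansion has_laurent_expansion_fps in auto)

text \<open>The analytic substitute for the finiteness theorems of semianalytic geometry: an analytic function
  cannot oscillate along an arc on which another analytic function \<open>g\<close> vanishes, provided that \<open>g\<close>
  has finite order in \<open>y\<close>. The algebraic relation reduces this to the fact that a nonzero
  convergent power series in one variable has isolated zeros.\<close>

lemma sign_along_zero_arc:
  assumes g: "power_family (ball 0 \<rho>) g" and h: "power_family (ball 0 \<rho>) h" "real_family (ball 0 \<rho>) h"
    and "0 < \<rho>" and ord: "(deriv ^^ n) (g 0) 0 \<noteq> 0"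
    and \<xi>: "0 < \<eta>" "continuous_on {0<..<\<eta>} \<xi>" "(\<xi> \<longlongrightarrow> 0) (at_right 0)"
    and zero: "\<And>x. x \<in> {0<..<\<eta>} \<Longrightarrow> ev g (of_real x) (of_real (\<xi> x)) = 0"
  shows "\<exists>s. eventually (\<lambda>x. sgn (real_ev h x (\<xi> x)) = s) (at_right 0)"
proof -
  obtain m s and a :: "nat \<Rightarrow> complex fps" where s: "0 < s" "s \<le> \<rho>"
    and a: "\<exists>k\<le>m. a k \<noteq> 0" "\<forall>k\<le>m. 0 < fps_conv_radius (a k)"
    and rel: "eventually (\<lambda>x. \<forall>y\<in>ball 0 s. ev g x y = 0 \<longrightarrow> (\<Sum>k\<le>m. eval_fps (a k) x * ev h x y ^ k) = 0) (nhds 0)"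
    by (rule algebraic_relation_on_zero_set[OF g h(1) \<open>0 < \<rho>\<close> ord]) (rule that)
  \<comment> \<open>Coefficients below the lowest nonzero one drop out of the relation.\<close>
  define l where "l = (LEAST k. a k \<noteq> 0)"
  have l: "l \<le> m" "a l \<noteq> 0" "\<And>k. k < l \<Longrightarrow> a k = 0"
  proof -
    obtain k where k: "k \<le> m" "a k \<noteq> 0" using a by blast
    show "a l \<noteq> 0" unfolding l_def by (rule LeastI[of "\<lambda>k. a k \<noteq> 0", OF k(2)])
    show "l \<le> m" unfolding l_def using Least_le[of "\<lambda>k. a k \<noteq> 0", OF k(2)] k(1) by simp
    show "a k = 0" if "k < l" for k using not_less_Least[of k "\<lambda>k. a k \<noteq> 0"] that unfolding l_def by blast
  qed
  have lim0: "filterlim complex_of_real (at 0) (at_right 0)"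
  proof (rule filterlim_atI)
    have "(complex_of_real \<longlongrightarrow> of_real 0) (at_right 0)" by (intro tendsto_intros)
    then show "(complex_of_real \<longlongrightarrow> 0) (at_right 0)" by simp
  qed (simp add: eventually_at_filter)
  have "eventually (\<lambda>x. eval_fps (a l) x \<noteq> 0) (at 0)"
    using a(2) l(1,2) by (intro fps_eventually_nonzero) auto
  from eventually_compose_filterlim[OF this lim0]
  have E1: "eventually (\<lambda>x. eval_fps (a l) (complex_of_real x) \<noteq> 0) (at_right 0)" .
  have "eventually (\<lambda>x. \<forall>k\<in>{..m}. ereal (norm x) < fps_conv_radius (a k)) (nhds (0::complex))"
    using a(2) by (intro eventually_ball_finite) (auto intro: eventually_in_disc_of_convergence)
  from eventually_nhds_imp_at_right[OF eventually_nhds_of_real[OF this]]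
  have E2: "eventually (\<lambda>x. \<forall>k\<in>{..m}. ereal (norm (complex_of_real x)) < fps_conv_radius (a k)) (at_right 0)" .
  have E3: "eventually (\<lambda>x. \<bar>\<xi> x\<bar> < s) (at_right 0)"
    using tendstoD[OF \<xi>(3) s(1)] by simp
  have E4: "eventually (\<lambda>x. x < \<eta>) (at_right 0)"
    using \<xi>(1) by (auto simp: eventually_at_right_field)
  note E5 = eventually_nhds_imp_at_right[OF eventually_nhds_of_real[OF rel]]
  note E6 = eventually_nhds_imp_at_right[OF real_ev_eq[OF h]]
  obtain e where e: "0 < e" "continuous_on ({-e<..<e} \<times> {-\<rho><..<\<rho>}) (\<lambda>(x, y). real_ev h x y)"
    using real_ev_continuous[OF h(1)] by blast
  have "eventually (\<lambda>x. x < e) (at_right 0)"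
    using e(1) by (auto simp: eventually_at_right_field)
  with E1 E2 E3 E4 E5 E6 have "eventually (\<lambda>x. eval_fps (a l) (complex_of_real x) \<noteq> 0 \<and>
      (\<forall>k\<in>{..m}. ereal (norm (complex_of_real x)) < fps_conv_radius (a k)) \<and> \<bar>\<xi> x\<bar> < s \<and> x < \<eta> \<and> x < e \<and>
      (ev g (of_real x) (of_real (\<xi> x)) = 0 \<longrightarrow> (\<Sum>k\<le>m. eval_fps (a k) (of_real x) * of_real (real_ev h x (\<xi> x)) ^ k) = 0)) (at_right 0)"
  proof eventually_elim
    case (elim x)
    have "complex_of_real (\<xi> x) \<in> ball 0 s" "complex_of_real (\<xi> x) \<in> ball 0 \<rho>" using elim s by auto
    then show ?case using elim by auto
  qed
  then obtain d where d: "0 < d" and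
    D: "\<And>x. x \<in> {0<..<d} \<Longrightarrow> eval_fps (a l) (complex_of_real x) \<noteq> 0 \<and>
      (\<forall>k\<in>{..m}. ereal (norm (complex_of_real x)) < fps_conv_radius (a k)) \<and> \<bar>\<xi> x\<bar> < s \<and> x < \<eta> \<and> x < e \<and>
      (ev g (of_real x) (of_real (\<xi> x)) = 0 \<longrightarrow> (\<Sum>k\<le>m. eval_fps (a k) (of_real x) * of_real (real_ev h x (\<xi> x)) ^ k) = 0)"
    unfolding eventually_at_right_field by auto
  have "\<exists>s. \<forall>x\<in>{0<..<d}. sgn (real_ev h x (\<xi> x)) = s"
  proof (rule sgn_constant_of_algebraic_relation[where A = "\<lambda>k x. eval_fps (a k) (of_real x)" and m = m and l = l])
    have "continuous_on {0<..<d} (\<lambda>x. (\<lambda>(x, y). real_ev h x y) (x, \<xi> x))"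
    proof (rule continuous_on_compose2[OF e(2)])
      show "continuous_on {0<..<d} (\<lambda>x. (x, \<xi> x))"
        using D by (intro continuous_intros continuous_on_subset[OF \<xi>(2)]) force
      show "(\<lambda>x. (x, \<xi> x)) ` {0<..<d} \<subseteq> {- e<..<e} \<times> {- \<rho><..<\<rho>}"
        using D s e by (fastforce simp: abs_less_iff)
    qed
    then show "continuous_on {0<..<d} (\<lambda>x. real_ev h x (\<xi> x))" by simp
    show "continuous_on {0<..<d} (\<lambda>x. eval_fps (a k) (complex_of_real x))" if "k \<le> m" for k
      using D that by (intro continuous_intros) (auto simp: eball_def)
    show "(\<Sum>k\<le>m. eval_fps (a k) (of_real x) * of_real (real_ev h x (\<xi> x)) ^ k) = 0" if "x \<in> {0<..<d}" for x
      using D[OF that] zero[of x] that by auto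
  qed (use l D in auto)
  then show ?thesis using d unfolding eventually_at_right_field by (metis greaterThanLessThan_iff)
qed

section \<open>Local structure of the real zero set\<close>

text \<open>Listing the arcs from bottom to top makes the zeros between neighbouring arcs of the derivative
  accessible to induction over the list.\<close>

definition ordered_arcs :: "real \<Rightarrow> (real \<Rightarrow> real) list \<Rightarrow> bool" where
  "ordered_arcs \<eta> fs \<longleftrightarrow> (\<forall>f\<in>set fs. continuous_on {0<..<\<eta>} f) \<and>
     sorted_wrt (\<lambda>f g. \<forall>x\<in>{0<..<\<eta>}. f x < g x) fs"

text \<open>Between two consecutive zero arcs of the derivative the function is strictly monotone in \<open>y\<close>. It
  has a zero there precisely if its signs on the two arcs are opposite, and this zero is unique
  and, by the intermediate value theorem, depends continuously on \<open>x\<close>.\<close>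

lemma zero_arc_between:
  fixes F F' :: "real \<Rightarrow> real \<Rightarrow> real"
  assumes F: "continuous_on ({0<..<\<eta>} \<times> {-D<..<D}) (\<lambda>(x, y). F x y)"
    and F': "\<And>x y. x \<in> {0<..<\<eta>} \<Longrightarrow> y \<in> {-D<..<D} \<Longrightarrow> (F x has_real_derivative F' x y) (at y)"
    and l: "continuous_on {0<..<\<eta>} l" "\<And>x. x \<in> {0<..<\<eta>} \<Longrightarrow> - D < l x"
    and r: "continuous_on {0<..<\<eta>} r" "\<And>x. x \<in> {0<..<\<eta>} \<Longrightarrow> r x < D"
    and lr: "\<And>x. x \<in> {0<..<\<eta>} \<Longrightarrow> l x < r x"
    and nz: "\<And>x y. x \<in> {0<..<\<eta>} \<Longrightarrow> l x < y \<Longrightarrow> y < r x \<Longrightarrow> F' x y \<noteq> 0"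
    and sl: "\<And>x. x \<in> {0<..<\<eta>} \<Longrightarrow> sgn (F x (l x)) = sl"
    and sr: "\<And>x. x \<in> {0<..<\<eta>} \<Longrightarrow> sgn (F x (r x)) = sr"
  shows "\<exists>fs. ordered_arcs \<eta> fs \<and> (\<forall>f\<in>set fs. \<forall>x\<in>{0<..<\<eta>}. l x < f x \<and> f x < r x) \<and>
    (\<forall>x\<in>{0<..<\<eta>}. \<forall>y. l x < y \<and> y < r x \<longrightarrow> (F x y = 0 \<longleftrightarrow> (\<exists>f\<in>set fs. y = f x)))"
proof -
  have cy: "continuous_on {l x..r x} (F x)" if x: "x \<in> {0<..<\<eta>}" for x
  proof (rule continuous_at_imp_continuous_on, rule ballI)
    fix y assume "y \<in> {l x..r x}"
    then have "y \<in> {-D<..<D}" using l(2) r(2) x by force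
    then show "isCont (F x) y" using F' x DERIV_isCont by blast
  qed
  have inj: "inj_on (F x) {l x..r x}" if x: "x \<in> {0<..<\<eta>}" for x
  proof (rule linorder_inj_onI)
    show "y \<le> z \<or> z \<le> y" for y z :: real by linarith
    fix y z assume yz: "y < z" "y \<in> {l x..r x}" "z \<in> {l x..r x}"
    show "F x y \<noteq> F x z"
    proof
      assume "F x y = F x z"
      then have "\<exists>w. y < w \<and> w < z \<and> (F x has_real_derivative 0) (at w)"
      proof (intro Rolle)
        show "continuous_on {y..z} (F x)" using yz by (intro continuous_on_subset[OF cy[OF x]]) auto
        fix w assume w: "y < w" "w < z"
        then have "w \<in> {-D<..<D}" using l(2)[OF x] r(2)[OF x] yz by auto
        then show "F x differentiable (at w)" using F' x real_differentiable_def by blast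
      qed (use yz in auto)
      then obtain w where w: "y < w" "w < z" "(F x has_real_derivative 0) (at w)" by blast
      then have "w \<in> {-D<..<D}" using l(2)[OF x] r(2)[OF x] yz by auto
      then have "F' x w = 0" using F'[OF x] w(3) DERIV_unique by blast
      then show False using nz[OF x, of w] w yz by auto
    qed
  qed
  have opposite: "sl * sr < 0" if x: "x \<in> {0<..<\<eta>}" and y: "l x < y" "y < r x" "F x y = 0" for x y
  proof -
    have "F x (l x) < F x y \<and> F x y < F x (r x) \<or> F x (r x) < F x y \<and> F x y < F x (l x)"
      using continuous_inj_imp_mono[OF y(1,2) cy[OF x] inj[OF x]] .
    then show ?thesis using y sl[OF x] sr[OF x] by (auto simp: sgn_if split: if_splits)
  qed
  show ?thesis
  proof (cases "sl * sr < 0")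
    case False
    have "F x y \<noteq> 0" if "x \<in> {0<..<\<eta>}" "l x < y \<and> y < r x" for x y
      using opposite[OF that(1)] that(2) False by blast
    then show ?thesis by (intro exI[of _ "[]"]) (auto simp: ordered_arcs_def)
  next
    case True
    have ivt: "\<exists>y. a < y \<and> y < b \<and> F x y = 0"
      if x: "x \<in> {0<..<\<eta>}" and ab: "l x \<le> a" "a < b" "b \<le> r x" "F x a * F x b < 0" for x a b
    proof -
      have c: "continuous_on {a..b} (F x)" using ab by (intro continuous_on_subset[OF cy[OF x]]) auto
      have "\<exists>y\<ge>a. y \<le> b \<and> F x y = 0"
      proof (cases "F x a < 0")
        case True
        then show ?thesis using ab c by (intro IVT') (auto simp: mult_less_0_iff)
      next
        case False
        then show ?thesis using ab c by (intro IVT2') (auto simp: mult_less_0_iff)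
      qed
      then obtain y where "a \<le> y" "y \<le> b" "F x y = 0" by blast
      moreover have "y \<noteq> a" "y \<noteq> b" using ab(4) \<open>F x y = 0\<close> by auto
      ultimately show ?thesis by (intro exI[of _ y]) auto
    qed
    have ends: "F x (l x) * F x (r x) < 0" if "x \<in> {0<..<\<eta>}" for x
      using True sl[OF that] sr[OF that] by (auto simp: sgn_if mult_less_0_iff split: if_splits)
    define f where "f = (\<lambda>x. SOME y. l x < y \<and> y < r x \<and> F x y = 0)"
    have f: "l x < f x" "f x < r x" "F x (f x) = 0" if x: "x \<in> {0<..<\<eta>}" for x
    proof -
      have "\<exists>y. l x < y \<and> y < r x \<and> F x y = 0"
        using ivt[OF x order_refl lr[OF x] order_refl ends[OF x]] .
      from someI_ex[OF this] show "l x < f x" "f x < r x" "F x (f x) = 0" unfolding f_def by blast+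
    qed
    have uniq: "y = f x" if "x \<in> {0<..<\<eta>}" "l x < y" "y < r x" "F x y = 0" for x y
      using inj[OF that(1)] f[OF that(1)] that unfolding inj_on_def by auto
    have "isCont f x" if x: "x \<in> {0<..<\<eta>}" for x
      unfolding isCont_def
    proof (rule order_tendstoI)
      have near: "eventually (\<lambda>z. z \<in> {0<..<\<eta>}) (at x)"
        using x by (intro eventually_at_in_open') auto
      have lim: "(l \<longlongrightarrow> l x) (at x)" "(r \<longlongrightarrow> r x) (at x)"
        using l(1) r(1) x by (auto simp: continuous_on_eq_continuous_at isCont_def)
      have limF: "((\<lambda>z. F z y) \<longlongrightarrow> F x y) (at x)" if "l x < y" "y < r x" for y
      proof -
        have y: "y \<in> {-D<..<D}" using that l(2)[OF x] r(2)[OF x] by auto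
        have "continuous_on {0<..<\<eta>} (\<lambda>z. (\<lambda>(x, y). F x y) (z, y))"
          using y by (intro continuous_on_compose2[OF F] continuous_intros) auto
        then show ?thesis using x by (auto simp: continuous_on_eq_continuous_at isCont_def)
      qed
      have cross: "F x p * F x q < 0" if "l x < p" "p < f x" "f x < q" "q < r x" for p q
      proof -
        have "F x p < F x (f x) \<and> F x (f x) < F x q \<or> F x q < F x (f x) \<and> F x (f x) < F x p"
          using that by (intro continuous_inj_imp_mono continuous_on_subset[OF cy[OF x]] inj_on_subset[OF inj[OF x]]) auto
        then show ?thesis using f(3)[OF x] by (auto simp: mult_less_0_iff)
      qed
      have trap: "eventually (\<lambda>z. p < f z \<and> f z < q) (at x)"
        if pq: "l x < p" "p < f x" "f x < q" "q < r x" for p q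
      proof -
        have "((\<lambda>z. F z p * F z q) \<longlongrightarrow> F x p * F x q) (at x)"
          using pq by (intro tendsto_mult limF) auto
        then have "eventually (\<lambda>z. F z p * F z q < 0) (at x)"
          using cross[OF pq] by (rule order_tendstoD(2))
        with near order_tendstoD(2)[OF lim(1) pq(1)] order_tendstoD(1)[OF lim(2) pq(4)]
        show ?thesis
        proof eventually_elim
          case (elim z)
          then obtain y where y: "p < y" "y < q" "F z y = 0"
            using ivt[of z p q] pq by auto
          then have "y = f z" using elim by (intro uniq) auto
          then show ?case using y by simp
        qed
      qed
      fix c
      show "eventually (\<lambda>z. c < f z) (at x)" if "c < f x"
      proof -
        have "max c (l x) < f x" using that f[OF x] by simp
        then obtain p where p: "max c (l x) < p" "p < f x" using dense by blast
        obtain q where "f x < q" "q < r x" using f[OF x] dense by blast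
        with trap[of p q] p have "eventually (\<lambda>z. p < f z \<and> f z < q) (at x)" by simp
        then show ?thesis by eventually_elim (use p in auto)
      qed
      show "eventually (\<lambda>z. f z < c) (at x)" if "f x < c"
      proof -
        have "f x < min c (r x)" using that f[OF x] by simp
        then obtain q where q: "f x < q" "q < min c (r x)" using dense by blast
        obtain p where "l x < p" "p < f x" using f[OF x] dense by blast
        with trap[of p q] q have "eventually (\<lambda>z. p < f z \<and> f z < q) (at x)" by simp
        then show ?thesis by eventually_elim (use q in auto)
      qed
    qed
    then have "continuous_on {0<..<\<eta>} f" by (intro continuous_at_imp_continuous_on) auto
    then show ?thesis using f uniq
      by (intro exI[of _ "[f]"]) (auto simp: ordered_arcs_def)
  qed
qed

text \<open>The arcs \<open>zs\<close>, which contain all zeros of the derivative, cut the strip into layers without such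
  zeros. A zero arc of \<open>F\<close> is either the unique zero inside a layer or one of the \<open>zs\<close> along which
  \<open>F\<close> vanishes.\<close>

lemma zero_arcs_between:
  fixes F F' :: "real \<Rightarrow> real \<Rightarrow> real"
  assumes F: "continuous_on ({0<..<\<eta>} \<times> {-D<..<D}) (\<lambda>(x, y). F x y)"
    and F': "\<And>x y. x \<in> {0<..<\<eta>} \<Longrightarrow> y \<in> {-D<..<D} \<Longrightarrow> (F x has_real_derivative F' x y) (at y)"
    and r: "continuous_on {0<..<\<eta>} r" "\<And>x. x \<in> {0<..<\<eta>} \<Longrightarrow> r x < D"
       "\<And>x. x \<in> {0<..<\<eta>} \<Longrightarrow> sgn (F x (r x)) = sr"
    and l: "continuous_on {0<..<\<eta>} l" "\<And>x. x \<in> {0<..<\<eta>} \<Longrightarrow> - D < l x"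
       "\<And>x. x \<in> {0<..<\<eta>} \<Longrightarrow> sgn (F x (l x)) = sl"
    and zs: "ordered_arcs \<eta> zs" "\<And>f x. f \<in> set zs \<Longrightarrow> x \<in> {0<..<\<eta>} \<Longrightarrow> l x < f x \<and> f x < r x"
       "\<And>f. f \<in> set zs \<Longrightarrow> \<exists>s. \<forall>x\<in>{0<..<\<eta>}. sgn (F x (f x)) = s"
    and lr: "\<And>x. x \<in> {0<..<\<eta>} \<Longrightarrow> l x < r x"
    and nz: "\<And>x y. x \<in> {0<..<\<eta>} \<Longrightarrow> l x < y \<Longrightarrow> y < r x \<Longrightarrow> F' x y = 0 \<Longrightarrow> \<exists>f\<in>set zs. y = f x"
    and "0 < \<eta>"
  shows "\<exists>fs. ordered_arcs \<eta> fs \<and> (\<forall>f\<in>set fs. \<forall>x\<in>{0<..<\<eta>}. l x < f x \<and> f x < r x) \<and>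
    (\<forall>x\<in>{0<..<\<eta>}. \<forall>y. l x < y \<and> y < r x \<longrightarrow> (F x y = 0 \<longleftrightarrow> (\<exists>f\<in>set fs. y = f x)))"
  using l zs lr nz
proof (induction zs arbitrary: l sl)
  case Nil
  show ?case
    by (rule zero_arc_between[OF F F' Nil(1,2) r(1,2) Nil(7) _ Nil(3) r(3)]) (use Nil(8) in auto)
next
  case (Cons z zs)
  note l = Cons.prems(1,2,3) and zs = Cons.prems(4,5,6) and lr = Cons.prems(7) and nz = Cons.prems(8)
  have z: "continuous_on {0<..<\<eta>} z" "\<And>x. x \<in> {0<..<\<eta>} \<Longrightarrow> l x < z x \<and> z x < r x"
    using zs by (auto simp: ordered_arcs_def)
  have above: "z x < f x" if "f \<in> set zs" "x \<in> {0<..<\<eta>}" for f x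
    using zs(1) that by (auto simp: ordered_arcs_def)
  obtain sz where sz: "\<And>x. x \<in> {0<..<\<eta>} \<Longrightarrow> sgn (F x (z x)) = sz" using zs(3)[of z] by auto
  have "\<exists>fs. ordered_arcs \<eta> fs \<and> (\<forall>f\<in>set fs. \<forall>x\<in>{0<..<\<eta>}. l x < f x \<and> f x < z x) \<and>
    (\<forall>x\<in>{0<..<\<eta>}. \<forall>y. l x < y \<and> y < z x \<longrightarrow> (F x y = 0 \<longleftrightarrow> (\<exists>f\<in>set fs. y = f x)))"
  proof (rule zero_arc_between[OF F F' l(1,2) z(1) _ _ _ l(3) sz])
    fix x assume x: "x \<in> {0<..<\<eta>}"
    show "z x < D" "l x < z x" using z(2)[OF x] r(2)[OF x] by auto
    fix y assume y: "l x < y" "y < z x"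
    show "F' x y \<noteq> 0"
    proof
      assume "F' x y = 0"
      then obtain f where "f \<in> set (z # zs)" "y = f x" using nz[OF x, of y] y z(2)[OF x] by auto
      then show False using above[of f x] x y by auto
    qed
  qed
  then obtain fs where fs: "ordered_arcs \<eta> fs" "\<forall>f\<in>set fs. \<forall>x\<in>{0<..<\<eta>}. l x < f x \<and> f x < z x"
    "\<forall>x\<in>{0<..<\<eta>}. \<forall>y. l x < y \<and> y < z x \<longrightarrow> (F x y = 0 \<longleftrightarrow> (\<exists>f\<in>set fs. y = f x))" by blast
  have "\<exists>gs. ordered_arcs \<eta> gs \<and> (\<forall>f\<in>set gs. \<forall>x\<in>{0<..<\<eta>}. z x < f x \<and> f x < r x) \<and>
    (\<forall>x\<in>{0<..<\<eta>}. \<forall>y. z x < y \<and> y < r x \<longrightarrow> (F x y = 0 \<longleftrightarrow> (\<exists>f\<in>set gs. y = f x)))"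
  proof (rule Cons.IH[OF z(1) _ sz])
    show "ordered_arcs \<eta> zs" using zs(1) by (auto simp: ordered_arcs_def)
    fix x assume x: "x \<in> {0<..<\<eta>}"
    show "- D < z x" "z x < r x" using z(2)[OF x] l(2)[OF x] by auto
    show "z x < f x \<and> f x < r x" if "f \<in> set zs" for f
      using above[OF that x] zs(2)[of f x] that x by auto
    show "\<exists>f\<in>set zs. y = f x" if "z x < y" "y < r x" "F' x y = 0" for y
      using nz[OF x, of y] that z(2)[OF x] by auto
  qed (use zs(3) in auto)
  then obtain gs where gs: "ordered_arcs \<eta> gs" "\<forall>f\<in>set gs. \<forall>x\<in>{0<..<\<eta>}. z x < f x \<and> f x < r x"
    "\<forall>x\<in>{0<..<\<eta>}. \<forall>y. z x < y \<and> y < r x \<longrightarrow> (F x y = 0 \<longleftrightarrow> (\<exists>f\<in>set gs. y = f x))" by blast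
  \<comment> \<open>The arc \<open>z\<close> itself is a zero arc exactly if the constant sign along it is \<open>0\<close>.\<close>
  define ms where "ms = (if sz = 0 then [z] else [])"
  have ms: "set ms \<subseteq> {z}" "\<And>x. x \<in> {0<..<\<eta>} \<Longrightarrow> F x (z x) = 0 \<longleftrightarrow> z \<in> set ms"
    using sz by (force simp: ms_def sgn_0_0)+
  show ?case
  proof (intro exI[of _ "fs @ ms @ gs"] conjI)
    have "\<forall>x\<in>{0<..<\<eta>}. f x < g x" if "f \<in> set fs" "g \<in> set ms \<union> set gs" for f g
    proof
      fix x assume x: "x \<in> {0<..<\<eta>}"
      have "f x < z x" using fs(2) that(1) x by blast
      moreover have "g = z \<or> z x < g x" using that(2) gs(2) ms(1) x by blast
      ultimately show "f x < g x" by auto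
    qed
    moreover have "\<forall>x\<in>{0<..<\<eta>}. f x < g x" if "f \<in> set ms" "g \<in> set gs" for f g
    proof -
      have "f = z" using that(1) ms(1) by blast
      then show ?thesis using that(2) gs(2) by blast
    qed
    moreover have "sorted_wrt (\<lambda>f g. \<forall>x\<in>{0<..<\<eta>}. f x < g x) ms" by (simp add: ms_def)
    ultimately show "ordered_arcs \<eta> (fs @ ms @ gs)"
      using fs(1) gs(1) z(1) ms(1) unfolding ordered_arcs_def by (auto simp: sorted_wrt_append)
    show "\<forall>f\<in>set (fs @ ms @ gs). \<forall>x\<in>{0<..<\<eta>}. l x < f x \<and> f x < r x"
    proof (intro ballI)
      fix f x assume f: "f \<in> set (fs @ ms @ gs)" and x: "x \<in> {0<..<\<eta>}"
      from f consider "f \<in> set fs" | "f = z" | "f \<in> set gs" using ms(1) by auto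
      then show "l x < f x \<and> f x < r x"
      proof cases
        case 1
        then have "l x < f x" "f x < z x" using fs(2) x by blast+
        then show ?thesis using z(2)[OF x] by linarith
      next
        case 2
        then show ?thesis using z(2)[OF x] by simp
      next
        case 3
        then have "z x < f x" "f x < r x" using gs(2) x by blast+
        then show ?thesis using z(2)[OF x] by linarith
      qed
    qed
    show "\<forall>x\<in>{0<..<\<eta>}. \<forall>y. l x < y \<and> y < r x \<longrightarrow> (F x y = 0 \<longleftrightarrow> (\<exists>f\<in>set (fs @ ms @ gs). y = f x))"
    proof (intro ballI allI impI)
      fix x y assume x: "x \<in> {0<..<\<eta>}" and y: "l x < y \<and> y < r x"
      consider "y < z x" | "y = z x" | "z x < y" by linarith
      then show "F x y = 0 \<longleftrightarrow> (\<exists>f\<in>set (fs @ ms @ gs). y = f x)"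
      proof cases
        case 1
        have "y \<noteq> f x" if "f \<in> set ms \<union> set gs" for f
        proof -
          have "f = z \<or> z x < f x" using that gs(2) ms(1) x by blast
          then show ?thesis using 1 by auto
        qed
        then show ?thesis using fs(3) x y 1 by auto
      next
        case 2
        have "y \<noteq> f x" if "f \<in> set fs \<union> set gs" for f
        proof -
          have "f x < z x \<or> z x < f x" using that gs(2) fs(2) x by blast
          then show ?thesis using 2 by auto
        qed
        then show ?thesis using ms x 2 by auto
      next
        case 3
        have "y \<noteq> f x" if "f \<in> set fs \<union> set ms" for f
        proof -
          have "f = z \<or> f x < z x" using that fs(2) ms(1) x by blast
          then show ?thesis using 3 by auto
        qed
        then show ?thesis using gs(3) x y 3 by auto
      qed
    qed
  qed
qed

text \<open>Induction on a bound \<open>m\<close> for the order of \<open>u 0\<close> at \<open>0\<close>. Differentiation in \<open>y\<close> lowers the order,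
  so the derivative vanishes near \<open>0\<close> exactly on finitely many arcs. Along these the sign of the
  series is eventually constant, as it is at the ends \<open>\<plusminus>\<delta>\<close> of a small interval, where \<open>u 0\<close> does
  not vanish. The arcs converge to \<open>0\<close> because \<open>0\<close> is the only zero of \<open>u 0\<close> in the interval.\<close>

lemma local_zero_arcs:
  assumes "power_family (ball 0 \<rho>) u" "real_family (ball 0 \<rho>) u" "0 < \<rho>" "(deriv ^^ m) (u 0) 0 \<noteq> 0"
  shows "\<exists>\<delta> \<eta> fs. 0 < \<delta> \<and> \<delta> \<le> \<rho> \<and> 0 < \<eta> \<and> ordered_arcs \<eta> fs \<and>
    (\<forall>f\<in>set fs. (f \<longlongrightarrow> 0) (at_right 0) \<and> (\<forall>x\<in>{0<..<\<eta>}. \<bar>f x\<bar> < \<delta>)) \<and>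
    (\<forall>x\<in>{0<..<\<eta>}. \<forall>y. \<bar>y\<bar> < \<delta> \<longrightarrow> (real_ev u x y = 0 \<longleftrightarrow> (\<exists>f\<in>set fs. y = f x)))"
  using assms
proof (induction m arbitrary: u \<rho>)
  case 0
  note u = 0(1) and re = 0(2) and \<rho> = 0(3)
  have hol: "u 0 holomorphic_on ball 0 \<rho>" using u by (simp add: power_family_def)
  define c where "c = \<bar>Re (u 0 0)\<bar>"
  have "u 0 (of_real 0) \<in> \<real>" using re \<rho> unfolding real_family_def
    by (metis centre_in_ball of_real_0)
  then have c: "0 < c" using 0(4) by (auto simp: c_def complex_is_Real_iff complex_eq_iff)
  have "continuous_on (ball 0 \<rho>) (u 0)" using hol by (rule holomorphic_on_imp_continuous_on)
  then have "isCont (u 0) 0" using \<rho> by (simp add: continuous_on_eq_continuous_at)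
  then have "eventually (\<lambda>y. dist (u 0 y) (u 0 0) < c / 2) (nhds 0)"
    using c by (intro tendstoD) (auto simp: isCont_def tendsto_at_iff_tendsto_nhds)
  then obtain d where d: "0 < d" "\<And>y. norm y < d \<Longrightarrow> norm (u 0 y - u 0 0) < c / 2"
    unfolding eventually_nhds_metric dist_norm by auto
  have "0 < c / 2" using c by simp
  from eventually_nhds_imp_at_right[OF real_ev_near_first[OF u this]]
  obtain \<eta> where \<eta>: "0 < \<eta>" "\<And>x y. x \<in> {0<..<\<eta>} \<Longrightarrow> \<bar>y\<bar> < \<rho> \<Longrightarrow> \<bar>real_ev u x y - Re (u 0 (of_real y))\<bar> < c / 2"
    unfolding eventually_at_right_field by auto
  have "real_ev u x y \<noteq> 0" if x: "x \<in> {0<..<\<eta>}" and y: "\<bar>y\<bar> < min d \<rho>" for x y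
  proof -
    have "\<bar>Re (u 0 (of_real y)) - Re (u 0 0)\<bar> < c / 2"
      using d(2)[of "of_real y"] y abs_Re_le_cmod[of "u 0 (of_real y) - u 0 0"] by simp
    then show ?thesis using \<eta>(2)[OF x, of y] y unfolding c_def by (auto simp: abs_if split: if_splits)
  qed
  then show ?case using d \<rho> \<eta>
    by - (rule exI[of _ "min d \<rho>"], rule exI[of _ \<eta>], rule exI[of _ "[]"], auto simp: ordered_arcs_def)
next
  case (Suc m)
  note u = Suc.prems(1) and re = Suc.prems(2) and \<rho> = Suc.prems(3)
  define u' where "u' = (\<lambda>k. deriv (u k))"
  have u': "power_family (ball 0 (\<rho> / 2)) u'" "real_family (ball 0 (\<rho> / 2)) u'" "0 < \<rho> / 2"
    using power_family_deriv[OF u \<rho>] real_family_deriv[OF u re] \<rho> by (auto simp: u'_def)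
  have ord: "(deriv ^^ m) (u' 0) 0 \<noteq> 0"
    using Suc.prems(4) unfolding u'_def by (simp add: funpow_Suc_right del: funpow.simps)
  obtain \<delta>' \<eta>' zs where \<delta>': "0 < \<delta>'" "\<delta>' \<le> \<rho> / 2" and \<eta>': "0 < \<eta>'" and zs: "ordered_arcs \<eta>' zs"
    "\<forall>f\<in>set zs. (f \<longlongrightarrow> 0) (at_right 0) \<and> (\<forall>x\<in>{0<..<\<eta>'}. \<bar>f x\<bar> < \<delta>')"
    "\<forall>x\<in>{0<..<\<eta>'}. \<forall>y. \<bar>y\<bar> < \<delta>' \<longrightarrow> (real_ev u' x y = 0 \<longleftrightarrow> (\<exists>f\<in>set zs. y = f x))"
    using Suc.IH[OF u' ord] by blast
  have hol: "u 0 holomorphic_on ball 0 \<rho>" using u by (simp add: power_family_def)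
  obtain p e s E where s: "0 < s" "s \<le> \<rho>" and fac: "\<forall>y\<in>ball 0 s. u 0 y = y ^ p * e y \<and> e y \<noteq> 0 \<and> norm (inverse (e y)) \<le> (E::real)"
    using finite_order_factor[OF hol \<rho> Suc.prems(4)] by metis
  have nz: "Re (u 0 (of_real y)) \<noteq> 0" if "y \<noteq> 0" "\<bar>y\<bar> < s" for y
  proof -
    have "complex_of_real y \<in> ball 0 s" "complex_of_real y \<in> ball 0 \<rho>" using that s by auto
    moreover from this have "u 0 (of_real y) \<noteq> 0" using fac that(1) by auto
    moreover have "u 0 (of_real y) \<in> \<real>"
      using re \<open>complex_of_real y \<in> ball 0 \<rho>\<close> unfolding real_family_def by blast
    ultimately show ?thesis by (auto simp: complex_is_Real_iff complex_eq_iff)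
  qed
  \<comment> \<open>The division by \<open>2\<close> leaves room on both sides of \<open>[-\<delta>, \<delta>]\<close>, and \<open>u 0\<close> does not vanish at
    the end points.\<close>
  define \<delta> where "\<delta> = min \<delta>' s / 2"
  have \<delta>: "0 < \<delta>" "2 * \<delta> \<le> \<delta>'" "2 * \<delta> \<le> s" using \<delta>' s by (auto simp: \<delta>_def)
  have "eventually (\<lambda>x. \<bar>f x\<bar> < \<delta>) (at_right 0)" if "f \<in> set zs" for f
    using zs(2) that tendstoD[of f 0 "at_right 0" \<delta>] \<delta>(1) by auto
  then have E1: "eventually (\<lambda>x. \<forall>f\<in>set zs. \<bar>f x\<bar> < \<delta>) (at_right 0)"
    by (intro eventually_ball_finite) auto
  have E2: "eventually (\<lambda>x. x < \<eta>') (at_right 0)"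
    using \<eta>' by (auto simp: eventually_at_right_field)
  have "\<forall>f\<in>set zs. \<exists>s. eventually (\<lambda>x. sgn (real_ev u x (f x)) = s) (at_right 0)"
  proof
    fix f assume f: "f \<in> set zs"
    obtain b where b: "0 < b" "\<And>x y. x \<in> {0<..<b} \<Longrightarrow> \<bar>y\<bar> < \<rho> / 2 \<Longrightarrow> ev u' (of_real x) (of_real y) = of_real (real_ev u' x y)"
      using eventually_nhds_imp_at_right[OF real_ev_eq[OF u'(1,2)]] unfolding eventually_at_right_field by auto
    show "\<exists>s. eventually (\<lambda>x. sgn (real_ev u x (f x)) = s) (at_right 0)"
    proof (rule sign_along_zero_arc[OF u'(1) _ _ u'(3) ord])
      show "power_family (ball 0 (\<rho> / 2)) u" using \<rho> by (intro power_family_mono[OF u]) auto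
      show "real_family (ball 0 (\<rho> / 2)) u" using re \<rho> by (auto simp: real_family_def)
      show "0 < min b \<eta>'" using b \<eta>' by simp
      show "continuous_on {0<..<min b \<eta>'} f"
        using zs(1) f unfolding ordered_arcs_def by (auto intro: continuous_on_subset)
      show "(f \<longlongrightarrow> 0) (at_right 0)" using zs(2) f by blast
      fix x assume x: "x \<in> {0<..<min b \<eta>'}"
      then have "\<bar>f x\<bar> < \<delta>'" "real_ev u' x (f x) = 0" using zs f by auto
      then show "ev u' (of_real x) (of_real (f x)) = 0" using b(2)[of x "f x"] x \<delta>' by auto
    qed
  qed
  from bchoice[OF this] obtain sg where "\<forall>f\<in>set zs. eventually (\<lambda>x. sgn (real_ev u x (f x)) = sg f) (at_right 0)" by blast
  then have E3: "eventually (\<lambda>x. \<forall>f\<in>set zs. sgn (real_ev u x (f x)) = sg f) (at_right 0)"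
    by (intro eventually_ball_finite) auto
  note E4 = eventually_nhds_imp_at_right[OF real_ev_deriv[OF u \<rho>]]
  have ends: "eventually (\<lambda>x. sgn (real_ev u x y) = sgn (Re (u 0 (of_real y)))) (at_right 0)"
    if y: "y \<noteq> 0" "\<bar>y\<bar> \<le> \<delta>" for y
  proof -
    have pos: "0 < \<bar>Re (u 0 (of_real y))\<bar>" using nz[of y] y \<delta> by auto
    show ?thesis using eventually_nhds_imp_at_right[OF real_ev_near_first[OF u pos]]
    proof eventually_elim
      case (elim x)
      then have "\<bar>real_ev u x y - Re (u 0 (of_real y))\<bar> < \<bar>Re (u 0 (of_real y))\<bar>" using y \<delta> s by auto
      then show ?case by (auto simp: sgn_if abs_if split: if_splits)
    qed
  qed
  have E5: "eventually (\<lambda>x. sgn (real_ev u x \<delta>) = sgn (Re (u 0 (of_real \<delta>)))) (at_right 0)"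
    and E6: "eventually (\<lambda>x. sgn (real_ev u x (-\<delta>)) = sgn (Re (u 0 (of_real (-\<delta>))))) (at_right 0)"
    using ends[of \<delta>] ends[of "-\<delta>"] \<delta>(1) by auto
  obtain e where e: "0 < e" "continuous_on ({-e<..<e} \<times> {-\<rho><..<\<rho>}) (\<lambda>(x, y). real_ev u x y)"
    using real_ev_continuous[OF u] by blast
  have E7: "eventually (\<lambda>x. x < e) (at_right 0)" using e(1) by (auto simp: eventually_at_right_field)
  from E1 E2 E3 E4 E5 E6 E7 have "eventually (\<lambda>x. (\<forall>f\<in>set zs. \<bar>f x\<bar> < \<delta>) \<and> x < \<eta>' \<and>
     (\<forall>f\<in>set zs. sgn (real_ev u x (f x)) = sg f) \<and>
     (\<forall>y. \<bar>y\<bar> < \<rho> / 2 \<longrightarrow> (real_ev u x has_real_derivative real_ev u' x y) (at y)) \<and>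
     sgn (real_ev u x \<delta>) = sgn (Re (u 0 (of_real \<delta>))) \<and> sgn (real_ev u x (-\<delta>)) = sgn (Re (u 0 (of_real (-\<delta>)))) \<and> x < e) (at_right 0)"
    unfolding u'_def by eventually_elim auto
  then obtain \<eta> where \<eta>: "0 < \<eta>" and H: "\<And>x. x \<in> {0<..<\<eta>} \<Longrightarrow> (\<forall>f\<in>set zs. \<bar>f x\<bar> < \<delta>) \<and> x < \<eta>' \<and>
     (\<forall>f\<in>set zs. sgn (real_ev u x (f x)) = sg f) \<and>
     (\<forall>y. \<bar>y\<bar> < \<rho> / 2 \<longrightarrow> (real_ev u x has_real_derivative real_ev u' x y) (at y)) \<and>
     sgn (real_ev u x \<delta>) = sgn (Re (u 0 (of_real \<delta>))) \<and> sgn (real_ev u x (-\<delta>)) = sgn (Re (u 0 (of_real (-\<delta>)))) \<and> x < e"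
    unfolding eventually_at_right_field by auto
  have "\<exists>fs. ordered_arcs \<eta> fs \<and> (\<forall>f\<in>set fs. \<forall>x\<in>{0<..<\<eta>}. - \<delta> < f x \<and> f x < \<delta>) \<and>
    (\<forall>x\<in>{0<..<\<eta>}. \<forall>y. - \<delta> < y \<and> y < \<delta> \<longrightarrow> (real_ev u x y = 0 \<longleftrightarrow> (\<exists>f\<in>set fs. y = f x)))"
  proof (rule zero_arcs_between[where D = "2 * \<delta>" and F' = "real_ev u'" and zs = zs])
    have "{0<..<\<eta>} \<subseteq> {-e<..<e}" using H e by force
    then show "continuous_on ({0<..<\<eta>} \<times> {-(2*\<delta>)<..<2*\<delta>}) (\<lambda>(x, y). real_ev u x y)"
      using \<delta> s by (intro continuous_on_subset[OF e(2)] Sigma_mono) auto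
    have "{0<..<\<eta>} \<subseteq> {0<..<\<eta>'}" using H by force
    then show "ordered_arcs \<eta> zs"
      using zs(1) unfolding ordered_arcs_def
      by (auto intro: continuous_on_subset elim!: sorted_wrt_mono_rel[rotated])
    fix x assume x: "x \<in> {0<..<\<eta>}"
    show "sgn (real_ev u x \<delta>) = sgn (Re (u 0 (of_real \<delta>)))" "sgn (real_ev u x (-\<delta>)) = sgn (Re (u 0 (of_real (-\<delta>))))"
      using H[OF x] by auto
    show "(real_ev u x has_real_derivative real_ev u' x y) (at y)" if "y \<in> {-(2*\<delta>)<..<2*\<delta>}" for y
      using H[OF x] that \<delta> \<delta>' by auto
    show "- \<delta> < f x \<and> f x < \<delta>" if "f \<in> set zs" for f using H[OF x] that by auto
    show "\<exists>f\<in>set zs. y = f x" if "- \<delta> < y" "y < \<delta>" "real_ev u' x y = 0" for y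
      using zs(3) H[OF x] x that \<delta> by auto
  next
    fix f assume "f \<in> set zs"
    then show "\<exists>s. \<forall>x\<in>{0<..<\<eta>}. sgn (real_ev u x (f x)) = s" using H by blast
  qed (use \<delta> \<eta> in auto)
  then obtain fs where fs: "ordered_arcs \<eta> fs" "\<forall>f\<in>set fs. \<forall>x\<in>{0<..<\<eta>}. - \<delta> < f x \<and> f x < \<delta>"
    "\<forall>x\<in>{0<..<\<eta>}. \<forall>y. - \<delta> < y \<and> y < \<delta> \<longrightarrow> (real_ev u x y = 0 \<longleftrightarrow> (\<exists>f\<in>set fs. y = f x))" by blast
  have "(f \<longlongrightarrow> 0) (at_right 0)" if f: "f \<in> set fs" for f
  proof (rule tendstoI)
    fix \<epsilon> :: real assume \<epsilon>: "0 < \<epsilon>"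
    define K where "K = {-\<delta>..\<delta>} - {-\<epsilon><..<\<epsilon>}"
    have K: "compact K" unfolding K_def by (intro compact_diff) auto
    have "\<exists>c>0. \<forall>y\<in>K. c \<le> \<bar>Re (u 0 (of_real y))\<bar>"
    proof (cases "K = {}")
      case True then show ?thesis by (intro exI[of _ 1]) auto
    next
      case False
      have "continuous_on K (\<lambda>y. u 0 (complex_of_real y))"
        using \<delta> s by (intro continuous_on_compose2[OF holomorphic_on_imp_continuous_on[OF hol]] continuous_intros)
          (auto simp: K_def)
      then have "continuous_on K (\<lambda>y. \<bar>Re (u 0 (of_real y))\<bar>)" by (intro continuous_intros)
      then obtain y0 where "y0 \<in> K" "\<forall>y\<in>K. \<bar>Re (u 0 (of_real y0))\<bar> \<le> \<bar>Re (u 0 (of_real y))\<bar>"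
        using continuous_attains_inf[OF K False] by blast
      moreover have "0 < \<bar>Re (u 0 (of_real y0))\<bar>" using nz[of y0] \<open>y0 \<in> K\<close> \<epsilon> \<delta> by (auto simp: K_def)
      ultimately show ?thesis by blast
    qed
    then obtain c where c: "0 < c" "\<And>y. y \<in> K \<Longrightarrow> c \<le> \<bar>Re (u 0 (of_real y))\<bar>" by blast
    have "eventually (\<lambda>x. 0 < x \<and> x < \<eta>) (at_right 0)" using \<eta> by (auto simp: eventually_at_right_field)
    with eventually_nhds_imp_at_right[OF real_ev_near_first[OF u c(1)]]
    show "eventually (\<lambda>x. dist (f x) 0 < \<epsilon>) (at_right 0)"
    proof eventually_elim
      case (elim x)
      then have fx: "- \<delta> < f x" "f x < \<delta>" "real_ev u x (f x) = 0" using fs f by auto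
      moreover from this have "\<bar>f x\<bar> < \<rho>" using \<delta> s by auto
      ultimately have "\<bar>Re (u 0 (of_real (f x)))\<bar> < c" using elim(1) by fastforce
      then have "f x \<notin> K" using c(2)[of "f x"] by auto
      then show ?case using fx by (auto simp: K_def)
    qed
  qed
  moreover have "- \<delta> < y \<and> y < \<delta> \<longleftrightarrow> \<bar>y\<bar> < \<delta>" for y by linarith
  ultimately show ?case using fs \<delta> \<eta> s
    by - (rule exI[of _ \<delta>], rule exI[of _ \<eta>], rule exI[of _ fs], simp)
qed

section \<open>Conic structure of a plane curve at the origin\<close>

text \<open>The arcs \<open>r *\<^sub>R \<gamma> i r\<close> are parametrized by their distance \<open>r\<close> to the origin, so that the arcs
  \<open>(\<gamma> i r, r)\<close> parametrize the blowing-up, and \<open>\<gamma> i 0\<close> is the direction of the tangent half-line.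
  Different arcs may have the same direction at the origin but do not meet elsewhere.\<close>

definition conic_arcs :: "'a::euclidean_space set \<Rightarrow> real \<Rightarrow> 'i set \<Rightarrow> ('i \<Rightarrow> real \<Rightarrow> 'a) \<Rightarrow> bool" where
  "conic_arcs X \<epsilon> I \<gamma> \<longleftrightarrow> 0 < \<epsilon> \<and> finite I \<and>
     (\<forall>i\<in>I. continuous_on {0..\<epsilon>} (\<gamma> i) \<and> \<gamma> i ` {0..\<epsilon>} \<subseteq> sphere 0 1) \<and>
     (\<forall>i\<in>I. \<forall>j\<in>I. \<forall>r\<in>{0<..\<epsilon>}. \<gamma> i r = \<gamma> j r \<longrightarrow> i = j) \<and>
     X \<inter> cball 0 \<epsilon> - {0} = (\<Union>i\<in>I. (\<lambda>r. r *\<^sub>R \<gamma> i r) ` {0<..\<epsilon>})"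

definition dir :: "real \<Rightarrow> real ^ 2" where
  "dir t = (\<chi> i. if i = 1 then cos t else sin t)"

lemma dir_nth [simp]: "dir t $ 1 = cos t" "dir t $ 2 = sin t"
  by (simp_all add: dir_def)

lemma norm_dir [simp]: "norm (dir t) = 1"
  by (simp add: norm_eq_sqrt_inner inner_vec_def sum_2 power2_eq_square[symmetric])

lemma continuous_on_dir [continuous_intros]:
  fixes f :: "'a::t2_space \<Rightarrow> real"
  shows "continuous_on S f \<Longrightarrow> continuous_on S (\<lambda>x. dir (f x))"
  unfolding dir_def
proof (intro continuous_on_vec_lambda)
  fix i :: 2
  assume "continuous_on S f"
  then show "continuous_on S (\<lambda>x. if i = 1 then cos (f x) else sin (f x))"
    by (cases "i = 1") (auto intro!: continuous_intros)
qed

lemma dir_eq_iff: "dir a = dir b \<longleftrightarrow> (\<exists>n::int. a = b + 2 * pi * n)"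
  using sin_cos_eq_iff[of a b] by (auto simp: vec_eq_iff forall_2)

lemma dir_inj_local:
  assumes "dir a = dir b" "\<bar>a - b\<bar> < 2"
  shows "a = b"
proof -
  obtain n :: int where n: "a = b + 2 * pi * n" using assms(1) by (auto simp: dir_eq_iff)
  have "n = 0"
  proof (rule ccontr)
    assume "n \<noteq> 0"
    then have "1 \<le> \<bar>real_of_int n\<bar>" by linarith
    then have "2 * pi * 1 \<le> 2 * pi * \<bar>real_of_int n\<bar>" by (intro mult_left_mono) auto
    then have "2 * pi \<le> \<bar>a - b\<bar>" using n by (simp add: abs_mult)
    then show False using assms(2) pi_gt3 by linarith
  qed
  then show ?thesis using n by simp
qed

text \<open>The angle \<open>y\<close> is the argument of the quotient of the two directions as complex numbers; it depends
  continuously on \<open>q\<close> near \<open>p\<close>, where the quotient is \<open>1\<close>.\<close>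

lemma dir_cover_near:
  assumes "norm p = 1"
  obtains t where "\<bar>t\<bar> \<le> pi" "p = dir t"
    "\<And>\<delta>. 0 < \<delta> \<Longrightarrow> \<exists>d>0. \<forall>q. norm q = 1 \<longrightarrow> dist p q < d \<longrightarrow> (\<exists>y. \<bar>y\<bar> < \<delta> \<and> q = dir (t + y))"
proof -
  define z :: "real ^ 2 \<Rightarrow> complex" where "z = (\<lambda>q. Complex (q $ 1) (q $ 2))"
  have nz: "norm (z q) = norm q" for q
  proof -
    have "norm q = sqrt ((q $ 1)\<^sup>2 + (q $ 2)\<^sup>2)"
      by (simp add: norm_eq_sqrt_inner inner_vec_def sum_2 power2_eq_square)
    then show ?thesis by (simp add: z_def complex_norm)
  qed
  have cis_dir: "q = dir s" if "z q = cis s" for q s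
    using that by (auto simp: z_def vec_eq_iff forall_2 complex_eq_iff)
  define t where "t = Arg (z p)"
  have zp: "z p = cis t" using assms nz[of p] unfolding t_def by (subst cis_Arg) (auto simp: sgn_eq)
  define w where "w = (\<lambda>q. z q * cnj (z p))"
  have wp: "w p = 1" using assms nz[of p] by (simp add: w_def complex_norm_square[symmetric])
  have contz: "isCont z p" unfolding z_def Complex_eq by (intro continuous_intros)
  have "isCont (\<lambda>q. Arg (w q)) p"
  proof (rule isCont_o2[where g = Arg])
    show "isCont w p" unfolding w_def using contz by (intro continuous_intros)
    show "isCont Arg (w p)" unfolding wp by (rule continuous_at_Arg) simp
  qed
  then have "((\<lambda>q. Arg (w q)) \<longlongrightarrow> Arg (w p)) (nhds p)"
    using tendsto_at_iff_tendsto_nhds[of "\<lambda>q. Arg (w q)" p] by (simp add: isCont_def)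
  then have lim: "((\<lambda>q. Arg (w q)) \<longlongrightarrow> 0) (nhds p)" by (simp add: wp)
  show thesis
  proof (rule that[of t])
    show "\<bar>t\<bar> \<le> pi" using Arg_bounded[of "z p"] by (simp add: t_def abs_le_iff)
    show "p = dir t" using cis_dir zp by blast
    fix \<delta> :: real assume "0 < \<delta>"
    then have "eventually (\<lambda>q. \<bar>Arg (w q)\<bar> < \<delta>) (nhds p)" using tendstoD[OF lim] by simp
    then obtain d where d: "0 < d" "\<And>q. dist q p < d \<Longrightarrow> \<bar>Arg (w q)\<bar> < \<delta>"
      unfolding eventually_nhds_metric by auto
    show "\<exists>d>0. \<forall>q. norm q = 1 \<longrightarrow> dist p q < d \<longrightarrow> (\<exists>y. \<bar>y\<bar> < \<delta> \<and> q = dir (t + y))"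
    proof (rule exI[of _ d], intro conjI allI impI d(1))
      fix q assume q: "norm q = 1" "dist p q < d"
      have "norm (w q) = 1" using assms q nz by (simp add: w_def norm_mult)
      then have "w q = cis (Arg (w q))" by (subst cis_Arg) (auto simp: sgn_eq)
      moreover have "z q = w q * z p"
        using assms nz[of p] by (simp add: w_def mult.assoc mult.commute[of "cnj (z p)"] complex_norm_square[symmetric])
      ultimately have "z q = cis (t + Arg (w q))" using zp by (metis cis_mult mult.commute)
      then show "\<exists>y. \<bar>y\<bar> < \<delta> \<and> q = dir (t + y)"
        using cis_dir d(2)[of q] q(2) by (intro exI[of _ "Arg (w q)"]) (auto simp: dist_commute)
    qed
  qed
qed

definition multi_index :: "nat \<Rightarrow> nat \<Rightarrow> 2 \<Rightarrow> nat" where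
  "multi_index i j = (\<lambda>k. if k = 1 then i else j)"

text \<open>The homogeneous part of degree \<open>n\<close> of a power series in two variables, evaluated at
  \<open>(cos z, sin z)\<close>: the coefficient of \<open>r ^ n\<close> in polar coordinates.\<close>

definition polar_family :: "((2 \<Rightarrow> nat) \<Rightarrow> real) \<Rightarrow> nat \<Rightarrow> complex \<Rightarrow> complex" where
  "polar_family c n z = (\<Sum>i\<le>n. of_real (c (multi_index i (n - i))) * cos z ^ i * sin z ^ (n - i))"

lemma bij_multi_index: "bij_betw (\<lambda>(n, i). multi_index i (n - i)) (Sigma UNIV (\<lambda>n. {..n})) UNIV"
proof (rule bij_betwI[where g = "\<lambda>\<alpha>. (\<alpha> 1 + \<alpha> 2, \<alpha> 1)"])
  show "(case (\<alpha> 1 + \<alpha> 2, \<alpha> 1) of (n, i) \<Rightarrow> multi_index i (n - i)) = \<alpha>" for \<alpha>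
  proof
    fix k :: 2
    show "(case (\<alpha> 1 + \<alpha> 2, \<alpha> 1) of (n, i) \<Rightarrow> multi_index i (n - i)) k = \<alpha> k"
      using exhaust_2[of k] by (auto simp: multi_index_def)
  qed
qed (auto simp: multi_index_def)

lemma norm_sin_le: "norm (sin z) \<le> exp (norm (z::complex))"
proof -
  have "norm (exp (\<i> * z) - exp (- (\<i> * z))) \<le> exp (norm z) + exp (norm z)"
    using norm_exp[of "\<i> * z"] norm_exp[of "- (\<i> * z)"]
    by (intro order_trans[OF norm_triangle_ineq4] add_mono) (auto simp: norm_mult)
  then show ?thesis by (simp add: sin_exp_eq norm_divide norm_mult)
qed

text \<open>Sorting the absolutely convergent double series by total degree. The disc of radius \<open>8\<close> is
  bounded, so that sine and cosine are bounded on it, and large enough to contain the unit disc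
  around every angle between \<open>-\<pi>\<close> and \<open>\<pi>\<close>.\<close>

lemma polar_expansion:
  fixes f :: "real ^ 2 \<Rightarrow> real"
  assumes "0 < e" and f: "\<forall>x\<in>ball 0 e. ((\<lambda>\<alpha>. c \<alpha> * (\<Prod>i\<in>UNIV. (x $ i) ^ \<alpha> i)) has_sum f x) UNIV"
  shows "power_family (ball 0 8) (polar_family c)" "real_family (ball 0 8) (polar_family c)"
    "\<And>r t. 0 \<le> r \<Longrightarrow> r < e \<Longrightarrow> real_ev (polar_family c) r t = f (r *\<^sub>R dir t)"
proof -
  have prod: "(\<Prod>i\<in>UNIV. (x $ i) ^ \<alpha> i) = (x $ 1) ^ \<alpha> 1 * (x $ 2) ^ \<alpha> 2" for x :: "real ^ 2" and \<alpha>
    by (simp add: UNIV_2)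
  \<comment> \<open>Convergence at the diagonal point with coordinates \<open>s\<close> bounds all coefficients by a geometric
    sequence in the total degree.\<close>
  define s where "s = e / 3"
  define x0 :: "real ^ 2" where "x0 = (\<chi> i. s)"
  have s: "0 < s" using assms(1) by (simp add: s_def)
  have "norm x0 \<le> 2 * s"
    using norm_le_l1_cart[of x0] s by (simp add: x0_def sum_2)
  then have "x0 \<in> ball 0 e" using assms(1) by (simp add: s_def)
  from f[rule_format, OF this] have "(\<lambda>\<alpha>. c \<alpha> * s ^ (\<alpha> 1 + \<alpha> 2)) summable_on UNIV"
    unfolding prod by (auto simp: x0_def summable_on_def power_add)
  then have sum: "(\<lambda>\<alpha>. \<bar>c \<alpha> * s ^ (\<alpha> 1 + \<alpha> 2)\<bar>) summable_on UNIV"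
    using summable_on_iff_abs_summable_on_real[of "\<lambda>\<alpha>. c \<alpha> * s ^ (\<alpha> 1 + \<alpha> 2)"] by (simp only: real_norm_def)
  define M where "M = infsum (\<lambda>\<alpha>. \<bar>c \<alpha> * s ^ (\<alpha> 1 + \<alpha> 2)\<bar>) UNIV + 1"
  have M0: "\<bar>c \<alpha> * s ^ (\<alpha> 1 + \<alpha> 2)\<bar> \<le> M" for \<alpha>
    using finite_sum_le_infsum[OF sum, of "{\<alpha>}"] by (simp add: M_def)
  have M: "0 < M" unfolding M_def using infsum_nonneg[of UNIV "\<lambda>\<alpha>. \<bar>c \<alpha> * s ^ (\<alpha> 1 + \<alpha> 2)\<bar>"] by simp
  define E where "E = exp (8::real)"
  have E: "0 < E" by (simp add: E_def)
  show "power_family (ball 0 8) (polar_family c)"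
  proof (rule power_familyI[of _ _ M "2 * E / s"])
    show "polar_family c k holomorphic_on ball 0 8" for k
      unfolding polar_family_def[abs_def] by (intro holomorphic_intros)
    fix k and y :: complex assume y: "y \<in> ball 0 8"
    have sc: "norm (cos y) \<le> E" "norm (sin y) \<le> E"
      using norm_cos_le[of y] norm_sin_le[of y] y by (auto simp: E_def intro: order_trans)
    have "norm (of_real (c (multi_index i (k - i))) * cos y ^ i * sin y ^ (k - i)) \<le> M / s ^ k * E ^ k"
      if "i \<le> k" for i
    proof -
      have "\<bar>c (multi_index i (k - i))\<bar> * s ^ k \<le> M"
        using M0[of "multi_index i (k - i)"] that s by (simp add: multi_index_def abs_mult)
      then have 1: "\<bar>c (multi_index i (k - i))\<bar> \<le> M / s ^ k" using s by (simp add: field_simps)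
      have "norm (of_real (c (multi_index i (k - i))) * cos y ^ i * sin y ^ (k - i)) \<le> M / s ^ k * E ^ i * E ^ (k - i)"
        unfolding norm_mult norm_power using 1 sc s M E by (intro mult_mono power_mono) auto
      also have "\<dots> = M / s ^ k * E ^ k" using that by (simp add: mult.assoc flip: power_add)
      finally show ?thesis .
    qed
    then have "norm (polar_family c k y) \<le> (\<Sum>i\<le>k. M / s ^ k * E ^ k)"
      unfolding polar_family_def by (intro order_trans[OF norm_sum] sum_mono) auto
    also have "\<dots> = real (Suc k) * (M / s ^ k * E ^ k)" by simp
    also have "\<dots> \<le> 2 ^ k * (M / s ^ k * E ^ k)"
    proof (rule mult_right_mono)
      have "Suc k \<le> 2 ^ k" using less_exp[of k] by linarith
      then show "real (Suc k) \<le> 2 ^ k" by (metis numeral_power_eq_of_nat_cancel_iff of_nat_le_iff of_nat_numeral of_nat_power)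
    qed (use M s E in auto)
    also have "\<dots> = M * (2 * E / s) ^ k" by (simp add: power_mult_distrib power_divide)
    finally show "norm (polar_family c k y) \<le> M * (2 * E / s) ^ k" .
  qed (use M s E in auto)
  have real: "polar_family c n (of_real t) = of_real (\<Sum>i\<le>n. c (multi_index i (n - i)) * cos t ^ i * sin t ^ (n - i))" for n t
    unfolding polar_family_def by (simp add: cos_of_real sin_of_real)
  then show "real_family (ball 0 8) (polar_family c)" by (simp add: real_family_def)
  show "real_ev (polar_family c) r t = f (r *\<^sub>R dir t)" if r: "0 \<le> r" "r < e" for r t
  proof -
    let ?x = "r *\<^sub>R dir t"
    have "?x \<in> ball 0 e" using r by simp
    from f[rule_format, OF this] have "((\<lambda>\<alpha>. c \<alpha> * ((r * cos t) ^ \<alpha> 1 * (r * sin t) ^ \<alpha> 2)) has_sum f ?x) UNIV"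
      unfolding prod by simp
    then have "((\<lambda>p. case p of (n, i) \<Rightarrow> c (multi_index i (n - i)) * ((r * cos t) ^ i * (r * sin t) ^ (n - i)))
        has_sum f ?x) (Sigma UNIV (\<lambda>n. {..n}))"
      using has_sum_reindex_bij_betw[OF bij_multi_index, of "\<lambda>\<alpha>. c \<alpha> * ((r * cos t) ^ \<alpha> 1 * (r * sin t) ^ \<alpha> 2)" "f ?x"]
      by (simp add: case_prod_unfold multi_index_def)
    then have "((\<lambda>n. \<Sum>i\<le>n. c (multi_index i (n - i)) * ((r * cos t) ^ i * (r * sin t) ^ (n - i))) has_sum f ?x) UNIV"
      by (rule has_sum_SigmaD) (auto intro!: has_sum_finiteI)
    then have "(\<lambda>n. \<Sum>i\<le>n. c (multi_index i (n - i)) * ((r * cos t) ^ i * (r * sin t) ^ (n - i))) sums f ?x"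
      by (rule has_sum_imp_sums)
    moreover have "(\<Sum>i\<le>n. c (multi_index i (n - i)) * ((r * cos t) ^ i * (r * sin t) ^ (n - i))) =
        (\<Sum>i\<le>n. c (multi_index i (n - i)) * cos t ^ i * sin t ^ (n - i)) * r ^ n" for n
      unfolding sum_distrib_right by (intro sum.cong) (auto simp: power_mult_distrib mult_ac simp flip: power_add)
    ultimately have "(\<lambda>n. (\<Sum>i\<le>n. c (multi_index i (n - i)) * cos t ^ i * sin t ^ (n - i)) * r ^ n) sums f ?x"
      by simp
    then have "(\<lambda>n. complex_of_real ((\<Sum>i\<le>n. c (multi_index i (n - i)) * cos t ^ i * sin t ^ (n - i)) * r ^ n)) sums of_real (f ?x)"
      by (rule sums_of_real)
    then have "(\<lambda>n. polar_family c n (of_real t) * of_real r ^ n) sums of_real (f ?x)"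
      unfolding real by simp
    then show ?thesis unfolding real_ev_def ev_def by (simp add: sums_iff)
  qed
qed

lemma real_family_add:
  "real_family S u \<Longrightarrow> real_family S v \<Longrightarrow> real_family S (\<lambda>k y. u k y + v k y)"
  by (simp add: real_family_def)

lemma real_family_times:
  "real_family S u \<Longrightarrow> real_family S v \<Longrightarrow> real_family S (pf_times u v)"
  by (auto simp: real_family_def pf_times_def intro!: sum_in_Reals Reals_mult)

lemma eventually_at_right_less: "0 < e \<Longrightarrow> eventually (\<lambda>r. 0 < r \<and> r < e) (at_right (0::real))"
  by (auto simp: eventually_at_right_field)

text \<open>The common zeros of finitely many real functions are the zeros of the sum of their squares, so a
  single equation suffices.\<close>

lemma sum_of_squares_polar:
  fixes F :: "(real ^ 2 \<Rightarrow> real) set"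
  assumes "finite F" "\<forall>f\<in>F. real_analytic_on f U" "0 \<in> U"
  shows "\<exists>G. power_family (ball 0 8) G \<and> real_family (ball 0 8) G \<and>
     eventually (\<lambda>r. \<forall>t. \<bar>t\<bar> < 8 \<longrightarrow> real_ev G r t = (\<Sum>f\<in>F. f (r *\<^sub>R dir t) ^ 2)) (at_right 0)"
  using assms(1,2)
proof (induction F rule: finite_induct)
  case empty
  have "power_family (ball 0 8) (\<lambda>k y. 0)" by (rule power_familyI[of _ _ 1 1]) auto
  then show ?case
    by (intro exI[of _ "\<lambda>k y. 0"]) (auto simp: real_family_def real_ev_def ev_def)
next
  case (insert g F)
  then obtain G where G: "power_family (ball 0 8) G" "real_family (ball 0 8) G"
     "eventually (\<lambda>r. \<forall>t. \<bar>t\<bar> < 8 \<longrightarrow> real_ev G r t = (\<Sum>f\<in>F. f (r *\<^sub>R dir t) ^ 2)) (at_right 0)"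
    by auto
  have "real_analytic_on g U" using insert.prems by simp
  then obtain c e where e: "0 < e" "\<forall>x\<in>ball 0 e. ((\<lambda>\<alpha>. c \<alpha> * (\<Prod>i\<in>UNIV. (x $ i) ^ \<alpha> i)) has_sum g x) UNIV"
    using assms(3) unfolding real_analytic_on_def by fastforce
  note p = polar_expansion[OF e]
  let ?p = "polar_family c" and ?S = "ball (0::complex) 8"
  have pp: "power_family ?S (pf_times ?p ?p)" "real_family ?S (pf_times ?p ?p)"
    using p by (auto intro: power_family_times real_family_times)
  have "eventually (\<lambda>r. \<forall>t. \<bar>t\<bar> < 8 \<longrightarrow> real_ev (\<lambda>k y. pf_times ?p ?p k y + G k y) r t =
      (\<Sum>f\<in>insert g F. f (r *\<^sub>R dir t) ^ 2)) (at_right 0)"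
    using G(3) eventually_at_right_less[OF e(1)]
      eventually_nhds_imp_at_right[OF eventually_nhds_of_real[OF ev_add[OF pp(1) G(1)]]]
      eventually_nhds_imp_at_right[OF eventually_nhds_of_real[OF ev_times[OF p(1,1)]]]
      eventually_nhds_imp_at_right[OF real_ev_eq[OF p(1,2)]]
  proof eventually_elim
    case (elim r)
    show ?case
    proof (intro allI impI)
      fix t :: real assume t: "\<bar>t\<bar> < 8"
      then have S: "complex_of_real t \<in> ?S" by simp
      have "ev ?p (of_real r) (of_real t) = of_real (g (r *\<^sub>R dir t))"
        using elim(2,5) S p(3)[of r t] by simp
      then have "real_ev (\<lambda>k y. pf_times ?p ?p k y + G k y) r t = g (r *\<^sub>R dir t) ^ 2 + real_ev G r t"
        using elim(3,4) S unfolding real_ev_def by (simp add: power2_eq_square)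
      then show "real_ev (\<lambda>k y. pf_times ?p ?p k y + G k y) r t = (\<Sum>f\<in>insert g F. f (r *\<^sub>R dir t) ^ 2)"
        using elim(1) t insert.hyps by simp
    qed
  qed
  moreover have "power_family ?S (\<lambda>k y. pf_times ?p ?p k y + G k y)" "real_family ?S (\<lambda>k y. pf_times ?p ?p k y + G k y)"
    using pp G by (auto intro: power_family_add real_family_add)
  ultimately show ?case by blast
qed

text \<open>Dividing by the lowest power of \<open>r\<close> that occurs makes the coefficient of \<open>r ^ 0\<close> nonzero without
  changing the zeros for \<open>r > 0\<close>. Geometrically this passes from the total to the strict
  transform.\<close>

lemma remove_power_of_variable:
  assumes G: "power_family S G" "real_family S G" and nz: "\<exists>k. \<exists>y\<in>S. G k y \<noteq> 0"
  obtains F where "power_family S F" "real_family S F" "\<exists>y\<in>S. F 0 y \<noteq> 0"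
    "eventually (\<lambda>r. \<forall>t. complex_of_real t \<in> S \<longrightarrow> (real_ev G r t = 0 \<longleftrightarrow> real_ev F r t = 0)) (at_right 0)"
proof -
  define d where "d = (LEAST k. \<exists>y\<in>S. G k y \<noteq> 0)"
  have d: "\<exists>y\<in>S. G d y \<noteq> 0" "\<And>k y. k < d \<Longrightarrow> y \<in> S \<Longrightarrow> G k y = 0"
    unfolding d_def using LeastI_ex[OF nz] not_less_Least[of _ "\<lambda>k. \<exists>y\<in>S. G k y \<noteq> 0"] by blast+
  define F where "F = (\<lambda>k. G (k + d))"
  obtain M R where MR: "0 < M" "0 < R" "\<And>k y. y \<in> S \<Longrightarrow> norm (G k y) \<le> M * R ^ k"
    using G(1) unfolding power_family_def by blast
  have "power_family S F"
  proof (rule power_familyI[of _ _ "M * R ^ d" R])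
    show "F k holomorphic_on S" for k using G(1) by (simp add: F_def power_family_def)
    show "norm (F k y) \<le> M * R ^ d * R ^ k" if "y \<in> S" for k y
      using MR(3)[OF that, of "k + d"] by (simp add: F_def power_add mult_ac)
  qed (use MR in auto)
  moreover have "real_family S F" using G(2) by (simp add: real_family_def F_def)
  moreover have "\<exists>y\<in>S. F 0 y \<noteq> 0" using d(1) by (simp add: F_def)
  moreover have "eventually (\<lambda>r. \<forall>t. complex_of_real t \<in> S \<longrightarrow> (real_ev G r t = 0 \<longleftrightarrow> real_ev F r t = 0)) (at_right 0)"
    using eventually_nhds_imp_at_right[OF eventually_nhds_of_real[OF power_family_summable[OF G(1)]]]
      eventually_at_right_less[OF zero_less_one]
  proof eventually_elim
    case (elim r)
    show ?case
    proof (intro allI impI)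
      fix t assume t: "complex_of_real t \<in> S"
      let ?r = "complex_of_real r" and ?t = "complex_of_real t"
      have s: "summable (\<lambda>k. G k ?t * ?r ^ k)" using elim t by (auto intro: summable_norm_cancel)
      have "ev G ?r ?t = (\<Sum>k. G (k + d) ?t * ?r ^ (k + d)) + (\<Sum>k<d. G k ?t * ?r ^ k)"
        unfolding ev_def by (rule suminf_split_initial_segment[OF s])
      also have "(\<Sum>k<d. G k ?t * ?r ^ k) = 0" using d(2) t by (intro sum.neutral) auto
      also have "(\<Sum>k. G (k + d) ?t * ?r ^ (k + d)) = (\<Sum>k. ?r ^ d * (F k ?t * ?r ^ k))"
        by (simp add: F_def power_add mult_ac)
      also have "\<dots> = ?r ^ d * ev F ?r ?t"
        unfolding ev_def
      proof (rule suminf_mult)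
        have "summable (\<lambda>k. inverse (?r ^ d) * (G (k + d) ?t * ?r ^ (k + d)))"
          using summable_ignore_initial_segment[OF s, of d] by (rule summable_mult)
        then show "summable (\<lambda>k. F k ?t * ?r ^ k)"
          using elim(2) by (simp add: F_def power_add field_simps)
      qed
      finally have "real_ev G r t = r ^ d * real_ev F r t"
        unfolding real_ev_def by (simp flip: of_real_power)
      then show "real_ev G r t = 0 \<longleftrightarrow> real_ev F r t = 0" using elim(2) by simp
    qed
  qed
  ultimately show thesis using that by blast
qed

lemma analytic_dim_ge_of_ball:
  assumes "ball 0 e \<subseteq> (X :: (real ^ 'n) set)" "0 < e"
  shows "CARD('n) \<le> analytic_dim X"
  unfolding analytic_dim_def
proof (rule Greatest_le_nat)
  have "analytic_submanifold CARD('n) (ball (0 :: real ^ 'n) e)"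
    unfolding analytic_submanifold_def
    by (intro ballI exI[of _ "ball 0 e"], rule exI[of _ 0]) (auto simp: independent_empty)
  then show "\<exists>M. M \<noteq> {} \<and> M \<subseteq> X \<and> analytic_submanifold CARD('n) M"
    using assms by (intro exI[of _ "ball 0 e"]) auto
  fix d assume "\<exists>M. M \<noteq> {} \<and> M \<subseteq> X \<and> analytic_submanifold d M"
  then show "d \<le> CARD('n)" unfolding analytic_submanifold_def by fastforce
qed

lemma power_family_shift:
  assumes "power_family (ball 0 8) H" "real_family (ball 0 8) H" "norm (complex_of_real t) < 4"
  shows "power_family (ball 0 1) (\<lambda>k y. H k (of_real t + y))" "real_family (ball 0 1) (\<lambda>k y. H k (of_real t + y))"
proof -
  have sub: "of_real t + y \<in> ball 0 8" if "y \<in> ball (0::complex) 1" for y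
    using that assms(3) norm_triangle_ineq[of "of_real t" y] by simp
  obtain M R where MR: "0 < M" "0 < R" "\<And>k y. y \<in> ball 0 8 \<Longrightarrow> norm (H k y) \<le> M * R ^ k"
    using assms(1) unfolding power_family_def by blast
  show "power_family (ball 0 1) (\<lambda>k y. H k (of_real t + y))"
  proof (rule power_familyI[OF _ MR(1,2)])
    fix k
    have "H k \<circ> (\<lambda>y. of_real t + y) holomorphic_on ball 0 1"
    proof (rule holomorphic_on_compose_gen[of _ _ _ "ball 0 8"])
      show "(\<lambda>y. of_real t + y) ` ball 0 1 \<subseteq> ball (0::complex) 8" using sub by blast
    qed (use assms(1) in \<open>auto simp: power_family_def intro: holomorphic_intros\<close>)
    then show "(\<lambda>y. H k (of_real t + y)) holomorphic_on ball 0 1" by (simp add: o_def)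
  qed (use MR(3) sub in blast)
  show "real_family (ball 0 1) (\<lambda>k y. H k (of_real t + y))"
    using assms(2) sub unfolding real_family_def by (metis of_real_add)
qed

text \<open>By the identity theorem a holomorphic function on a disc that is not identically zero has finite
  order at every point of the disc.\<close>

lemma finite_order_of_shift:
  assumes h: "h holomorphic_on ball 0 R" and a: "norm a < R" and y: "y \<in> ball 0 R" "h y \<noteq> (0::complex)"
  shows "\<exists>n. (deriv ^^ n) (\<lambda>y. h (a + y)) 0 \<noteq> 0"
proof (rule ccontr)
  assume "\<not> ?thesis"
  then have z: "(deriv ^^ n) (\<lambda>y. h (a + y)) 0 = 0" for n by blast
  have sub: "a + w \<in> ball 0 R" if "w \<in> ball (- a) R" for w
  proof -
    have "norm (a + w) = norm (- a - w)" by (subst norm_minus_cancel[symmetric]) simp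
    then show ?thesis using that by (simp add: dist_norm)
  qed
  have "h \<circ> (\<lambda>y. a + y) holomorphic_on ball (- a) R"
  proof (rule holomorphic_on_compose_gen[of _ _ _ "ball 0 R"])
    show "(\<lambda>y. a + y) ` ball (- a) R \<subseteq> ball 0 R" using sub by blast
  qed (use h in \<open>auto intro: holomorphic_intros\<close>)
  then have "(\<lambda>y. h (a + y)) holomorphic_on ball (- a) R" by (simp add: o_def)
  then have "(\<lambda>y. h (a + y)) (y - a) = 0"
    by (rule holomorphic_fun_eq_0_on_connected[OF _ _ _ z]) (use a y in \<open>auto simp: dist_norm\<close>)
  then show False using y by simp
qed

lemma continuous_on_extend_by_zero:
  fixes f :: "real \<Rightarrow> real"
  assumes "continuous_on {0<..<\<eta>} f" "(f \<longlongrightarrow> 0) (at_right 0)" "\<epsilon> < \<eta>"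
  shows "continuous_on {0..\<epsilon>} (\<lambda>r. if r \<le> 0 then 0 else f r)"
  unfolding continuous_on_eq_continuous_within
proof
  let ?g = "\<lambda>r. if r \<le> 0 then 0 else f r"
  fix x assume x: "x \<in> {0..\<epsilon>}"
  show "continuous (at x within {0..\<epsilon>}) ?g"
  proof (cases "x = 0")
    case True
    have "(?g \<longlongrightarrow> 0) (at 0 within {0..\<epsilon>})"
    proof (rule tendstoI)
      fix e :: real assume "0 < e"
      then obtain b where b: "0 < b" "\<And>r. 0 < r \<Longrightarrow> r < b \<Longrightarrow> \<bar>f r\<bar> < e"
        using tendstoD[OF assms(2)] unfolding eventually_at_right_field by auto
      then show "eventually (\<lambda>r. dist (?g r) 0 < e) (at 0 within {0..\<epsilon>})"
        unfolding eventually_at by (intro exI[of _ b]) auto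
    qed
    then show ?thesis using True by (simp add: continuous_within)
  next
    case False
    then have x0: "x \<in> {0<..<\<eta>}" using x assms(3) by auto
    then have "isCont f x" using assms(1) by (simp add: continuous_on_eq_continuous_at)
    moreover
    have "eventually (\<lambda>r. r \<in> {0<..}) (nhds x)" using x0 by (intro eventually_nhds_in_open) auto
    then have "eventually (\<lambda>r. ?g r = f r) (nhds x)" by eventually_elim auto
    then have "isCont ?g x \<longleftrightarrow> isCont f x" by (rule isCont_cong)
    ultimately have "isCont ?g x" by simp
    then show ?thesis by (rule continuous_at_imp_continuous_at_within)
  qed
qed

text \<open>In polar coordinates the curve is the zero set of a series in \<open>r\<close> with coefficients holomorphic in
  the angle. If all coefficients vanished, the set would contain a disc and have dimension \<open>2\<close>;
  hence after division by a power of \<open>r\<close> the leading coefficient has finite order at every angle,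
  and the local structure theorem applies near each direction. Compactness of the circle leaves
  finitely many directions, and arcs tending to different directions are disjoint for small \<open>r\<close>.\<close>

theorem conic_arcs_of_curve:
  fixes X :: "(real ^ 2) set"
  assumes "real_analytic_set X" "analytic_dim X = 1" "0 \<in> X"
  shows "\<exists>\<epsilon> (I :: ((real ^ 2) \<times> (real \<Rightarrow> real)) set) \<gamma>. conic_arcs X \<epsilon> I \<gamma>"
proof -
  obtain U F where U: "open U" "0 \<in> U" and F: "finite F" "\<forall>f\<in>F. real_analytic_on f U"
    and X: "X \<inter> U = {x\<in>U. \<forall>f\<in>F. f x = 0}"
    using assms(1)[unfolded real_analytic_set_def, THEN spec[of _ 0]] by (elim exE conjE) (rule that)
  obtain e0 where e0: "0 < e0" "ball 0 e0 \<subseteq> U" using U open_contains_ball by blast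
  let ?S = "ball (0::complex) 8"
  obtain G where G: "power_family ?S G" "real_family ?S G"
     "eventually (\<lambda>r. \<forall>t. \<bar>t\<bar> < 8 \<longrightarrow> real_ev G r t = (\<Sum>f\<in>F. f (r *\<^sub>R dir t) ^ 2)) (at_right 0)"
    using sum_of_squares_polar[OF F U(2)] by (elim exE conjE) (rule that)
  have inX: "eventually (\<lambda>r. \<forall>t. \<bar>t\<bar> < 8 \<longrightarrow> (r *\<^sub>R dir t \<in> X \<longleftrightarrow> real_ev G r t = 0)) (at_right 0)"
    using G(3) eventually_at_right_less[OF e0(1)]
  proof eventually_elim
    case (elim r)
    show ?case
    proof (intro allI impI)
      fix t :: real assume t: "\<bar>t\<bar> < 8"
      have "r *\<^sub>R dir t \<in> U" using elim(2) e0(2) by auto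
      then have "r *\<^sub>R dir t \<in> X \<longleftrightarrow> (\<forall>f\<in>F. f (r *\<^sub>R dir t) = 0)" using X by blast
      also have "\<dots> \<longleftrightarrow> real_ev G r t = 0"
        using elim(1) t F(1) by (simp add: sum_nonneg_eq_0_iff)
      finally show "r *\<^sub>R dir t \<in> X \<longleftrightarrow> real_ev G r t = 0" .
    qed
  qed
  have "\<exists>k. \<exists>y\<in>?S. G k y \<noteq> 0"
  proof (rule ccontr)
    assume "\<not> ?thesis"
    then have zero: "real_ev G r t = 0" if "\<bar>t\<bar> < 8" for r t
      using that unfolding real_ev_def ev_def by simp
    from inX have "eventually (\<lambda>r. \<forall>t. \<bar>t\<bar> < 8 \<longrightarrow> r *\<^sub>R dir t \<in> X) (at_right 0)"
      by eventually_elim (use zero in blast)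
    then obtain e where e: "0 < e" "\<And>r t. 0 < r \<Longrightarrow> r < e \<Longrightarrow> \<bar>t\<bar> < 8 \<Longrightarrow> r *\<^sub>R dir t \<in> X"
      unfolding eventually_at_right_field by blast
    have "ball 0 e \<subseteq> X"
    proof
      fix x :: "real ^ 2" assume x: "x \<in> ball 0 e"
      show "x \<in> X"
      proof (cases "x = 0")
        case False
        then have "norm (x /\<^sub>R norm x) = 1" by simp
        then obtain t where t: "\<bar>t\<bar> \<le> pi" "x /\<^sub>R norm x = dir t" by (rule dir_cover_near) (rule that)
        have "x = norm x *\<^sub>R dir t" using False by (simp flip: t(2))
        moreover have "norm x *\<^sub>R dir t \<in> X" using False x t(1) pi_less_4 by (intro e(2)) auto
        ultimately show ?thesis by simp
      qed (simp add: assms)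
    qed
    then show False using analytic_dim_ge_of_ball[OF _ e(1), of X] assms(2) by simp
  qed
  then obtain H where H: "power_family ?S H" "real_family ?S H" "\<exists>y\<in>?S. H 0 y \<noteq> 0"
    and GH: "eventually (\<lambda>r. \<forall>t. complex_of_real t \<in> ?S \<longrightarrow> (real_ev G r t = 0 \<longleftrightarrow> real_ev H r t = 0)) (at_right 0)"
    by (rule remove_power_of_variable[OF G(1,2)]) (rule that)
  define Q where "Q = (\<lambda>p z. case z of (t, \<delta>, \<eta>, fs, d) \<Rightarrow>
      \<bar>t\<bar> \<le> pi \<and> p = dir t \<and> 0 < \<delta> \<and> \<delta> \<le> 1 \<and> 0 < \<eta> \<and> ordered_arcs \<eta> fs \<and>
      (\<forall>f\<in>set fs. (f \<longlongrightarrow> 0) (at_right 0) \<and> (\<forall>x\<in>{0<..<\<eta>}. \<bar>f x\<bar> < \<delta>)) \<and>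
      (\<forall>x\<in>{0<..<\<eta>}. \<forall>y. \<bar>y\<bar> < \<delta> \<longrightarrow> (real_ev H x (t + y) = 0 \<longleftrightarrow> (\<exists>f\<in>set fs. y = f x))) \<and>
      0 < d \<and> (\<forall>q. norm q = 1 \<longrightarrow> dist p q < d \<longrightarrow> (\<exists>y. \<bar>y\<bar> < \<delta> \<and> q = dir (t + y))))"
  have "\<forall>p\<in>sphere 0 1. \<exists>z. Q p z"
  proof
    fix p :: "real ^ 2" assume "p \<in> sphere 0 1"
    then have "norm p = 1" by simp
    then obtain t where t: "\<bar>t\<bar> \<le> pi" "p = dir t"
      and cov: "\<And>\<delta>. 0 < \<delta> \<Longrightarrow> \<exists>d>0. \<forall>q. norm q = 1 \<longrightarrow> dist p q < d \<longrightarrow> (\<exists>y. \<bar>y\<bar> < \<delta> \<and> q = dir (t + y))"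
      by (rule dir_cover_near) (rule that)
    have t4: "norm (complex_of_real t) < 4" using t(1) pi_less_4 by simp
    define u where "u = (\<lambda>k y. H k (of_real t + y))"
    have u: "power_family (ball 0 1) u" "real_family (ball 0 1) u"
      using power_family_shift[OF H(1,2), of t] t4 by (auto simp: u_def)
    have "\<exists>n. (deriv ^^ n) (u 0) 0 \<noteq> 0"
    proof -
      obtain y where y: "y \<in> ?S" "H 0 y \<noteq> 0" using H(3) by blast
      show ?thesis
        unfolding u_def using H(1) t4 by (intro finite_order_of_shift[where R = 8 and y = y]) (use y in \<open>auto simp: power_family_def\<close>)
    qed
    then obtain n where "(deriv ^^ n) (u 0) 0 \<noteq> 0" by blast
    from local_zero_arcs[OF u zero_less_one this] obtain \<delta> \<eta> fs where
      L: "0 < \<delta>" "\<delta> \<le> 1" "0 < \<eta>" "ordered_arcs \<eta> fs"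
      "\<forall>f\<in>set fs. (f \<longlongrightarrow> 0) (at_right 0) \<and> (\<forall>x\<in>{0<..<\<eta>}. \<bar>f x\<bar> < \<delta>)"
      "\<forall>x\<in>{0<..<\<eta>}. \<forall>y. \<bar>y\<bar> < \<delta> \<longrightarrow> (real_ev u x y = 0 \<longleftrightarrow> (\<exists>f\<in>set fs. y = f x))"
      by blast
    have shift: "real_ev u x y = real_ev H x (t + y)" for x y
      by (simp add: real_ev_def ev_def u_def)
    obtain d where "d > 0" "\<forall>q. norm q = 1 \<longrightarrow> dist p q < d \<longrightarrow> (\<exists>y. \<bar>y\<bar> < \<delta> \<and> q = dir (t + y))"
      using cov[OF L(1)] by blast
    then have "Q p (t, \<delta>, \<eta>, fs, d)" using t L unfolding Q_def shift by simp
    then show "\<exists>z. Q p z" by blast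
  qed
  from bchoice[OF this] obtain Z where Z: "\<forall>p\<in>sphere 0 1. Q p (Z p)" by blast
  define t where "t = (\<lambda>p. fst (Z p))"
  define \<delta> where "\<delta> = (\<lambda>p. fst (snd (Z p)))"
  define \<eta> where "\<eta> = (\<lambda>p. fst (snd (snd (Z p))))"
  define fs where "fs = (\<lambda>p. fst (snd (snd (snd (Z p)))))"
  define d where "d = (\<lambda>p. snd (snd (snd (snd (Z p)))))"
  have local: "\<bar>t p\<bar> \<le> pi" "p = dir (t p)" "0 < \<delta> p" "\<delta> p \<le> 1" "0 < \<eta> p" "ordered_arcs (\<eta> p) (fs p)"
      "\<And>f. f \<in> set (fs p) \<Longrightarrow> (f \<longlongrightarrow> 0) (at_right 0)"
      "\<And>f x. f \<in> set (fs p) \<Longrightarrow> x \<in> {0<..<\<eta> p} \<Longrightarrow> \<bar>f x\<bar> < \<delta> p"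
      "\<And>x y. x \<in> {0<..<\<eta> p} \<Longrightarrow> \<bar>y\<bar> < \<delta> p \<Longrightarrow> real_ev H x (t p + y) = 0 \<longleftrightarrow> (\<exists>f\<in>set (fs p). y = f x)"
      "0 < d p" "\<And>q. norm q = 1 \<Longrightarrow> dist p q < d p \<Longrightarrow> (\<exists>y. \<bar>y\<bar> < \<delta> p \<and> q = dir (t p + y))"
    if "norm p = 1" for p
  proof -
    have "Q p (Z p)" using Z that by simp
    moreover have "Z p = (t p, \<delta> p, \<eta> p, fs p, d p)" by (simp add: t_def \<delta>_def \<eta>_def fs_def d_def)
    ultimately have "Q p (t p, \<delta> p, \<eta> p, fs p, d p)" by simp
    note q = this[unfolded Q_def prod.case]
    show "\<bar>t p\<bar> \<le> pi" "p = dir (t p)" "0 < \<delta> p" "\<delta> p \<le> 1" "0 < \<eta> p" "ordered_arcs (\<eta> p) (fs p)"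
      "\<And>f. f \<in> set (fs p) \<Longrightarrow> (f \<longlongrightarrow> 0) (at_right 0)"
      "\<And>f x. f \<in> set (fs p) \<Longrightarrow> x \<in> {0<..<\<eta> p} \<Longrightarrow> \<bar>f x\<bar> < \<delta> p"
      "\<And>x y. x \<in> {0<..<\<eta> p} \<Longrightarrow> \<bar>y\<bar> < \<delta> p \<Longrightarrow> real_ev H x (t p + y) = 0 \<longleftrightarrow> (\<exists>f\<in>set (fs p). y = f x)"
      "0 < d p" "\<And>q. norm q = 1 \<Longrightarrow> dist p q < d p \<Longrightarrow> (\<exists>y. \<bar>y\<bar> < \<delta> p \<and> q = dir (t p + y))"
      using q by blast+
  qed
  obtain P where P: "P \<subseteq> sphere 0 1" "finite P" "sphere 0 1 \<subseteq> (\<Union>p\<in>P. ball p (d p))"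
  proof (rule compactE_image[of "sphere (0 :: real ^ 2) 1" "sphere 0 1" "\<lambda>p. ball p (d p)"])
    show "sphere 0 1 \<subseteq> (\<Union>p\<in>sphere 0 1. ball p (d p))" using local(10) by force
  qed auto
  have P1: "norm p = 1" if "p \<in> P" for p using P(1) that by auto
  \<comment> \<open>An arc is identified by its direction and its angular function, which is extended to \<open>0\<close> by its limit.\<close>
  define I where "I = Sigma P (\<lambda>p. set (fs p))"
  define \<gamma> where "\<gamma> = (\<lambda>(p, f) (r::real). dir (t p + (if r \<le> 0 then 0 else f r)))"
  have finI: "finite I" using P(2) by (auto simp: I_def)
  have lim: "(\<gamma> i \<longlongrightarrow> fst i) (at_right 0)" if i: "i \<in> I" for i
  proof -
    obtain p f where pf: "i = (p, f)" "p \<in> P" "f \<in> set (fs p)" using i by (auto simp: I_def)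
    have cd: "isCont dir s" for s
      using continuous_on_dir[OF continuous_on_id, of UNIV] by (simp add: continuous_on_eq_continuous_at)
    have "((\<lambda>r. dir (t p + f r)) \<longlongrightarrow> dir (t p + 0)) (at_right 0)"
      using local(7)[OF P1[OF pf(2)] pf(3)] by (intro isCont_tendsto_compose[OF cd] tendsto_intros)
    then have "((\<lambda>r. dir (t p + f r)) \<longlongrightarrow> p) (at_right 0)" using local(2)[OF P1[OF pf(2)]] by simp
    then have "(\<gamma> (p, f) \<longlongrightarrow> p) (at_right 0)"
      by (rule Lim_transform_eventually) (auto simp: \<gamma>_def eventually_at_filter)
    then show ?thesis by (simp add: pf(1))
  qed
  have sep: "eventually (\<lambda>r. fst i \<noteq> fst j \<longrightarrow> \<gamma> i r \<noteq> \<gamma> j r) (at_right 0)" if ij: "i \<in> I" "j \<in> I" for i j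
  proof (cases "fst i = fst j")
    case False
    have "((\<lambda>r. \<gamma> i r - \<gamma> j r) \<longlongrightarrow> fst i - fst j) (at_right 0)" using ij by (intro tendsto_diff lim)
    then have "eventually (\<lambda>r. \<gamma> i r - \<gamma> j r \<noteq> 0) (at_right 0)" using False by (intro tendsto_imp_eventually_ne) auto
    then show ?thesis by eventually_elim auto
  qed simp
  have "eventually (\<lambda>r. \<forall>i\<in>I. \<forall>j\<in>I. fst i \<noteq> fst j \<longrightarrow> \<gamma> i r \<noteq> \<gamma> j r) (at_right 0)"
    using sep finI by (intro eventually_ball_finite ballI) auto
  moreover have "eventually (\<lambda>r. \<forall>p\<in>P. r < \<eta> p) (at_right 0)"
    using local(5) P1 P(2) by (intro eventually_ball_finite ballI) (auto simp: eventually_at_right_field)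
  ultimately have "eventually (\<lambda>r. (\<forall>i\<in>I. \<forall>j\<in>I. fst i \<noteq> fst j \<longrightarrow> \<gamma> i r \<noteq> \<gamma> j r) \<and> (\<forall>p\<in>P. r < \<eta> p) \<and>
      (\<forall>t. \<bar>t\<bar> < 8 \<longrightarrow> (r *\<^sub>R dir t \<in> X \<longleftrightarrow> real_ev H r t = 0))) (at_right 0)"
    using inX GH by eventually_elim simp
  then obtain b where b: "0 < b" and B: "\<And>r. 0 < r \<Longrightarrow> r < b \<Longrightarrow>
      (\<forall>i\<in>I. \<forall>j\<in>I. fst i \<noteq> fst j \<longrightarrow> \<gamma> i r \<noteq> \<gamma> j r) \<and> (\<forall>p\<in>P. r < \<eta> p) \<and>
      (\<forall>t. \<bar>t\<bar> < 8 \<longrightarrow> (r *\<^sub>R dir t \<in> X \<longleftrightarrow> real_ev H r t = 0))"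
    unfolding eventually_at_right_field by blast
  define \<epsilon> where "\<epsilon> = b / 2"
  have \<epsilon>: "0 < \<epsilon>" "\<epsilon> < b" using b by (auto simp: \<epsilon>_def)
  have onX: "r *\<^sub>R dir (t p + y) \<in> X \<longleftrightarrow> (\<exists>f\<in>set (fs p). y = f r)"
    if r: "0 < r" "r \<le> \<epsilon>" and p: "p \<in> P" and y: "\<bar>y\<bar> < \<delta> p" for r p y
  proof -
    have "\<bar>t p + y\<bar> < 8" using local(1,4)[OF P1[OF p]] y pi_less_4 by linarith
    then have "r *\<^sub>R dir (t p + y) \<in> X \<longleftrightarrow> real_ev H r (t p + y) = 0" using B[of r] r \<epsilon> by simp
    also have "\<dots> \<longleftrightarrow> (\<exists>f\<in>set (fs p). y = f r)"
      using B[of r] r \<epsilon> p by (intro local(9)[OF P1[OF p] _ y]) auto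
    finally show ?thesis .
  qed
  have "conic_arcs X \<epsilon> I \<gamma>"
    unfolding conic_arcs_def
  proof (intro conjI ballI impI)
    fix i assume i: "i \<in> I"
    then obtain p f where pf: "i = (p, f)" "p \<in> P" "f \<in> set (fs p)" by (auto simp: I_def)
    have "\<epsilon> < \<eta> p" using B[of \<epsilon>] \<epsilon> pf by auto
    then have "continuous_on {0..\<epsilon>} (\<lambda>r. if r \<le> 0 then 0 else f r)"
      using local(6,7)[OF P1[OF pf(2)]] pf(3)
      by (intro continuous_on_extend_by_zero[of "\<eta> p"]) (auto simp: ordered_arcs_def)
    then show "continuous_on {0..\<epsilon>} (\<gamma> i)"
      unfolding pf(1) \<gamma>_def prod.case by (intro continuous_intros)
    show "\<gamma> i ` {0..\<epsilon>} \<subseteq> sphere 0 1" by (auto simp: pf(1) \<gamma>_def)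
  next
    fix i j r assume i: "i \<in> I" and j: "j \<in> I" and r: "r \<in> {0<..\<epsilon>}" and eq: "\<gamma> i r = \<gamma> j r"
    have rb: "0 < r" "r < b" using r \<epsilon> by auto
    have "fst i = fst j" using B[OF rb] i j eq by blast
    then obtain p f g where pf: "i = (p, f)" "j = (p, g)" "p \<in> P" "f \<in> set (fs p)" "g \<in> set (fs p)"
      using i j by (auto simp: I_def)
    have re: "r \<in> {0<..<\<eta> p}" using B[OF rb] rb pf(3) by simp
    have "dir (t p + f r) = dir (t p + g r)" using eq r by (simp add: pf \<gamma>_def)
    moreover have "\<bar>(t p + f r) - (t p + g r)\<bar> < 2"
      using local(8)[OF P1[OF pf(3)] pf(4) re] local(8)[OF P1[OF pf(3)] pf(5) re] local(4)[OF P1[OF pf(3)]] by linarith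
    ultimately have same: "f r = g r" using dir_inj_local by force
    have "f = g"
    proof (rule ccontr)
      assume "f \<noteq> g"
      obtain m n where mn: "m < length (fs p)" "fs p ! m = f" "n < length (fs p)" "fs p ! n = g"
        using pf(4,5) by (auto simp: in_set_conv_nth)
      then have "m \<noteq> n" using \<open>f \<noteq> g\<close> by auto
      then have "m < n \<or> n < m" by linarith
      moreover have "sorted_wrt (\<lambda>f g. \<forall>x\<in>{0<..<\<eta> p}. f x < g x) (fs p)"
        using local(6)[OF P1[OF pf(3)]] by (simp add: ordered_arcs_def)
      ultimately have "f r < g r \<or> g r < f r"
        using sorted_wrt_nth_less[of _ "fs p" m n] sorted_wrt_nth_less[of _ "fs p" n m] mn re by blast
      then show False using same by simp
    qed
    then show "i = j" using pf by simp
  next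
    show "X \<inter> cball 0 \<epsilon> - {0} = (\<Union>i\<in>I. (\<lambda>r. r *\<^sub>R \<gamma> i r) ` {0<..\<epsilon>})"
    proof (intro equalityI subsetI)
      fix x assume x: "x \<in> X \<inter> cball 0 \<epsilon> - {0}"
      define r where "r = norm x"
      define q where "q = x /\<^sub>R r"
      have r: "0 < r" "r \<le> \<epsilon>" using x by (auto simp: r_def)
      have q: "norm q = 1" "x = r *\<^sub>R q" using r by (auto simp: q_def r_def)
      then obtain p where p: "p \<in> P" "dist p q < d p" using P(3) by force
      obtain y where y: "\<bar>y\<bar> < \<delta> p" "q = dir (t p + y)" using local(11)[OF P1[OF p(1)] q(1) p(2)] by blast
      obtain f where f: "f \<in> set (fs p)" "y = f r" using onX[OF r p(1) y(1)] x q(2) y(2) by auto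
      then have eq: "x = (\<lambda>r. r *\<^sub>R \<gamma> (p, f) r) r" and mem: "(p, f) \<in> I"
        using q(2) y(2) r p(1) by (auto simp: \<gamma>_def I_def)
      have "r \<in> {0<..\<epsilon>}" using r by simp
      then show "x \<in> (\<Union>i\<in>I. (\<lambda>r. r *\<^sub>R \<gamma> i r) ` {0<..\<epsilon>})" using mem eq by blast
    next
      fix x assume "x \<in> (\<Union>i\<in>I. (\<lambda>r. r *\<^sub>R \<gamma> i r) ` {0<..\<epsilon>})"
      then obtain p f r where pf: "p \<in> P" "f \<in> set (fs p)" and r: "0 < r" "r \<le> \<epsilon>" and x: "x = r *\<^sub>R dir (t p + f r)"
        by (auto simp: I_def \<gamma>_def)
      have "r \<in> {0<..<\<eta> p}" using B[of r] r \<epsilon> pf by simp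
      then have "\<bar>f r\<bar> < \<delta> p" by (rule local(8)[OF P1[OF pf(1)] pf(2)])
      then have "x \<in> X" unfolding x using onX[OF r pf(1)] pf(2) by blast
      moreover have "norm x = r" using r by (simp add: x)
      ultimately show "x \<in> X \<inter> cball 0 \<epsilon> - {0}" using r by auto
    qed
  qed (use \<epsilon> finI in auto)
  then show ?thesis by blast
qed

section \<open>The blowing-up of a conic set\<close>

definition lift_arc :: "(real \<Rightarrow> 'a::euclidean_space) \<Rightarrow> real set \<Rightarrow> ('a \<times> real) set" where
  "lift_arc g T = (\<lambda>r. (g r, r)) ` T"

lemma conic_arcsD:
  assumes "conic_arcs X \<epsilon> I \<gamma>"
  shows "0 < \<epsilon>" "finite I" "\<And>i. i \<in> I \<Longrightarrow> continuous_on {0..\<epsilon>} (\<gamma> i)"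
    "\<And>i r. i \<in> I \<Longrightarrow> 0 \<le> r \<Longrightarrow> r \<le> \<epsilon> \<Longrightarrow> norm (\<gamma> i r) = 1"
    "\<And>i j r. i \<in> I \<Longrightarrow> j \<in> I \<Longrightarrow> 0 < r \<Longrightarrow> r \<le> \<epsilon> \<Longrightarrow> \<gamma> i r = \<gamma> j r \<Longrightarrow> i = j"
    "X \<inter> cball 0 \<epsilon> - {0} = (\<Union>i\<in>I. (\<lambda>r. r *\<^sub>R \<gamma> i r) ` {0<..\<epsilon>})"
proof -
  note X = assms[unfolded conic_arcs_def]
  show "0 < \<epsilon>" "finite I" "X \<inter> cball 0 \<epsilon> - {0} = (\<Union>i\<in>I. (\<lambda>r. r *\<^sub>R \<gamma> i r) ` {0<..\<epsilon>})"
    and "\<And>i. i \<in> I \<Longrightarrow> continuous_on {0..\<epsilon>} (\<gamma> i)"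
    using X by blast+
  show "\<gamma> i r = \<gamma> j r \<Longrightarrow> i = j" if "i \<in> I" "j \<in> I" "0 < r" "r \<le> \<epsilon>" for i j r
    using X that by force
  show "norm (\<gamma> i r) = 1" if "i \<in> I" "0 \<le> r" "r \<le> \<epsilon>" for i r
    using X that by (force simp: image_subset_iff)
qed

text \<open>The defining equation in terms of polar coordinates.\<close>

lemma conic_arcs_mem_iff:
  assumes X: "conic_arcs X \<epsilon> I \<gamma>" and q: "norm q = 1" and r: "0 < r" "r \<le> \<epsilon>"
  shows "r *\<^sub>R q \<in> X \<longleftrightarrow> (\<exists>i\<in>I. q = \<gamma> i r)"
proof
  note D = conic_arcsD[OF X]
  assume "r *\<^sub>R q \<in> X"
  then have "r *\<^sub>R q \<in> X \<inter> cball 0 \<epsilon> - {0}" using q r by auto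
  then obtain i r' where i: "i \<in> I" "0 < r'" "r' \<le> \<epsilon>" "r *\<^sub>R q = r' *\<^sub>R \<gamma> i r'"
    unfolding D(6) by auto
  have "norm (r *\<^sub>R q) = r" "norm (r' *\<^sub>R \<gamma> i r') = r'" using q r i(1-3) D(4)[of i r'] by auto
  then have "r = r'" using i(4) by simp
  then show "\<exists>i\<in>I. q = \<gamma> i r" using i r by (intro bexI[of _ i]) auto
next
  note D = conic_arcsD[OF X]
  assume "\<exists>i\<in>I. q = \<gamma> i r"
  then obtain i where i: "i \<in> I" "q = \<gamma> i r" by blast
  then have "r *\<^sub>R q \<in> (\<Union>i\<in>I. (\<lambda>r. r *\<^sub>R \<gamma> i r) ` {0<..\<epsilon>})"
    using r by (intro UN_I[of i] image_eqI[of _ _ r]) auto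
  then show "r *\<^sub>R q \<in> X" unfolding D(6)[symmetric] by blast
qed

lemma conic_arcsI:
  assumes "0 < \<epsilon>" "finite I" "\<And>i. i \<in> I \<Longrightarrow> continuous_on {0..\<epsilon>} (\<gamma> i)"
    "\<And>i r. i \<in> I \<Longrightarrow> 0 \<le> r \<Longrightarrow> r \<le> \<epsilon> \<Longrightarrow> norm (\<gamma> i r) = 1"
    "\<And>i j r. i \<in> I \<Longrightarrow> j \<in> I \<Longrightarrow> 0 < r \<Longrightarrow> r \<le> \<epsilon> \<Longrightarrow> \<gamma> i r = \<gamma> j r \<Longrightarrow> i = j"
    "\<And>q r. norm q = 1 \<Longrightarrow> 0 < r \<Longrightarrow> r \<le> \<epsilon> \<Longrightarrow> r *\<^sub>R q \<in> X \<longleftrightarrow> (\<exists>i\<in>I. q = \<gamma> i r)"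
  shows "conic_arcs X \<epsilon> I \<gamma>"
proof -
  have "X \<inter> cball 0 \<epsilon> - {0} = (\<Union>i\<in>I. (\<lambda>r. r *\<^sub>R \<gamma> i r) ` {0<..\<epsilon>})"
  proof (intro equalityI subsetI)
    fix x assume x: "x \<in> X \<inter> cball 0 \<epsilon> - {0}"
    define r where "r = norm x"
    define q where "q = x /\<^sub>R r"
    have r: "0 < r" "r \<le> \<epsilon>" using x by (auto simp: r_def)
    have q: "norm q = 1" "x = r *\<^sub>R q" using r by (auto simp: q_def r_def)
    then obtain i where "i \<in> I" "q = \<gamma> i r" using assms(6)[OF q(1) r] x by auto
    then show "x \<in> (\<Union>i\<in>I. (\<lambda>r. r *\<^sub>R \<gamma> i r) ` {0<..\<epsilon>})"
      using q(2) r by (intro UN_I[of i] image_eqI[of _ _ r]) auto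
  next
    fix x assume "x \<in> (\<Union>i\<in>I. (\<lambda>r. r *\<^sub>R \<gamma> i r) ` {0<..\<epsilon>})"
    then obtain i r where i: "i \<in> I" "0 < r" "r \<le> \<epsilon>" "x = r *\<^sub>R \<gamma> i r" by auto
    have n: "norm (\<gamma> i r) = 1" using assms(4)[OF i(1)] i by simp
    then have "x \<in> X" using assms(6)[OF n i(2,3)] i by blast
    moreover have "norm x = r" using n i by simp
    ultimately show "x \<in> X \<inter> cball 0 \<epsilon> - {0}" using i by auto
  qed
  then show ?thesis using assms(1-5) unfolding conic_arcs_def by (auto simp: image_subset_iff)
qed

lemma conic_arcs_mono:
  assumes X: "conic_arcs X \<epsilon> I \<gamma>" and "0 < \<delta>" "\<delta> \<le> \<epsilon>"
  shows "conic_arcs X \<delta> I \<gamma>"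
proof (rule conic_arcsI)
  note D = conic_arcsD[OF X]
  show "continuous_on {0..\<delta>} (\<gamma> i)" if "i \<in> I" for i
    using assms by (intro continuous_on_subset[OF D(3)[OF that]]) auto
  show "r *\<^sub>R q \<in> X \<longleftrightarrow> (\<exists>i\<in>I. q = \<gamma> i r)" if "norm q = 1" "0 < r" "r \<le> \<delta>" for q r
    using that assms by (intro conic_arcs_mem_iff[OF X]) auto
qed (use conic_arcsD[OF X] assms in auto)

lemma conic_arcs_cong:
  assumes X: "conic_arcs X \<epsilon> I \<gamma>" and eq: "X \<inter> cball 0 \<epsilon> = Y \<inter> cball 0 \<epsilon>"
  shows "conic_arcs Y \<epsilon> I \<gamma>"
  using X eq unfolding conic_arcs_def by simp

text \<open>The conic structure depends on the germ at the origin only.\<close>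

lemma conic_arcs_restrict:
  assumes X: "conic_arcs X \<epsilon> I \<gamma>" and A: "0 \<in> interior A"
  obtains \<delta> where "0 < \<delta>" "\<delta> \<le> \<epsilon>" "conic_arcs X \<delta> I \<gamma>" "conic_arcs (X \<inter> A) \<delta> I \<gamma>"
proof -
  obtain e where e: "0 < e" "ball 0 e \<subseteq> A" using A by (auto simp: mem_interior)
  define \<delta> where "\<delta> = min \<epsilon> (e / 2)"
  have \<delta>: "0 < \<delta>" "\<delta> \<le> \<epsilon>" "\<delta> < e" using e conic_arcsD(1)[OF X] by (auto simp: \<delta>_def)
  have c: "conic_arcs X \<delta> I \<gamma>" using conic_arcs_mono[OF X \<delta>(1,2)] .
  have "cball 0 \<delta> \<subseteq> A" using \<delta>(3) e(2) by (auto simp: subset_iff)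
  then have "conic_arcs (X \<inter> A) \<delta> I \<gamma>" by (intro conic_arcs_cong[OF c]) blast
  then show thesis using that \<delta> c by blast
qed

lemma compact_lift_arc:
  assumes "continuous_on T g" "compact T"
  shows "compact (lift_arc g T)"
  unfolding lift_arc_def using assms by (intro compact_continuous_image continuous_intros)

lemma connected_lift_arc:
  assumes "continuous_on T g" "connected T"
  shows "connected (lift_arc g T)"
  unfolding lift_arc_def using assms by (intro connected_continuous_image continuous_intros)

lemma pair_set_eqI: "(\<And>q r. (q, r) \<in> A \<longleftrightarrow> (q, r) \<in> B) \<Longrightarrow> A = B"
  by auto

lemma mem_lift_arc [simp]: "(q, r) \<in> lift_arc g T \<longleftrightarrow> r \<in> T \<and> q = g r"
  by (auto simp: lift_arc_def)

lemma blow_preimage_conic: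
  assumes X: "conic_arcs X \<epsilon> I \<gamma>" and "r \<le> \<epsilon>"
  shows "(q, r) \<in> blow_preimage X \<longleftrightarrow> 0 < r \<and> (\<exists>i\<in>I. q = \<gamma> i r)"
proof
  assume L: "(q, r) \<in> blow_preimage X"
  then have "norm q = 1" "0 \<le> r" "r *\<^sub>R q \<noteq> 0" "r *\<^sub>R q \<in> X"
    by (auto simp: blow_preimage_def blow_def)
  moreover from this have "0 < r" by (cases "r = 0") auto
  ultimately show "0 < r \<and> (\<exists>i\<in>I. q = \<gamma> i r)" using conic_arcs_mem_iff[OF X] assms(2) by blast
next
  assume R: "0 < r \<and> (\<exists>i\<in>I. q = \<gamma> i r)"
  then have n: "norm q = 1" using conic_arcsD(4)[OF X] assms(2) by auto
  then have "r *\<^sub>R q \<in> X" using conic_arcs_mem_iff[OF X n] R assms(2) by blast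
  moreover have "q \<noteq> 0" using n by auto
  ultimately show "(q, r) \<in> blow_preimage X" using R n by (auto simp: blow_preimage_def blow_def)
qed

text \<open>The closure adds to each arc its end point over the origin: the finite union of the compact lifted
  arcs is closed.\<close>

lemma strict_transform_conic:
  assumes X: "conic_arcs X \<epsilon> I \<gamma>" and "r < \<epsilon>"
  shows "(q, r) \<in> strict_transform X \<longleftrightarrow> 0 \<le> r \<and> (\<exists>i\<in>I. q = \<gamma> i r)"
proof
  note D = conic_arcsD[OF X]
  define K where "K = (\<Union>i\<in>I. lift_arc (\<gamma> i) {0..\<epsilon>})"
  have K: "closed K" unfolding K_def using D
    by (intro closed_UN ballI compact_imp_closed compact_lift_arc) auto
  let ?S = "(UNIV :: 'a set) \<times> {..<\<epsilon>}"
  have "?S \<inter> blow_preimage X \<subseteq> K"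
    using blow_preimage_conic[OF X] by (fastforce simp: K_def)
  then have "closure (?S \<inter> blow_preimage X) \<subseteq> K" using K by (rule closure_minimal)
  moreover have "?S \<inter> closure (blow_preimage X) \<subseteq> closure (?S \<inter> blow_preimage X)"
    by (intro open_Int_closure_subset open_Times) auto
  moreover assume "(q, r) \<in> strict_transform X"
  ultimately have "(q, r) \<in> K" using assms(2) unfolding strict_transform_def by blast
  then show "0 \<le> r \<and> (\<exists>i\<in>I. q = \<gamma> i r)" by (auto simp: K_def)
next
  note D = conic_arcsD[OF X]
  assume "0 \<le> r \<and> (\<exists>i\<in>I. q = \<gamma> i r)"
  then obtain i where i: "i \<in> I" "q = \<gamma> i r" "0 \<le> r" by blast
  have "(\<lambda>r. (\<gamma> i r, r)) ` closure {0<..\<epsilon>} \<subseteq> closure (blow_preimage X)"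
  proof (rule image_closure_subset)
    show "continuous_on (closure {0<..\<epsilon>}) (\<lambda>r. (\<gamma> i r, r))"
      using D(1,3) i by (auto intro!: continuous_intros)
    show "(\<lambda>r. (\<gamma> i r, r)) ` {0<..\<epsilon>} \<subseteq> closure (blow_preimage X)"
      using blow_preimage_conic[OF X] i closure_subset by fastforce
  qed auto
  then show "(q, r) \<in> strict_transform X"
    using i assms D(1) unfolding strict_transform_def by auto
qed

lemma strict_boundary_conic:
  assumes X: "conic_arcs X \<epsilon> I \<gamma>"
  shows "(q, r) \<in> strict_boundary X \<longleftrightarrow> r = 0 \<and> (\<exists>i\<in>I. q = \<gamma> i 0)"
  using strict_transform_conic[OF X, of 0 q] conic_arcsD(1,4)[OF X] by (auto simp: strict_boundary_def)

text \<open>For small radii exactly the arcs with direction \<open>v\<close> at the origin run through a small ball around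
  \<open>v\<close>. The same radius works for all arcs as there are finitely many.\<close>

lemma separate_directions:
  assumes X: "conic_arcs X \<epsilon> I \<gamma>"
  obtains d s where "0 < d" "0 < s" "s < \<epsilon>"
    "\<And>i r. i \<in> I \<Longrightarrow> 0 \<le> r \<Longrightarrow> r < s \<Longrightarrow> \<gamma> i r \<in> ball v d \<longleftrightarrow> \<gamma> i 0 = v"
proof -
  note D = conic_arcsD[OF X]
  obtain d where d: "0 < d" "\<And>i. i \<in> I \<Longrightarrow> \<gamma> i 0 \<noteq> v \<Longrightarrow> d \<le> dist v (\<gamma> i 0)"
    using finite_set_avoid[of "(\<lambda>i. \<gamma> i 0) ` I" v] D(2) by auto
  have "\<forall>i\<in>I. eventually (\<lambda>r. dist (\<gamma> i r) (\<gamma> i 0) < d / 2) (at_right 0)"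
  proof
    fix i assume "i \<in> I"
    then have "(\<gamma> i \<longlongrightarrow> \<gamma> i 0) (at 0 within {0..\<epsilon>})"
      using D(1,3) by (auto simp: continuous_on_def)
    then have "(\<gamma> i \<longlongrightarrow> \<gamma> i 0) (at_right 0)"
      using at_within_Icc_at_right[OF D(1)] by simp
    then show "eventually (\<lambda>r. dist (\<gamma> i r) (\<gamma> i 0) < d / 2) (at_right 0)"
      using d(1) by (intro tendstoD) auto
  qed
  then have "eventually (\<lambda>r. \<forall>i\<in>I. dist (\<gamma> i r) (\<gamma> i 0) < d / 2) (at_right 0)"
    using D(2) by (intro eventually_ball_finite) auto
  then obtain b where b: "0 < b" "\<And>r i. 0 < r \<Longrightarrow> r < b \<Longrightarrow> i \<in> I \<Longrightarrow> dist (\<gamma> i r) (\<gamma> i 0) < d / 2"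
    unfolding eventually_at_right_field by auto
  define s where "s = min b \<epsilon> / 2"
  have s: "0 < s" "s < \<epsilon>" "s < b" using b D(1) by (auto simp: s_def)
  show thesis
  proof (rule that[of "d / 2" s])
    fix i r assume i: "i \<in> I" and r: "0 \<le> r" "r < s"
    have near: "dist (\<gamma> i r) (\<gamma> i 0) < d / 2" using b(2)[of r i] i r s d(1) by (cases "r = 0") auto
    show "\<gamma> i r \<in> ball v (d / 2) \<longleftrightarrow> \<gamma> i 0 = v"
    proof
      assume "\<gamma> i r \<in> ball v (d / 2)"
      then have "dist v (\<gamma> i 0) < d"
        using near dist_triangle_less_add[of v "\<gamma> i r" "d / 2" "\<gamma> i 0" "d / 2"] by (simp add: dist_commute)
      then show "\<gamma> i 0 = v" using d(2)[OF i] by force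
    next
      assume "\<gamma> i 0 = v"
      then show "\<gamma> i r \<in> ball v (d / 2)" using near by (simp add: dist_commute)
    qed
  qed (use d s in auto)
qed

section \<open>Components of germs\<close>

text \<open>Finitely many disjoint relatively closed pieces are also relatively open, so a connected set lies
  in one of them. The pieces are closed relative to \<open>S\<close> as traces of the closed sets \<open>K i\<close>.\<close>

lemma connected_subset_of_piece:
  assumes "finite I" "S = (\<Union>i\<in>I. B i)" and K: "\<And>i. i \<in> I \<Longrightarrow> closed (K i) \<and> B i = S \<inter> K i"
    and disj: "\<And>i j. i \<in> I \<Longrightarrow> j \<in> I \<Longrightarrow> i \<noteq> j \<Longrightarrow> B i \<inter> B j = {}"
    and C: "connected C" "C \<subseteq> S" "C \<noteq> {}"
  shows "\<exists>i\<in>I. C \<subseteq> B i"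
proof -
  obtain y i where y: "y \<in> C" "i \<in> I" "y \<in> B i" using C assms(2) by blast
  let ?L = "\<Union>j\<in>I - {i}. K j"
  have "K i \<inter> C = {} \<or> ?L \<inter> C = {}"
  proof (rule connected_closedD[OF C(1)])
    show "K i \<inter> ?L \<inter> C = {}"
    proof (rule ccontr)
      assume "K i \<inter> ?L \<inter> C \<noteq> {}"
      then obtain z j where z: "z \<in> K i" "z \<in> K j" "z \<in> C" "j \<in> I" "j \<noteq> i" by blast
      then have "z \<in> B i" "z \<in> B j" using K C(2) y(2) by blast+
      then show False using disj[of i j] z y by blast
    qed
    show "C \<subseteq> K i \<union> ?L"
    proof
      fix z assume "z \<in> C"
      then obtain j where "j \<in> I" "z \<in> B j" using C(2) assms(2) by blast
      then show "z \<in> K i \<union> ?L" using K by blast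
    qed
    show "closed (K i)" using K y(2) by blast
    show "closed ?L" using K assms(1) by (intro closed_UN) auto
  qed
  moreover have "y \<in> K i \<inter> C" using y K by blast
  ultimately have "?L \<inter> C = {}" by blast
  have "C \<subseteq> B i"
  proof
    fix z assume z: "z \<in> C"
    then obtain j where j: "j \<in> I" "z \<in> B j" using C(2) assms(2) by blast
    then have "z \<in> K j" using K by blast
    then have "j = i" using \<open>?L \<inter> C = {}\<close> z j by blast
    then show "z \<in> B i" using j by simp
  qed
  then show ?thesis using y by blast
qed

lemma germ_eqI:
  assumes "open V" "x \<in> V" "A \<inter> V = B \<inter> V"
  shows "germ A x = germ B x"
proof -
  have sub: "germ A x \<subseteq> germ B x" if AB: "A \<inter> V = B \<inter> V" for A B
  proof
    fix C assume "C \<in> germ A x"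
    then obtain U where U: "open U" "x \<in> U" "A \<inter> U = C \<inter> U" unfolding germ_def by blast
    have "B \<inter> (U \<inter> V) = C \<inter> (U \<inter> V)" using U(3) AB by blast
    then show "C \<in> germ B x" unfolding germ_def using U assms by (intro CollectI exI[of _ "U \<inter> V"]) auto
  qed
  show ?thesis using sub[OF assms(3)] sub[OF assms(3)[symmetric]] by blast
qed

lemma germ_self: "A \<in> germ A x"
  unfolding germ_def by (intro CollectI exI[of _ UNIV]) auto

lemma germ_eqD: "germ A x = germ B x \<Longrightarrow> \<exists>U. open U \<and> x \<in> U \<and> A \<inter> U = B \<inter> U"
  using germ_self[of B x] unfolding germ_def by blast

text \<open>If small neighbourhoods cut each piece in a connected set, then the component of any small
  neighbourhood that is adherent to \<open>x\<close> and meets the piece \<open>B i\<close> has the same germ as \<open>B i\<close>.\<close>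

lemma germ_components_finite:
  assumes U0: "open U0" "x \<in> U0" and "finite I" and S: "A \<inter> U0 = (\<Union>i\<in>I. B i)"
    and K: "\<And>i. i \<in> I \<Longrightarrow> closed (K i) \<and> B i = A \<inter> U0 \<inter> K i"
    and disj: "\<And>i j. i \<in> I \<Longrightarrow> j \<in> I \<Longrightarrow> i \<noteq> j \<Longrightarrow> B i \<inter> B j = {}"
    and x: "\<And>i. i \<in> I \<Longrightarrow> x \<in> closure (B i)"
    and conn: "\<And>i U. i \<in> I \<Longrightarrow> open U \<Longrightarrow> x \<in> U \<Longrightarrow> \<exists>V. open V \<and> x \<in> V \<and> V \<subseteq> U \<and> connected (B i \<inter> V)"
  shows "germ_components A x = (\<lambda>i. germ (B i) x) ` I \<and> inj_on (\<lambda>i. germ (B i) x) I"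
proof -
  have meets: "B i \<inter> V \<noteq> {}" if "i \<in> I" "open V" "x \<in> V" for i V
    using x[OF that(1)] that(2,3) open_Int_closure_eq_empty[of V "B i"] by blast
  have piece: "\<exists>i\<in>I. C \<subseteq> B i" if "connected C" "C \<subseteq> A \<inter> U0" "C \<noteq> {}" for C
    by (rule connected_subset_of_piece[OF \<open>finite I\<close> S K disj that])
  have germ_C: "germ C x = germ (B i) x"
    if i: "i \<in> I" and U: "open U" "x \<in> U" "U \<subseteq> U0" and C: "C \<in> components (A \<inter> U)" "C \<subseteq> B i" "x \<in> closure C" for i U C
  proof -
    obtain V where V: "open V" "x \<in> V" "V \<subseteq> U" "connected (B i \<inter> V)" using conn[OF i U(1,2)] by blast
    have "C \<inter> V \<noteq> {}" using C(3) V open_Int_closure_eq_empty[of V C] by blast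
    then have "B i \<inter> V \<subseteq> C"
      using C V K[OF i] by (intro components_maximal[OF C(1) V(4)]) auto
    then have "C \<inter> V = B i \<inter> V" using C(2) by blast
    then show ?thesis using V by (intro germ_eqI) auto
  qed
  have "germ_components A x = (\<lambda>i. germ (B i) x) ` I"
  proof (intro equalityI subsetI)
    fix c assume "c \<in> germ_components A x"
    then obtain U1 where U1: "open U1" "x \<in> U1"
      "\<forall>U. open U \<and> x \<in> U \<and> U \<subseteq> U1 \<longrightarrow> (\<exists>C \<in> components (A \<inter> U). x \<in> closure C \<and> c = germ C x)"
      unfolding germ_components_def by blast
    then obtain C where C: "C \<in> components (A \<inter> (U0 \<inter> U1))" "x \<in> closure C" "c = germ C x"
      using U0 by (metis Int_lower2 IntI open_Int)
    have "\<exists>i\<in>I. C \<subseteq> B i"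
      using in_components_connected[OF C(1)] in_components_subset[OF C(1)] in_components_nonempty[OF C(1)]
      by (intro piece) auto
    then obtain i where "i \<in> I" "C \<subseteq> B i" by blast
    then show "c \<in> (\<lambda>i. germ (B i) x) ` I"
      using germ_C[of i "U0 \<inter> U1" C] C U0 U1(1,2) by auto
  next
    fix c assume "c \<in> (\<lambda>i. germ (B i) x) ` I"
    then obtain i where i: "i \<in> I" "c = germ (B i) x" by blast
    have "\<exists>C \<in> components (A \<inter> U). x \<in> closure C \<and> c = germ C x" if U: "open U" "x \<in> U" "U \<subseteq> U0" for U
    proof -
      obtain V where V: "open V" "x \<in> V" "V \<subseteq> U" "connected (B i \<inter> V)" using conn[OF i(1) U(1,2)] by blast
      have ne: "B i \<inter> V \<noteq> {}" using meets[OF i(1) V(1,2)] .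
      have "B i \<inter> V \<subseteq> A \<inter> U" using K[OF i(1)] V by blast
      then obtain C where C: "C \<in> components (A \<inter> U)" "B i \<inter> V \<subseteq> C"
        using exists_component_superset[of "B i \<inter> V" "A \<inter> U"] V(4) ne by blast
      have "x \<in> closure (B i \<inter> V)"
      proof -
        have "V \<inter> closure (B i) \<subseteq> closure (V \<inter> B i)" by (rule open_Int_closure_subset[OF V(1)])
        then show ?thesis using V(2) x[OF i(1)] by (auto simp: Int_commute)
      qed
      then have xC: "x \<in> closure C" using C(2) closure_mono by blast
      obtain j where j: "j \<in> I" "C \<subseteq> B j"
        using piece[of C] in_components_connected[OF C(1)] in_components_subset[OF C(1)] in_components_nonempty[OF C(1)] U(3) by blast
      have "j = i" using j C(2) ne disj[OF j(1) i(1)] by blast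
      then show ?thesis using germ_C[OF i(1) U C(1) _ xC] j C(1) xC i(2) by auto
    qed
    then show "c \<in> germ_components A x" unfolding germ_components_def using U0 by blast
  qed
  moreover have "inj_on (\<lambda>i. germ (B i) x) I"
  proof (rule inj_onI)
    fix i j assume ij: "i \<in> I" "j \<in> I" "germ (B i) x = germ (B j) x"
    obtain U where "open U" "x \<in> U" "B i \<inter> U = B j \<inter> U" using germ_eqD[OF ij(3)] by blast
    then show "i = j" using meets[OF ij(1)] disj[OF ij(1,2)] by blast
  qed
  ultimately show ?thesis ..
qed

text \<open>The components of the germ at a boundary point are the germs of the lifted arcs ending there.\<close>

lemma rel_mult_conic:
  assumes X: "conic_arcs X \<epsilon> I \<gamma>"
  shows "rel_mult X (v, 0) = card {i\<in>I. \<gamma> i 0 = v}"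
proof -
  note D = conic_arcsD[OF X]
  obtain d s where ds: "0 < d" "0 < s" "s < \<epsilon>"
    and near: "\<And>i r. i \<in> I \<Longrightarrow> 0 \<le> r \<Longrightarrow> r < s \<Longrightarrow> \<gamma> i r \<in> ball v d \<longleftrightarrow> \<gamma> i 0 = v"
    by (rule separate_directions[OF X]) (rule that)
  define J where "J = {i\<in>I. \<gamma> i 0 = v}"
  define U0 where "U0 = ball v d \<times> {-s<..<s}"
  define B where "B = (\<lambda>i. lift_arc (\<gamma> i) {0<..<s})"
  define K where "K = (\<lambda>i. lift_arc (\<gamma> i) {0..\<epsilon>})"
  have mem: "(q, r) \<in> blow_preimage X \<inter> U0 \<longleftrightarrow> 0 < r \<and> r < s \<and> (\<exists>i\<in>J. q = \<gamma> i r)" for q r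
  proof
    assume L: "(q, r) \<in> blow_preimage X \<inter> U0"
    then have r: "r < s" "q \<in> ball v d" by (auto simp: U0_def)
    then obtain i where i: "i \<in> I" "0 < r" "q = \<gamma> i r" using blow_preimage_conic[OF X, of r q] L ds by auto
    then show "0 < r \<and> r < s \<and> (\<exists>i\<in>J. q = \<gamma> i r)" using near[of i r] r by (auto simp: J_def)
  next
    assume R: "0 < r \<and> r < s \<and> (\<exists>i\<in>J. q = \<gamma> i r)"
    then obtain i where i: "i \<in> I" "\<gamma> i 0 = v" "q = \<gamma> i r" by (auto simp: J_def)
    then have "q \<in> ball v d" using near[of i r] R by auto
    then show "(q, r) \<in> blow_preimage X \<inter> U0"
      using blow_preimage_conic[OF X, of r q] R ds i by (auto simp: U0_def)
  qed
  have "germ_components (blow_preimage X) (v, 0) = (\<lambda>i. germ (B i) (v, 0)) ` J \<and> inj_on (\<lambda>i. germ (B i) (v, 0)) J"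
  proof (rule germ_components_finite[where K = K and ?U0.0 = U0])
    show "open U0" unfolding U0_def by (intro open_Times) auto
    show "(v, 0) \<in> U0" using ds by (auto simp: U0_def)
    show "finite J" using D(2) by (simp add: J_def)
    show "blow_preimage X \<inter> U0 = (\<Union>i\<in>J. B i)"
    proof (rule pair_set_eqI)
      show "(q, r) \<in> blow_preimage X \<inter> U0 \<longleftrightarrow> (q, r) \<in> (\<Union>i\<in>J. B i)" for q r
        unfolding mem by (auto simp: B_def)
    qed
    show "closed (K i) \<and> B i = blow_preimage X \<inter> U0 \<inter> K i" if i: "i \<in> J" for i
    proof
      show "closed (K i)" unfolding K_def using D(3) i by (intro compact_imp_closed compact_lift_arc) (auto simp: J_def)
      have "(q, r) \<in> B i \<longleftrightarrow> (q, r) \<in> blow_preimage X \<inter> U0 \<inter> K i" for q r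
        unfolding Int_iff[of "(q, r)" "blow_preimage X \<inter> U0"] mem
        using i ds by (auto simp: B_def K_def)
      then show "B i = blow_preimage X \<inter> U0 \<inter> K i" by (rule pair_set_eqI)
    qed
    show "B i \<inter> B j = {}" if "i \<in> J" "j \<in> J" "i \<noteq> j" for i j
      using D(5)[of i j] that ds by (fastforce simp: B_def J_def)
    have cl: "(\<lambda>r. (\<gamma> i r, r)) ` {0..<s} \<subseteq> closure (lift_arc (\<gamma> i) {0<..<s})" if i: "i \<in> J" for i
    proof -
      have "(\<lambda>r. (\<gamma> i r, r)) ` closure {0<..<s} \<subseteq> closure (lift_arc (\<gamma> i) {0<..<s})"
      proof (rule image_closure_subset)
        show "continuous_on (closure {0<..<s}) (\<lambda>r. (\<gamma> i r, r))"
        proof (rule continuous_on_subset)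
          show "continuous_on {0..\<epsilon>} (\<lambda>r. (\<gamma> i r, r))"
            using D(3) i by (auto simp: J_def intro!: continuous_intros)
        qed (use ds in auto)
        show "(\<lambda>r. (\<gamma> i r, r)) ` {0<..<s} \<subseteq> closure (lift_arc (\<gamma> i) {0<..<s})"
          unfolding lift_arc_def by (rule closure_subset)
      qed auto
      then show ?thesis using ds by (auto simp: image_subset_iff)
    qed
    show "(v, 0) \<in> closure (B i)" if i: "i \<in> J" for i
      using cl[OF i] i ds by (auto simp: B_def J_def)
    show "\<exists>V. open V \<and> (v, 0) \<in> V \<and> V \<subseteq> U \<and> connected (B i \<inter> V)"
      if i: "i \<in> J" and U: "open U" "(v, 0) \<in> U" for i U
    proof -
      have c: "continuous_on {0..\<epsilon>} (\<lambda>r. (\<gamma> i r, r))" using D(3) i by (auto simp: J_def intro!: continuous_intros)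
      have "((\<lambda>r. (\<gamma> i r, r)) \<longlongrightarrow> (\<gamma> i 0, 0)) (at 0 within {0..\<epsilon>})"
        using c D(1) by (auto simp: continuous_on_def)
      then have "((\<lambda>r. (\<gamma> i r, r)) \<longlongrightarrow> (v, 0)) (at_right 0)"
        using at_within_Icc_at_right[OF D(1)] i by (simp add: J_def)
      then have "eventually (\<lambda>r. (\<gamma> i r, r) \<in> U) (at_right 0)" using U by (rule topological_tendstoD)
      then obtain b where b: "0 < b" "\<And>r. 0 < r \<Longrightarrow> r < b \<Longrightarrow> (\<gamma> i r, r) \<in> U"
        unfolding eventually_at_right_field by auto
      define V where "V = U \<inter> (UNIV \<times> {..<b})"
      have "B i \<inter> V = lift_arc (\<gamma> i) {0<..<min s b}"
        using b by (auto simp: B_def V_def lift_arc_def)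
      moreover have "connected (lift_arc (\<gamma> i) {0<..<min s b})"
      proof (rule connected_lift_arc)
        show "continuous_on {0<..<min s b} (\<gamma> i)"
          using i ds by (intro continuous_on_subset[OF D(3)]) (auto simp: J_def)
      qed auto
      moreover have "open V" unfolding V_def using U by (intro open_Int open_Times) auto
      ultimately show ?thesis using U b by (intro exI[of _ V]) (auto simp: V_def)
    qed
  qed
  then show ?thesis unfolding rel_mult_def J_def by (simp add: card_image)
qed

definition branch :: "(real \<Rightarrow> 'a::euclidean_space) \<Rightarrow> real \<Rightarrow> 'a set" where
  "branch g s = (\<lambda>r. r *\<^sub>R g r) ` {0<..<s}"

text \<open>The half-branches are the germs of the arcs, each of which is connected in every small ball.\<close>

lemma half_branches_conic:
  assumes X: "conic_arcs X \<epsilon> I \<gamma>"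
  shows "half_branches X = (\<lambda>i. germ (branch (\<gamma> i) \<epsilon>) 0) ` I" "inj_on (\<lambda>i. germ (branch (\<gamma> i) \<epsilon>) 0) I"
proof -
  note D = conic_arcsD[OF X]
  define K where "K = (\<lambda>i. (\<lambda>r. r *\<^sub>R \<gamma> i r) ` {0..\<epsilon>})"
  have norm: "norm (r *\<^sub>R \<gamma> i r) = r" if "i \<in> I" "0 \<le> r" "r \<le> \<epsilon>" for i r using D(4) that by simp
  have same: "i = j \<and> r = r'" if "i \<in> I" "j \<in> I" "0 < r" "r \<le> \<epsilon>" "0 \<le> r'" "r' \<le> \<epsilon>" "r *\<^sub>R \<gamma> i r = r' *\<^sub>R \<gamma> j r'" for i j r r'
  proof -
    have "r = r'" using norm[of i r] norm[of j r'] that by simp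
    then show ?thesis using D(5)[of i j r] that by simp
  qed
  have mem: "(X - {0}) \<inter> ball 0 \<epsilon> = (\<Union>i\<in>I. branch (\<gamma> i) \<epsilon>)"
  proof -
    have "(X - {0}) \<inter> ball 0 \<epsilon> = (X \<inter> cball 0 \<epsilon> - {0}) \<inter> ball 0 \<epsilon>" by auto
    also have "\<dots> = (\<Union>i\<in>I. (\<lambda>r. r *\<^sub>R \<gamma> i r) ` {0<..\<epsilon>}) \<inter> ball 0 \<epsilon>" unfolding D(6) ..
    also have "\<dots> = (\<Union>i\<in>I. branch (\<gamma> i) \<epsilon>)"
    proof (intro equalityI subsetI)
      fix x assume "x \<in> (\<Union>i\<in>I. (\<lambda>r. r *\<^sub>R \<gamma> i r) ` {0<..\<epsilon>}) \<inter> ball 0 \<epsilon>"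
      then obtain i r where i: "i \<in> I" "0 < r" "r \<le> \<epsilon>" "x = r *\<^sub>R \<gamma> i r" "norm x < \<epsilon>" by auto
      then have "r < \<epsilon>" using norm[of i r] by simp
      then show "x \<in> (\<Union>i\<in>I. branch (\<gamma> i) \<epsilon>)"
        using i unfolding branch_def by (intro UN_I[of i] image_eqI[of _ _ r]) auto
    next
      fix x assume "x \<in> (\<Union>i\<in>I. branch (\<gamma> i) \<epsilon>)"
      then obtain i r where i: "i \<in> I" "0 < r" "r < \<epsilon>" "x = r *\<^sub>R \<gamma> i r" by (auto simp: branch_def)
      then have "norm x < \<epsilon>" using norm[of i r] by simp
      then show "x \<in> (\<Union>i\<in>I. (\<lambda>r. r *\<^sub>R \<gamma> i r) ` {0<..\<epsilon>}) \<inter> ball 0 \<epsilon>"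
        using i by (intro IntI UN_I[of i] image_eqI[of _ _ r]) auto
    qed
    finally show ?thesis .
  qed
  have cont: "continuous_on {0..\<epsilon>} (\<lambda>r. r *\<^sub>R \<gamma> i r)" if "i \<in> I" for i
    using D(3) that by (intro continuous_intros) auto
  have "germ_components (X - {0}) 0 = (\<lambda>i. germ (branch (\<gamma> i) \<epsilon>) 0) ` I \<and> inj_on (\<lambda>i. germ (branch (\<gamma> i) \<epsilon>) 0) I"
  proof (rule germ_components_finite[where K = K and ?U0.0 = "ball 0 \<epsilon>"])
    show "open (ball (0::'a) \<epsilon>)" "(0::'a) \<in> ball 0 \<epsilon>" "finite I" using D by auto
    show "(X - {0}) \<inter> ball 0 \<epsilon> = (\<Union>i\<in>I. branch (\<gamma> i) \<epsilon>)" by (rule mem)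
    show "branch (\<gamma> i) \<epsilon> \<inter> branch (\<gamma> j) \<epsilon> = {}" if "i \<in> I" "j \<in> I" "i \<noteq> j" for i j
      using same that by (force simp: branch_def)
    show "closed (K i) \<and> branch (\<gamma> i) \<epsilon> = (X - {0}) \<inter> ball 0 \<epsilon> \<inter> K i" if i: "i \<in> I" for i
    proof
      show "closed (K i)" unfolding K_def using cont[OF i] by (intro compact_imp_closed compact_continuous_image) auto
      have "branch (\<gamma> i) \<epsilon> \<subseteq> K i" by (auto simp: branch_def K_def)
      moreover have "x \<in> branch (\<gamma> i) \<epsilon>" if x: "x \<in> branch (\<gamma> j) \<epsilon>" "j \<in> I" "x \<in> K i" for x j
      proof -
        obtain r where r: "0 < r" "r < \<epsilon>" "x = r *\<^sub>R \<gamma> j r" using x(1) by (auto simp: branch_def)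
        obtain r' where "0 \<le> r'" "r' \<le> \<epsilon>" "x = r' *\<^sub>R \<gamma> i r'" using x(3) by (auto simp: K_def)
        then have "j = i" using same[of j i r r'] r x(2) i by simp
        then show ?thesis using x(1) by simp
      qed
      ultimately show "branch (\<gamma> i) \<epsilon> = (X - {0}) \<inter> ball 0 \<epsilon> \<inter> K i" unfolding mem using i by blast
    qed
    show "0 \<in> closure (branch (\<gamma> i) \<epsilon>)" if i: "i \<in> I" for i
    proof -
      have "(\<lambda>r. r *\<^sub>R \<gamma> i r) ` closure {0<..<\<epsilon>} \<subseteq> closure (branch (\<gamma> i) \<epsilon>)"
        unfolding branch_def using cont[OF i] D(1)
        by (intro image_closure_subset closure_subset) auto
      then show ?thesis using D(1) by (force simp: image_subset_iff)
    qed
    show "\<exists>V. open V \<and> 0 \<in> V \<and> V \<subseteq> U \<and> connected (branch (\<gamma> i) \<epsilon> \<inter> V)"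
      if i: "i \<in> I" and U: "open U" "0 \<in> U" for i U
    proof -
      obtain b where b: "0 < b" "ball 0 b \<subseteq> U" using U open_contains_ball by blast
      have "branch (\<gamma> i) \<epsilon> \<inter> ball 0 b = (\<lambda>r. r *\<^sub>R \<gamma> i r) ` {0<..<min \<epsilon> b}"
      proof (intro equalityI subsetI)
        fix x assume "x \<in> branch (\<gamma> i) \<epsilon> \<inter> ball 0 b"
        then obtain r where r: "0 < r" "r < \<epsilon>" "x = r *\<^sub>R \<gamma> i r" "norm x < b" by (auto simp: branch_def)
        then have "r < b" using norm[OF i, of r] by simp
        then show "x \<in> (\<lambda>r. r *\<^sub>R \<gamma> i r) ` {0<..<min \<epsilon> b}" using r by auto
      next
        fix x assume "x \<in> (\<lambda>r. r *\<^sub>R \<gamma> i r) ` {0<..<min \<epsilon> b}"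
        then obtain r where r: "0 < r" "r < \<epsilon>" "r < b" "x = r *\<^sub>R \<gamma> i r" by auto
        then have "norm x < b" using norm[OF i, of r] by simp
        then show "x \<in> branch (\<gamma> i) \<epsilon> \<inter> ball 0 b" using r by (auto simp: branch_def)
      qed
      moreover have "connected ((\<lambda>r. r *\<^sub>R \<gamma> i r) ` {0<..<min \<epsilon> b})"
        by (intro connected_continuous_image continuous_on_subset[OF cont[OF i]]) auto
      ultimately show ?thesis using b by (intro exI[of _ "ball 0 b"]) auto
    qed
  qed
  then show "half_branches X = (\<lambda>i. germ (branch (\<gamma> i) \<epsilon>) 0) ` I" "inj_on (\<lambda>i. germ (branch (\<gamma> i) \<epsilon>) 0) I"
    unfolding half_branches_def by auto
qed

text \<open>If \<open>x k / t k\<close> converges to \<open>v \<noteq> 0\<close>, then the directions of the \<open>x k\<close> converge to that of \<open>v\<close>, and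
  the limit lies over the origin in the compact union of lifted arcs. For the converse the
  sequence runs along one arc.\<close>

lemma tangent_cone_conic:
  assumes X: "conic_arcs X \<epsilon> I \<gamma>"
  shows "tangent_cone X = {c *\<^sub>R \<gamma> i 0 | c i. 0 \<le> c \<and> i \<in> I}"
proof (intro equalityI subsetI)
  note D = conic_arcsD[OF X]
  fix v assume "v \<in> tangent_cone X"
  then obtain x t where xt: "\<And>k. x k \<in> X - {0}" "\<And>k::nat. 0 < t k" and lim: "x \<longlonglongrightarrow> 0" "(\<lambda>k. x k /\<^sub>R t k) \<longlonglongrightarrow> v"
    unfolding tangent_cone_def by blast
  define K where "K = (\<Union>i\<in>I. lift_arc (\<gamma> i) {0..\<epsilon>})"
  have K: "closed K" unfolding K_def using D by (intro closed_UN ballI compact_imp_closed compact_lift_arc) auto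
  have ev: "eventually (\<lambda>k. norm (x k) < \<epsilon>) sequentially"
    using tendstoD[OF lim(1) D(1)] by simp
  have inK: "(x k /\<^sub>R norm (x k), norm (x k)) \<in> K" if k: "norm (x k) < \<epsilon>" for k
  proof -
    have pos: "0 < norm (x k)" using xt(1)[of k] by auto
    have "norm (x k) *\<^sub>R (x k /\<^sub>R norm (x k)) \<in> X" using pos xt(1)[of k] by simp
    then have "\<exists>i\<in>I. x k /\<^sub>R norm (x k) = \<gamma> i (norm (x k))"
      using conic_arcs_mem_iff[OF X, of "x k /\<^sub>R norm (x k)" "norm (x k)"] pos k by simp
    then show ?thesis using k by (auto simp: K_def)
  qed
  show "v \<in> {c *\<^sub>R \<gamma> i 0 | c i. 0 \<le> c \<and> i \<in> I}"
  proof (cases "v = 0")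
    case True
    obtain k where "norm (x k) < \<epsilon>" using eventually_happens[OF ev] by auto
    then have "I \<noteq> {}" using inK[of k] by (auto simp: K_def)
    then show ?thesis using True by force
  next
    case False
    have "(\<lambda>k. (x k /\<^sub>R t k) /\<^sub>R norm (x k /\<^sub>R t k)) \<longlonglongrightarrow> v /\<^sub>R norm v"
      using lim(2) False by (intro tendsto_intros) auto
    moreover have "(x k /\<^sub>R t k) /\<^sub>R norm (x k /\<^sub>R t k) = x k /\<^sub>R norm (x k)" for k
      using xt(2)[of k] by simp
    ultimately have "(\<lambda>k. x k /\<^sub>R norm (x k)) \<longlonglongrightarrow> v /\<^sub>R norm v" by (simp only:)
    moreover have "(\<lambda>k. norm (x k)) \<longlonglongrightarrow> 0" using tendsto_norm[OF lim(1)] by simp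
    ultimately have "(\<lambda>k. (x k /\<^sub>R norm (x k), norm (x k))) \<longlonglongrightarrow> (v /\<^sub>R norm v, 0)" by (rule tendsto_Pair)
    moreover have "eventually (\<lambda>k. (x k /\<^sub>R norm (x k), norm (x k)) \<in> K) sequentially"
      using ev by eventually_elim (rule inK)
    ultimately have "(v /\<^sub>R norm v, 0) \<in> K"
      by (intro Lim_in_closed_set[OF K _ sequentially_bot])
    then obtain i where i: "i \<in> I" "v /\<^sub>R norm v = \<gamma> i 0" by (auto simp: K_def)
    then have "v = norm v *\<^sub>R \<gamma> i 0" using False by (simp flip: i(2))
    then show ?thesis using i(1) norm_ge_zero by blast
  qed
next
  note D = conic_arcsD[OF X]
  fix v assume "v \<in> {c *\<^sub>R \<gamma> i 0 | c i. 0 \<le> c \<and> i \<in> I}"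
  then obtain c i where v: "v = c *\<^sub>R \<gamma> i 0" "0 \<le> c" "i \<in> I" by blast
  define r where "r = (\<lambda>k. \<epsilon> * inverse (real (Suc k)))"
  \<comment> \<open>For \<open>c = 0\<close> any constant scaling gives the limit \<open>0\<close>.\<close>
  define t where "t = (\<lambda>k. if c = 0 then 1 else r k / c)"
  define x where "x = (\<lambda>k. r k *\<^sub>R \<gamma> i (r k))"
  have r: "0 < r k" "r k \<le> \<epsilon>" for k using D(1) by (auto simp: r_def field_simps)
  have r0: "r \<longlonglongrightarrow> 0" unfolding r_def using LIMSEQ_inverse_real_of_nat by (auto intro: tendsto_mult_right_zero)
  have lim: "(\<lambda>k. \<gamma> i (r k)) \<longlonglongrightarrow> \<gamma> i 0"
    by (rule continuous_on_tendsto_compose[OF D(3)[OF v(3)] r0])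
       (use D(1) r in \<open>auto intro!: always_eventually simp: less_imp_le\<close>)
  have g: "(\<lambda>k. c *\<^sub>R \<gamma> i (r k)) \<longlonglongrightarrow> c *\<^sub>R \<gamma> i 0" for c
    by (intro tendsto_intros lim)
  have x0: "x \<longlonglongrightarrow> 0 *\<^sub>R \<gamma> i 0"
    unfolding x_def by (intro tendsto_scaleR r0 lim)
  have "x k \<in> X - {0} \<and> 0 < t k" for k
  proof -
    have n: "norm (\<gamma> i (r k)) = 1" using D(4)[OF v(3)] r[of k] by simp
    then have "x k \<in> X" unfolding x_def using conic_arcs_mem_iff[OF X n r] v(3) by blast
    moreover have "x k \<noteq> 0" using n r(1)[of k] unfolding x_def by auto
    ultimately show ?thesis using v(2) r(1)[of k] by (auto simp: t_def)
  qed
  moreover have "x \<longlonglongrightarrow> 0" using x0 by simp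
  moreover have "(\<lambda>k. x k /\<^sub>R t k) \<longlonglongrightarrow> v"
  proof (cases "c = 0")
    case True
    then show ?thesis using x0 by (simp add: t_def v)
  next
    case False
    have "x k /\<^sub>R t k = c *\<^sub>R \<gamma> i (r k)" for k
      using False r(1)[of k] by (simp add: t_def x_def)
    then show ?thesis using g[of c] by (simp add: v)
  qed
  ultimately show "v \<in> tangent_cone X" unfolding tangent_cone_def by blast
qed

section \<open>Simple points and tangent half-lines\<close>

text \<open>The projection of the graph to the second factor and its inverse. The points of
  \<open>Euclidean_space 1\<close> are sequences, whence the evaluation at \<open>0\<close>.\<close>

lemma graph_homeomorphic_to_interval:
  assumes "continuous_on T g"
  shows "top_of_set (lift_arc g T) homeomorphic_space subtopology (Euclidean_space 1) {y. y 0 \<in> T}"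
proof -
  let ?E = "subtopology (Euclidean_space 1) {y. y 0 \<in> T}"
  let ?f = "\<lambda>p :: 'a \<times> real. \<lambda>i::nat. if i = 0 then snd p else 0"
  let ?h = "\<lambda>y :: nat \<Rightarrow> real. (g (y 0), y 0)"
  have "continuous_map (top_of_set (lift_arc g T)) (powertop_real UNIV) ?f"
    unfolding continuous_map_componentwise_UNIV
  proof
    fix i :: nat
    show "continuous_map (top_of_set (lift_arc g T)) euclideanreal (\<lambda>p. ?f p i)"
      by (cases "i = 0") (auto simp: continuous_map_iff_continuous intro!: continuous_intros)
  qed
  then have f: "continuous_map (top_of_set (lift_arc g T)) ?E ?f"
    by (auto simp: Euclidean_space_def continuous_map_in_subtopology lift_arc_def)
  have proj: "continuous_map ?E (top_of_set T) (\<lambda>y. y 0)"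
    by (auto simp: Euclidean_space_def continuous_map_in_subtopology
        intro!: continuous_map_from_subtopology continuous_map_product_projection)
  have "continuous_map (top_of_set T) euclidean (\<lambda>r. (g r, r))"
    using assms by (auto simp: continuous_map_iff_continuous intro!: continuous_intros)
  from continuous_map_compose[OF proj this]
  have h: "continuous_map ?E (top_of_set (lift_arc g T)) ?h"
    by (auto simp: continuous_map_in_subtopology o_def lift_arc_def Euclidean_space_def)
  have "homeomorphic_maps (top_of_set (lift_arc g T)) ?E ?f ?h"
    unfolding homeomorphic_maps_def using f h
    by (auto simp: lift_arc_def Euclidean_space_def fun_eq_iff)
  then show ?thesis unfolding homeomorphic_space_def by blast
qed

lemma continuous_map_Euclidean_space_projection:
  "continuous_map (Euclidean_space n) euclideanreal (\<lambda>y. y 0)"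
  unfolding Euclidean_space_def
  by (intro continuous_map_from_subtopology continuous_map_product_projection) auto

lemma topological_manifold_graph:
  assumes "continuous_on {0<..<s} g"
  shows "topological_manifold 1 (lift_arc g {0<..<s})"
  unfolding topological_manifold_def
proof
  let ?E = "Euclidean_space 1" and ?C = "lift_arc g {0<..<s}"
  let ?W = "{y \<in> topspace ?E. y 0 \<in> {0<..<s}}"
  fix x assume x: "x \<in> ?C"
  have "openin ?E ?W"
    by (rule openin_continuous_map_preimage[OF continuous_map_Euclidean_space_projection]) auto
  moreover have "?W = topspace ?E \<inter> {y. y 0 \<in> {0<..<s}}" by auto
  then have "subtopology ?E ?W = subtopology ?E {y. y 0 \<in> {0<..<s}}"
    using subtopology_restrict[of ?E "{y. y 0 \<in> {0<..<s}}"] by (simp only:)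
  ultimately show "\<exists>V W. openin (top_of_set ?C) V \<and> x \<in> V \<and> openin ?E W
      \<and> top_of_set V homeomorphic_space subtopology ?E W"
    using graph_homeomorphic_to_interval[OF assms] x
    by (intro exI[of _ ?C], intro exI[of _ ?W]) auto
qed

lemma topological_manifold_with_boundary_graph:
  assumes "continuous_on {0..<s} g"
  shows "topological_manifold_with_boundary 1 (lift_arc g {0..<s})"
  unfolding topological_manifold_with_boundary_def
proof
  let ?E = "Euclidean_space 1" and ?C = "lift_arc g {0..<s}"
  let ?H = "subtopology ?E {y. 0 \<le> y 0}"
  let ?W = "{y \<in> topspace ?H. y 0 \<in> {..<s}}"
  fix x assume x: "x \<in> ?C"
  have "openin ?H ?W"
    by (rule openin_continuous_map_preimage[OF continuous_map_from_subtopology[OF continuous_map_Euclidean_space_projection]]) auto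
  moreover have "?W = topspace ?E \<inter> {y. y 0 \<in> {0..<s}}" by auto
  then have "subtopology ?E ?W = subtopology ?E {y. y 0 \<in> {0..<s}}"
    using subtopology_restrict[of ?E "{y. y 0 \<in> {0..<s}}"] by (simp only:)
  ultimately show "\<exists>V W. openin (top_of_set ?C) V \<and> x \<in> V \<and> openin ?H W
      \<and> top_of_set V homeomorphic_space subtopology ?E W"
    using graph_homeomorphic_to_interval[OF assms] x
    by (intro exI[of _ ?C], intro exI[of _ ?W]) auto
qed

text \<open>Every boundary point is simple: in a neighbourhood that contains no other boundary point the
  components are the finitely many lifted arcs ending there, which are open intervals, and adding
  the boundary point makes them half-open intervals.\<close>

lemma Smp_conic:
  fixes X :: "(real ^ 'n) set"
  assumes X: "conic_arcs X \<epsilon> I \<gamma>" and dim: "analytic_dim X = 1"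
  shows "Smp X = strict_boundary X"
proof (intro equalityI subsetI)
  note D = conic_arcsD[OF X]
  fix p assume "p \<in> strict_boundary X"
  then obtain v i0 where p: "p = (v, 0)" "i0 \<in> I" "v = \<gamma> i0 0"
    using strict_boundary_conic[OF X] by (cases p) auto
  obtain d s where ds: "0 < d" "0 < s" "s < \<epsilon>"
    and near: "\<And>i r. i \<in> I \<Longrightarrow> 0 \<le> r \<Longrightarrow> r < s \<Longrightarrow> \<gamma> i r \<in> ball v d \<longleftrightarrow> \<gamma> i 0 = v"
    by (rule separate_directions[OF X]) (rule that)
  define J where "J = {i\<in>I. \<gamma> i 0 = v}"
  define U where "U = ball v d \<times> {-s<..<s}"
  define B where "B = (\<lambda>i. lift_arc (\<gamma> i) {0<..<s})"
  define K where "K = (\<lambda>i. lift_arc (\<gamma> i) {0..\<epsilon>})"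
  define S where "S = strict_transform X \<inter> U - strict_boundary X"
  have cont: "continuous_on T (\<gamma> i)" if "i \<in> J" "T \<subseteq> {0..\<epsilon>}" for i T
    using that by (intro continuous_on_subset[OF D(3)]) (auto simp: J_def)
  have mem: "(q, r) \<in> S \<longleftrightarrow> 0 < r \<and> r < s \<and> (\<exists>i\<in>J. q = \<gamma> i r)" for q r
  proof
    assume "(q, r) \<in> S"
    then have L: "(q, r) \<in> strict_transform X" "q \<in> ball v d" "r < s" "(q, r) \<notin> strict_boundary X"
      by (auto simp: S_def U_def)
    then obtain i where i: "i \<in> I" "0 \<le> r" "q = \<gamma> i r" using strict_transform_conic[OF X, of r q] ds by auto
    then have "0 < r" using L(4) strict_boundary_conic[OF X] by (cases "r = 0") auto
    then show "0 < r \<and> r < s \<and> (\<exists>i\<in>J. q = \<gamma> i r)" using near[of i r] i L by (auto simp: J_def)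
  next
    assume R: "0 < r \<and> r < s \<and> (\<exists>i\<in>J. q = \<gamma> i r)"
    then obtain i where i: "i \<in> I" "\<gamma> i 0 = v" "q = \<gamma> i r" by (auto simp: J_def)
    then have "q \<in> ball v d" using near[of i r] R by auto
    then show "(q, r) \<in> S"
      using strict_transform_conic[OF X, of r q] strict_boundary_conic[OF X, of q r] R ds i
      by (auto simp: U_def S_def)
  qed
  have S: "S = (\<Union>i\<in>J. B i)"
  proof (rule pair_set_eqI)
    show "(q, r) \<in> S \<longleftrightarrow> (q, r) \<in> (\<Union>i\<in>J. B i)" for q r unfolding mem by (auto simp: B_def)
  qed
  have closedK: "closed (K i) \<and> B i = S \<inter> K i" if i: "i \<in> J" for i
  proof
    show "closed (K i)" unfolding K_def using cont[OF i] by (intro compact_imp_closed compact_lift_arc) auto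
    have "(q, r) \<in> B i \<longleftrightarrow> (q, r) \<in> S \<inter> K i" for q r
      unfolding Int_iff mem using i ds by (auto simp: B_def K_def)
    then show "B i = S \<inter> K i" by (rule pair_set_eqI)
  qed
  have disj: "B i \<inter> B j = {}" if "i \<in> J" "j \<in> J" "i \<noteq> j" for i j
    using D(5)[of i j] that ds by (fastforce simp: B_def J_def)
  have connB: "connected (B i)" if "i \<in> J" for i
    unfolding B_def by (intro connected_lift_arc cont[OF that]) (use ds in auto)
  have comp: "\<exists>i\<in>J. C = B i" if C: "C \<in> components S" for C
  proof -
    have "\<exists>i\<in>J. C \<subseteq> B i"
    proof (rule connected_subset_of_piece[where S = S and K = K])
      show "finite J" using D(2) by (simp add: J_def)
    qed (use S closedK disj in_components_connected[OF C] in_components_subset[OF C] in_components_nonempty[OF C] in auto)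
    then obtain i where i: "i \<in> J" "C \<subseteq> B i" by blast
    have "B i \<subseteq> C"
      using in_components_nonempty[OF C] i S by (intro components_maximal[OF C connB]) auto
    then show ?thesis using i by auto
  qed
  have finite_comp: "finite (components S)"
    by (rule finite_subset[of _ "B ` J"]) (use comp D(2) in \<open>auto simp: J_def\<close>)
  have half: "(B i \<union> strict_boundary X) \<inter> U = lift_arc (\<gamma> i) {0..<s}" if i: "i \<in> J" for i
  proof (rule pair_set_eqI)
    fix q r
    have "(q, r) \<in> strict_boundary X \<inter> U \<longleftrightarrow> r = 0 \<and> q = v"
      using strict_boundary_conic[OF X, of q r] near[of _ 0] p ds by (auto simp: U_def)
    moreover have "B i \<subseteq> U" using S i by (auto simp: S_def)
    ultimately have "(q, r) \<in> (B i \<union> strict_boundary X) \<inter> U \<longleftrightarrow> (q, r) \<in> B i \<or> r = 0 \<and> q = v" by blast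
    moreover have "(q, r) \<in> lift_arc (\<gamma> i) {0..<s} \<longleftrightarrow> (q, r) \<in> B i \<or> r = 0 \<and> q = v"
      using i ds by (cases "r = 0") (auto simp: B_def J_def)
    ultimately show "(q, r) \<in> (B i \<union> strict_boundary X) \<inter> U \<longleftrightarrow> (q, r) \<in> lift_arc (\<gamma> i) {0..<s}"
      by simp
  qed
  have "topological_manifold (analytic_dim X) C \<and>
        topological_manifold_with_boundary (analytic_dim X) ((C \<union> strict_boundary X) \<inter> U)"
    if C: "C \<in> components S" for C
  proof -
    obtain i where i: "i \<in> J" "C = B i" using comp[OF C] by blast
    have "topological_manifold 1 (lift_arc (\<gamma> i) {0<..<s})"
      by (intro topological_manifold_graph cont[OF i(1)]) (use ds in auto)
    moreover have "topological_manifold_with_boundary 1 (lift_arc (\<gamma> i) {0..<s})"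
      by (intro topological_manifold_with_boundary_graph cont[OF i(1)]) (use ds in auto)
    ultimately show ?thesis using half[OF i(1)] i by (simp add: dim B_def)
  qed
  moreover have "open U" unfolding U_def by (intro open_Times) auto
  moreover have "p \<in> U" using p ds by (simp add: U_def)
  ultimately show "p \<in> Smp X"
    using finite_comp \<open>p \<in> strict_boundary X\<close> unfolding Smp_def S_def by blast
qed (simp add: Smp_def)

definition ray :: "'a::real_vector \<Rightarrow> 'a set" where
  "ray v = {t *\<^sub>R v | t. 0 \<le> t}"

lemma ray_eq_iff:
  assumes "norm v = 1" "norm w = (1::real)"
  shows "ray v = ray w \<longleftrightarrow> v = w"
proof
  assume "ray v = ray w"
  then have "1 *\<^sub>R v \<in> ray w" unfolding ray_def by (metis (mono_tags, lifting) mem_Collect_eq zero_le_one)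
  then obtain t where t: "0 \<le> t" "v = t *\<^sub>R w" unfolding ray_def by auto
  then have "t = 1" using assms by simp
  then show "v = w" using t by simp
qed simp

lemma tangent_half_lines_conic:
  assumes X: "conic_arcs X \<epsilon> I \<gamma>"
  shows "tangent_half_lines X = (\<lambda>i. ray (\<gamma> i 0)) ` I"
proof (intro equalityI subsetI)
  note D = conic_arcsD[OF X]
  fix l assume "l \<in> tangent_half_lines X"
  then obtain v where v: "v \<noteq> 0" "l = ray v" "l \<subseteq> tangent_cone X"
    unfolding tangent_half_lines_def ray_def by blast
  have "1 *\<^sub>R v \<in> ray v" unfolding ray_def by (intro CollectI exI[of _ 1]) auto
  then obtain c i where c: "v = c *\<^sub>R \<gamma> i 0" "0 \<le> c" "i \<in> I"
    using v(2,3) unfolding tangent_cone_conic[OF X] by auto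
  then have c0: "0 < c" using v(1) by (cases "c = 0") auto
  have "ray v = ray (\<gamma> i 0)"
  proof (intro equalityI subsetI)
    fix x assume "x \<in> ray v"
    then obtain t where "0 \<le> t" "x = t *\<^sub>R v" unfolding ray_def by blast
    then show "x \<in> ray (\<gamma> i 0)" unfolding ray_def using c by (intro CollectI exI[of _ "t * c"]) auto
  next
    fix x assume "x \<in> ray (\<gamma> i 0)"
    then obtain t where "0 \<le> t" "x = t *\<^sub>R \<gamma> i 0" unfolding ray_def by blast
    then show "x \<in> ray v" unfolding ray_def using c c0 by (intro CollectI exI[of _ "t / c"]) auto
  qed
  then show "l \<in> (\<lambda>i. ray (\<gamma> i 0)) ` I" using c v by blast
next
  note D = conic_arcsD[OF X]
  fix l assume "l \<in> (\<lambda>i. ray (\<gamma> i 0)) ` I"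
  then obtain i where i: "i \<in> I" "l = ray (\<gamma> i 0)" by blast
  have "\<gamma> i 0 \<noteq> 0" using D(4)[OF i(1), of 0] D(1) by auto
  moreover have "l \<subseteq> tangent_cone X" unfolding tangent_cone_conic[OF X] i(2) ray_def using i(1) by blast
  ultimately show "l \<in> tangent_half_lines X" unfolding tangent_half_lines_def i(2) ray_def by blast
qed

lemma conic_arcs_branch:
  assumes X: "conic_arcs X \<epsilon> I \<gamma>" and i: "i \<in> I" and \<delta>: "0 < \<delta>" "\<delta> < \<epsilon>"
  shows "conic_arcs (branch (\<gamma> i) \<epsilon>) \<delta> {i} \<gamma>"
proof (rule conic_arcsI)
  note D = conic_arcsD[OF conic_arcs_mono[OF X \<delta>(1) less_imp_le[OF \<delta>(2)]]]
  show "continuous_on {0..\<delta>} (\<gamma> j)" if "j \<in> {i}" for j using D(3) i that by simp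
  show "norm (\<gamma> j r) = 1" if "j \<in> {i}" "0 \<le> r" "r \<le> \<delta>" for j r using D(4) i that by simp
  show "r *\<^sub>R q \<in> branch (\<gamma> i) \<epsilon> \<longleftrightarrow> (\<exists>j\<in>{i}. q = \<gamma> j r)" if q: "norm q = 1" and r: "0 < r" "r \<le> \<delta>" for q r
  proof
    assume "r *\<^sub>R q \<in> branch (\<gamma> i) \<epsilon>"
    then obtain r' where r': "0 < r'" "r' < \<epsilon>" "r *\<^sub>R q = r' *\<^sub>R \<gamma> i r'" by (auto simp: branch_def)
    have "norm (r *\<^sub>R q) = r" "norm (r' *\<^sub>R \<gamma> i r') = r'"
      using q r r'(1,2) conic_arcsD(4)[OF X i, of r'] by auto
    then have "r = r'" using r'(3) by simp
    then show "\<exists>j\<in>{i}. q = \<gamma> j r" using r' by simp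
  next
    assume "\<exists>j\<in>{i}. q = \<gamma> j r"
    then show "r *\<^sub>R q \<in> branch (\<gamma> i) \<epsilon>"
      unfolding branch_def using r \<delta> by (intro image_eqI[of _ _ r]) auto
  qed
qed (use \<delta> in auto)

text \<open>A germ at the origin determines the tangent cone of all its representatives, so one representative
  decides which half-line a half-branch is tangent to.\<close>

lemma tangent_cone_germ:
  assumes X: "conic_arcs X \<epsilon> I \<gamma>" and B: "B \<in> germ X 0"
  shows "tangent_cone B = tangent_cone X"
proof -
  obtain U where U: "open U" "0 \<in> U" "X \<inter> U = B \<inter> U" using B unfolding germ_def by blast
  then obtain \<delta> where \<delta>: "0 < \<delta>" "\<delta> \<le> \<epsilon>" "conic_arcs X \<delta> I \<gamma>" "conic_arcs (X \<inter> U) \<delta> I \<gamma>"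
    using conic_arcs_restrict[OF X, of U] by (auto simp: interior_open)
  obtain e where e: "0 < e" "ball 0 e \<subseteq> U" using U open_contains_ball by blast
  define \<eta> where "\<eta> = min \<delta> (e / 2)"
  have \<eta>: "0 < \<eta>" "\<eta> \<le> \<delta>" "cball 0 \<eta> \<subseteq> U" using \<delta> e by (auto simp: \<eta>_def subset_iff)
  have "conic_arcs B \<eta> I \<gamma>"
    by (rule conic_arcs_cong[OF conic_arcs_mono[OF \<delta>(3) \<eta>(1,2)]]) (use U \<eta>(3) in blast)
  from tangent_cone_conic[OF this] tangent_cone_conic[OF X] show ?thesis by simp
qed

lemma half_branches_tangent_conic:
  assumes X: "conic_arcs X \<epsilon> I \<gamma>" and v: "norm v = 1"
  shows "half_branches_tangent X (ray v) = (\<lambda>i. germ (branch (\<gamma> i) \<epsilon>) 0) ` {i\<in>I. \<gamma> i 0 = v}"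
proof -
  note D = conic_arcsD[OF X]
  have cone: "tangent_cone B = ray (\<gamma> i 0)" if i: "i \<in> I" and B: "B \<in> germ (branch (\<gamma> i) \<epsilon>) 0" for i B
  proof -
    have c: "conic_arcs (branch (\<gamma> i) \<epsilon>) (\<epsilon> / 2) {i} \<gamma>" using D(1) by (intro conic_arcs_branch[OF X i]) auto
    show ?thesis
      unfolding tangent_cone_germ[OF c B] tangent_cone_conic[OF c] by (auto simp: ray_def)
  qed
  have "(\<forall>B\<in>germ (branch (\<gamma> i) \<epsilon>) 0. tangent_cone B = ray v) \<longleftrightarrow> \<gamma> i 0 = v" if i: "i \<in> I" for i
  proof -
    have "(\<forall>B\<in>germ (branch (\<gamma> i) \<epsilon>) 0. tangent_cone B = ray v) \<longleftrightarrow> ray (\<gamma> i 0) = ray v"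
      using cone[OF i] germ_self[of "branch (\<gamma> i) \<epsilon>" 0] by auto
    then show ?thesis using ray_eq_iff[of "\<gamma> i 0" v] D(4)[OF i, of 0] D(1) v by simp
  qed
  then show ?thesis unfolding half_branches_tangent_def half_branches_conic(1)[OF X] by auto
qed

lemma card_half_branches_tangent:
  assumes X: "conic_arcs X \<epsilon> I \<gamma>" and v: "norm v = 1"
  shows "card (half_branches_tangent X (ray v)) = card {i\<in>I. \<gamma> i 0 = v}"
    "finite (half_branches_tangent X (ray v))"
  unfolding half_branches_tangent_conic[OF X v]
  using half_branches_conic(2)[OF X] conic_arcsD(2)[OF X] by (auto intro!: card_image intro: inj_on_subset)

section \<open>Blow-spherical homeomorphisms and multiplicities\<close>

text \<open>Each of the three conditions of the theorem is equivalent to one of this form, for sets in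
  bijection with the set of directions of the arcs at the origin.\<close>

definition matchable :: "'a set \<Rightarrow> ('a \<Rightarrow> nat) \<Rightarrow> 'b set \<Rightarrow> ('b \<Rightarrow> nat) \<Rightarrow> bool" where
  "matchable D m E n \<longleftrightarrow> (\<exists>\<tau>. bij_betw \<tau> D E \<and> (\<forall>v\<in>D. m v = n (\<tau> v)))"

lemma matchable_pullback:
  assumes "matchable D m E n" and f: "bij_betw f D' D" "\<And>x. x \<in> D' \<Longrightarrow> m' x = m (f x)"
    and g: "bij_betw g E' E" "\<And>x. x \<in> E' \<Longrightarrow> n' x = n (g x)"
  shows "matchable D' m' E' n'"
proof -
  obtain \<tau> where \<tau>: "bij_betw \<tau> D E" "\<forall>v\<in>D. m v = n (\<tau> v)" using assms(1) by (auto simp: matchable_def)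
  let ?g = "inv_into E' g"
  have "bij_betw (?g \<circ> \<tau> \<circ> f) D' E'"
    using f(1) \<tau>(1) bij_betw_inv_into[OF g(1)] by (intro bij_betw_trans[of f D' D] bij_betw_trans[of \<tau> D E]) (auto simp: o_assoc)
  moreover have "m' x = n' ((?g \<circ> \<tau> \<circ> f) x)" if x: "x \<in> D'" for x
  proof -
    have fx: "f x \<in> D" using bij_betwE[OF f(1)] x by blast
    then have \<tau>x: "\<tau> (f x) \<in> E" using bij_betwE[OF \<tau>(1)] by blast
    have "?g (\<tau> (f x)) \<in> E'" using bij_betwE[OF bij_betw_inv_into[OF g(1)]] \<tau>x by blast
    moreover have "g (?g (\<tau> (f x))) = \<tau> (f x)" using bij_betw_inv_into_right[OF g(1) \<tau>x] .
    ultimately show ?thesis using f(2)[OF x] g(2) \<tau>(2) fx by simp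
  qed
  ultimately show ?thesis unfolding matchable_def by blast
qed

lemma matchable_transfer:
  assumes f: "bij_betw f D' D" "\<And>x. x \<in> D' \<Longrightarrow> m' x = m (f x)"
    and g: "bij_betw g E' E" "\<And>x. x \<in> E' \<Longrightarrow> n' x = n (g x)"
  shows "matchable D' m' E' n' \<longleftrightarrow> matchable D m E n"
proof
  assume "matchable D m E n"
  then show "matchable D' m' E' n'" using f g by (rule matchable_pullback)
next
  assume M: "matchable D' m' E' n'"
  show "matchable D m E n"
  proof (rule matchable_pullback[OF M bij_betw_inv_into[OF f(1)] _ bij_betw_inv_into[OF g(1)]])
    show "m x = m' (inv_into D' f x)" if x: "x \<in> D" for x
    proof -
      have "inv_into D' f x \<in> D'" using bij_betwE[OF bij_betw_inv_into[OF f(1)]] x by blast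
      then show ?thesis using f(2) bij_betw_inv_into_right[OF f(1) x] by simp
    qed
    show "n x = n' (inv_into E' g x)" if x: "x \<in> E" for x
    proof -
      have "inv_into E' g x \<in> E'" using bij_betwE[OF bij_betw_inv_into[OF g(1)]] x by blast
      then show ?thesis using g(2) bij_betw_inv_into_right[OF g(1) x] by simp
    qed
  qed
qed

text \<open>Neighbourhoods in the ambient spaces correspond under a homeomorphism of the subsets; this is what
  the notions defined by germs are transported along.\<close>

lemma homeomorphism_neighbourhood:
  assumes "homeomorphism S T h k" "open U"
  shows "\<exists>V. open V \<and> (\<forall>z\<in>S. h z \<in> V \<longleftrightarrow> z \<in> U)"
proof -
  have "continuous_on T k" using assms(1) by (simp add: homeomorphism_def)
  then have "openin (top_of_set T) (T \<inter> k -` U)" using assms(2) by (intro continuous_openin_preimage_gen)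
  then obtain V where V: "open V" "T \<inter> k -` U = T \<inter> V" by (auto simp: openin_open)
  have "h z \<in> V \<longleftrightarrow> z \<in> U" if z: "z \<in> S" for z
  proof -
    have "h z \<in> T" "k (h z) = z" using assms(1) z by (auto simp: homeomorphism_def)
    moreover have "h z \<in> T \<inter> k -` U \<longleftrightarrow> h z \<in> T \<inter> V" using V(2) by simp
    ultimately show ?thesis by simp
  qed
  then show ?thesis using V(1) by blast
qed

lemma germ_eq_homeomorphism:
  assumes h: "homeomorphism S T h k" and CD: "C \<subseteq> S" "D \<subseteq> S" and x: "x \<in> S" and eq: "germ C x = germ D x"
  shows "germ (h ` C) (h x) = germ (h ` D) (h x)"
proof -
  obtain U where U: "open U" "x \<in> U" "C \<inter> U = D \<inter> U" using germ_eqD[OF eq] by blast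
  obtain V where V: "open V" "\<forall>z\<in>S. h z \<in> V \<longleftrightarrow> z \<in> U" using homeomorphism_neighbourhood[OF h U(1)] by blast
  have "h ` C \<inter> V = h ` (C \<inter> U)" "h ` D \<inter> V = h ` (D \<inter> U)" using V(2) CD by blast+
  then show ?thesis using U V x by (intro germ_eqI[of V]) auto
qed

text \<open>The witness of smallness is carried over, and the components of corresponding neighbourhoods
  correspond.\<close>

lemma germ_components_homeomorphism:
  assumes h: "homeomorphism S T h k" and C: "C \<subseteq> A" "A \<subseteq> S" and x: "x \<in> S"
    and mem: "germ C x \<in> germ_components A x"
  shows "germ (h ` C) (h x) \<in> germ_components (h ` A) (h x)"
proof -
  have h': "homeomorphism T S k h" using h by (rule homeomorphism_symD)
  have hk: "\<And>z. z \<in> S \<Longrightarrow> k (h z) = z" "h ` S = T" "continuous_on S h" "continuous_on T k"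
    using h by (auto simp: homeomorphism_def)
  obtain U0 where U0: "open U0" "x \<in> U0"
    "\<forall>U. open U \<and> x \<in> U \<and> U \<subseteq> U0 \<longrightarrow> (\<exists>E \<in> components (A \<inter> U). x \<in> closure E \<and> germ C x = germ E x)"
    using mem unfolding germ_components_def by blast
  obtain V0 where V0: "open V0" "\<forall>z\<in>S. h z \<in> V0 \<longleftrightarrow> z \<in> U0" using homeomorphism_neighbourhood[OF h U0(1)] by blast
  have "\<exists>E \<in> components (h ` A \<inter> V). h x \<in> closure E \<and> germ (h ` C) (h x) = germ E (h x)"
    if V: "open V" "h x \<in> V" "V \<subseteq> V0" for V
  proof -
    obtain U1 where U1: "open U1" "\<forall>y\<in>T. k y \<in> U1 \<longleftrightarrow> y \<in> V" using homeomorphism_neighbourhood[OF h' V(1)] by blast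
    have U1': "z \<in> U1 \<longleftrightarrow> h z \<in> V" if z: "z \<in> S" for z
    proof -
      have "h z \<in> T" using hk(2) z by blast
      then show ?thesis using U1(2) hk(1)[OF z] by metis
    qed
    define U where "U = U1 \<inter> U0"
    have "open U \<and> x \<in> U \<and> U \<subseteq> U0" using U1(1) U0 U1'[OF x] V(2) by (auto simp: U_def)
    then obtain E where E: "E \<in> components (A \<inter> U)" "x \<in> closure E" "germ C x = germ E x"
      using U0(3) by blast
    have EA: "E \<subseteq> A \<inter> U" using in_components_subset[OF E(1)] .
    have img: "h ` (A \<inter> U) = h ` A \<inter> V"
      using U1' V0(2) V(3) C(2) unfolding U_def by blast
    have "h ` E \<in> components (h ` A \<inter> V)"
      unfolding in_components_maximal
    proof (intro conjI allI impI)
      show "h ` E \<noteq> {}" using in_components_nonempty[OF E(1)] by blast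
      show "h ` E \<subseteq> h ` A \<inter> V" using EA img by blast
      show "connected (h ` E)"
        using EA C(2) by (intro connected_continuous_image in_components_connected[OF E(1)] continuous_on_subset[OF hk(3)]) auto
      fix D assume D: "D \<noteq> {} \<and> h ` E \<subseteq> D \<and> D \<subseteq> h ` A \<inter> V \<and> connected D"
      have DT: "D \<subseteq> T" using D C(2) hk(2) by blast
      have "connected (k ` D)" using D DT by (intro connected_continuous_image continuous_on_subset[OF hk(4)]) auto
      moreover have "k ` D \<subseteq> A \<inter> U"
      proof
        fix z assume "z \<in> k ` D"
        then obtain y where "y \<in> D" "z = k y" by blast
        moreover from this obtain w where "w \<in> A \<inter> U" "y = h w" using D img by blast
        ultimately show "z \<in> A \<inter> U" using hk(1) C(2) by auto
      qed
      moreover have "E \<inter> k ` D \<noteq> {}"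
      proof -
        obtain z where z: "z \<in> E" using in_components_nonempty[OF E(1)] by blast
        then have "z = k (h z)" using hk(1) EA C(2) by auto
        then show ?thesis using z D by blast
      qed
      ultimately have "k ` D \<subseteq> E" by (intro components_maximal[OF E(1)])
      have "D \<subseteq> h ` E"
      proof
        fix y assume y: "y \<in> D"
        then have "h (k y) = y" using h DT by (auto simp: homeomorphism_def)
        then show "y \<in> h ` E" using \<open>k ` D \<subseteq> E\<close> y by (metis imageI subsetD)
      qed
      then show "D = h ` E" using D by blast
    qed
    moreover have "h x \<in> closure (h ` E)"
    proof (rule ccontr)
      assume "h x \<notin> closure (h ` E)"
      obtain W where W: "open W" "\<forall>y\<in>T. k y \<in> W \<longleftrightarrow> y \<in> - closure (h ` E)"
        using homeomorphism_neighbourhood[OF h', of "- closure (h ` E)"] by auto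
      have W': "z \<in> W \<longleftrightarrow> h z \<notin> closure (h ` E)" if z: "z \<in> S" for z
      proof -
        have "h z \<in> T" using hk(2) z by blast
        then show ?thesis using W(2) hk(1)[OF z] by (metis ComplD ComplI)
      qed
      have "x \<in> W" using W'[OF x] \<open>h x \<notin> _\<close> by blast
      then have "W \<inter> E \<noteq> {}" using E(2) open_Int_closure_eq_empty[OF W(1), of E] by blast
      then obtain z where z: "z \<in> W" "z \<in> E" by blast
      then have "h z \<notin> closure (h ` E)" using W' EA C(2) by blast
      then show False using z closure_subset[of "h ` E"] by blast
    qed
    moreover have "germ (h ` C) (h x) = germ (h ` E) (h x)"
      using EA C by (intro germ_eq_homeomorphism[OF h _ _ x E(3)]) auto
    ultimately show ?thesis by blast
  qed
  moreover have "h x \<in> V0" using V0(2) x U0(2) by blast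
  ultimately show ?thesis unfolding germ_components_def using V0(1) by blast
qed

lemma germ_components_representative:
  assumes "c \<in> germ_components A x"
  shows "\<exists>C. C \<subseteq> A \<and> c = germ C x"
proof -
  obtain U where "open U" "x \<in> U" "\<exists>C \<in> components (A \<inter> U). x \<in> closure C \<and> c = germ C x"
    using assms unfolding germ_components_def by blast
  then obtain C where "C \<in> components (A \<inter> U)" "c = germ C x" by blast
  then show ?thesis using in_components_subset[of C "A \<inter> U"] by blast
qed

text \<open>Every component of the germ is represented by a subset of \<open>A\<close>, and the image of its germ does not
  depend on the representative.\<close>

lemma card_germ_components_homeomorphism:
  assumes h: "homeomorphism S T h k" and A: "A \<subseteq> S" and x: "x \<in> S"
  shows "card (germ_components A x) = card (germ_components (h ` A) (h x))"
proof -
  have h': "homeomorphism T S k h" using h by (rule homeomorphism_symD)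
  have hk: "\<And>z. z \<in> S \<Longrightarrow> k (h z) = z" "h ` S = T" using h by (auto simp: homeomorphism_def)
  have kh: "k ` h ` C = C" if "C \<subseteq> S" for C using hk(1) that by force
  define rep where "rep = (\<lambda>c. SOME C. C \<subseteq> A \<and> c = germ C x)"
  have rep: "rep c \<subseteq> A" "c = germ (rep c) x" if "c \<in> germ_components A x" for c
    using someI_ex[OF germ_components_representative[OF that]] unfolding rep_def by auto
  have "bij_betw (\<lambda>c. germ (h ` rep c) (h x)) (germ_components A x) (germ_components (h ` A) (h x))"
    unfolding bij_betw_def
  proof (intro conjI equalityI subsetI)
    show "inj_on (\<lambda>c. germ (h ` rep c) (h x)) (germ_components A x)"
    proof (rule inj_onI)
      fix c d assume c: "c \<in> germ_components A x" and d: "d \<in> germ_components A x"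
        and eq: "germ (h ` rep c) (h x) = germ (h ` rep d) (h x)"
      have "germ (k ` h ` rep c) (k (h x)) = germ (k ` h ` rep d) (k (h x))"
        using rep(1)[OF c] rep(1)[OF d] A hk(2) x by (intro germ_eq_homeomorphism[OF h' _ _ _ eq]) auto
      moreover have "k ` h ` rep c = rep c" "k ` h ` rep d = rep d" using rep(1)[OF c] rep(1)[OF d] A by (auto intro!: kh)
      ultimately show "c = d" using rep(2)[OF c] rep(2)[OF d] hk(1)[OF x] by simp
    qed
  next
    fix e assume "e \<in> (\<lambda>c. germ (h ` rep c) (h x)) ` germ_components A x"
    then obtain c where c: "c \<in> germ_components A x" "e = germ (h ` rep c) (h x)" by blast
    then show "e \<in> germ_components (h ` A) (h x)"
      using rep[OF c(1)] A x by (auto intro!: germ_components_homeomorphism[OF h])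
  next
    fix e assume e: "e \<in> germ_components (h ` A) (h x)"
    then obtain D where D: "D \<subseteq> h ` A" "e = germ D (h x)" using germ_components_representative by blast
    have hA: "h ` A \<subseteq> T" "h x \<in> T" using A hk(2) x by auto
    have DA: "k ` D \<subseteq> A" using D(1) kh[OF A] by blast
    have "germ (k ` D) (k (h x)) \<in> germ_components (k ` h ` A) (k (h x))"
      using e D hA by (intro germ_components_homeomorphism[OF h' D(1)]) auto
    then have c: "germ (k ` D) x \<in> germ_components A x" using kh[OF A] hk(1)[OF x] by simp
    have "germ (h ` rep (germ (k ` D) x)) (h x) = germ (h ` k ` D) (h x)"
      using rep[OF c] DA A by (intro germ_eq_homeomorphism[OF h _ _ x]) auto
    moreover have "h ` k ` D = D"
    proof -
      have "h (k y) = y" if "y \<in> D" for y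
      proof -
        have "y \<in> T" using D(1) hA(1) that by blast
        then show ?thesis using h by (simp add: homeomorphism_def)
      qed
      then show ?thesis by force
    qed
    ultimately show "e \<in> (\<lambda>c. germ (h ` rep c) (h x)) ` germ_components A x" using c D(2) by force
  qed
  then show ?thesis by (rule bij_betw_same_card)
qed

text \<open>For a closed set the closure in the blowing-up adds points over the origin only.\<close>

lemma strict_transform_closed:
  fixes X :: "'a::euclidean_space set"
  assumes "closed X" and p: "p \<in> strict_transform X"
  shows "fst p \<in> sphere 0 1" "0 \<le> snd p" "blow p \<in> X"
    "p \<in> strict_boundary X \<longleftrightarrow> snd p = 0" "p \<in> blow_preimage X \<longleftrightarrow> snd p \<noteq> 0"
proof -
  have "closed (sphere (0::'a) 1 \<times> {0::real..})" by (intro closed_Times) auto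
  moreover have "blow_preimage X \<subseteq> sphere 0 1 \<times> {0..}" by (auto simp: blow_preimage_def)
  ultimately have "strict_transform X \<subseteq> sphere 0 1 \<times> {0..}"
    unfolding strict_transform_def by (intro closure_minimal)
  then have "p \<in> sphere 0 1 \<times> {0..}" using p by blast
  then show sph: "fst p \<in> sphere 0 1" and nn: "0 \<le> snd p" by (auto simp: mem_Times_iff)
  have "blow ` closure (blow_preimage X) \<subseteq> X"
    by (rule image_closure_subset) (use assms(1) in \<open>auto simp: blow_def blow_preimage_def intro!: continuous_intros\<close>)
  then show bX: "blow p \<in> X" using p unfolding strict_transform_def by blast
  show "p \<in> strict_boundary X \<longleftrightarrow> snd p = 0"
    using p sph by (auto simp: strict_boundary_def mem_Times_iff)
  show "p \<in> blow_preimage X \<longleftrightarrow> snd p \<noteq> 0"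
    using sph nn bX by (auto simp: blow_preimage_def mem_Times_iff blow_def)
qed

lemma rel_mult_restrict:
  assumes X: "conic_arcs X \<epsilon> I \<gamma>" and A: "0 \<in> interior A"
  shows "strict_boundary (X \<inter> A) = strict_boundary X \<and> (\<forall>p\<in>strict_boundary X. rel_mult (X \<inter> A) p = rel_mult X p)"
proof -
  obtain \<delta> where \<delta>: "conic_arcs X \<delta> I \<gamma>" "conic_arcs (X \<inter> A) \<delta> I \<gamma>"
    using conic_arcs_restrict[OF X A] by blast
  have "strict_boundary (X \<inter> A) = strict_boundary X"
    by (rule pair_set_eqI) (simp add: strict_boundary_conic[OF \<delta>(1)] strict_boundary_conic[OF \<delta>(2)])
  moreover have "rel_mult (X \<inter> A) p = rel_mult X p" if p: "p \<in> strict_boundary X" for p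
  proof -
    have "p = (fst p, 0)" using p by (auto simp: strict_boundary_def)
    then show ?thesis using rel_mult_conic[OF \<delta>(1), of "fst p"] rel_mult_conic[OF \<delta>(2), of "fst p"] by metis
  qed
  ultimately show ?thesis by blast
qed

text \<open>The homeomorphism of the strict transforms preserves the boundary, since the radius of the image
  of \<open>p\<close> is the norm of \<open>\<phi> (blow p)\<close> and \<open>\<phi>\<close> vanishes at the origin only. Therefore it maps the
  complement of the boundary onto the complement of the boundary and preserves the number of
  components of its germ at each boundary point.\<close>

lemma blow_homeomorphic_imp_matchable:
  assumes X: "conic_arcs X \<epsilon> I \<gamma>" and Y: "conic_arcs Y \<epsilon>' J \<kappa>" and bs: "blow_spherical_homeomorphic X Y"
  shows "matchable (strict_boundary X) (rel_mult X) (strict_boundary Y) (rel_mult Y)"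
proof -
  obtain A B \<phi> where A: "0 \<in> interior A" "closed (X \<inter> A)" and B: "0 \<in> interior B" "closed (Y \<inter> B)"
    and \<phi>: "blow_spherical_homeomorphism (X \<inter> A) (Y \<inter> B) \<phi>"
    using bs unfolding blow_spherical_homeomorphic_def by blast
  let ?X = "X \<inter> A" and ?Y = "Y \<inter> B"
  obtain h k where \<phi>0: "continuous_on ?X \<phi>" "\<phi> ` ?X \<subseteq> ?Y" "\<phi> 0 = 0" "0 \<notin> \<phi> ` (?X - {0})"
    and h: "homeomorphism (strict_transform ?X) (strict_transform ?Y) h k"
    and hp: "\<forall>p \<in> strict_transform ?X - strict_boundary ?X. h p = blow_inv (\<phi> (blow p))"
    using \<phi> unfolding blow_spherical_homeomorphism_def by blast
  have ch: "continuous_on (strict_transform ?X) h" and hT: "h ` strict_transform ?X = strict_transform ?Y"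
    and kh: "\<And>p. p \<in> strict_transform ?X \<Longrightarrow> k (h p) = p"
    using h by (auto simp: homeomorphism_def)
  note TX = strict_transform_closed[OF A(2)] and TY = strict_transform_closed[OF B(2)]
  \<comment> \<open>The radius of the image is determined on the dense part away from the boundary, hence everywhere.\<close>
  have radius: "snd (h p) = norm (\<phi> (blow p))" if p: "p \<in> strict_transform ?X" for p
  proof -
    have "continuous_on (strict_transform ?X) (\<lambda>p. \<phi> (blow p))"
      by (rule continuous_on_compose2[OF \<phi>0(1)]) (use TX(3) in \<open>auto simp: blow_def intro!: continuous_intros\<close>)
    then have "continuous_on (closure (blow_preimage ?X)) (\<lambda>p. snd (h p) - norm (\<phi> (blow p)))"
      using ch unfolding strict_transform_def by (intro continuous_intros)
    moreover have "snd (h q) - norm (\<phi> (blow q)) = 0" if q: "q \<in> blow_preimage ?X" for q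
    proof -
      have "q \<in> strict_transform ?X" using q closure_subset unfolding strict_transform_def by blast
      then have "q \<in> strict_transform ?X - strict_boundary ?X" using TX(4,5) q by blast
      then show ?thesis using hp by (simp add: blow_inv_def)
    qed
    ultimately have "snd (h p) - norm (\<phi> (blow p)) = 0"
      using p unfolding strict_transform_def
      by (rule continuous_constant_on_closure[where f = "\<lambda>p. snd (h p) - norm (\<phi> (blow p))"])
    then show ?thesis by simp
  qed
  have zero: "snd (h p) = 0 \<longleftrightarrow> snd p = 0" if p: "p \<in> strict_transform ?X" for p
  proof -
    have "snd (h p) = 0 \<longleftrightarrow> \<phi> (blow p) = 0" using radius[OF p] by simp
    also have "\<dots> \<longleftrightarrow> blow p = 0" using TX(3)[OF p] \<phi>0(3,4) by force
    also have "\<dots> \<longleftrightarrow> snd p = 0" using TX(1)[OF p] by (auto simp: blow_def)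
    finally show ?thesis .
  qed
  have hTin: "h p \<in> strict_transform ?Y" if "p \<in> strict_transform ?X" for p using hT that by blast
  have sbX: "strict_boundary ?X = {p \<in> strict_transform ?X. snd p = 0}"
    using TX(4) by (auto simp: strict_boundary_def)
  have sbY: "strict_boundary ?Y = {p \<in> strict_transform ?Y. snd p = 0}"
    using TY(4) by (auto simp: strict_boundary_def)
  have bpX: "blow_preimage ?X = {p \<in> strict_transform ?X. snd p \<noteq> 0}"
    using TX(5) closure_subset[of "blow_preimage ?X"] unfolding strict_transform_def by blast
  have bpY: "blow_preimage ?Y = {p \<in> strict_transform ?Y. snd p \<noteq> 0}"
    using TY(5) closure_subset[of "blow_preimage ?Y"] unfolding strict_transform_def by blast
  have img: "h ` {p \<in> strict_transform ?X. P (snd p = 0)} = {p \<in> strict_transform ?Y. P (snd p = 0)}" for P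
  proof -
    have "h ` {p \<in> strict_transform ?X. P (snd p = 0)} = h ` {p \<in> strict_transform ?X. P (snd (h p) = 0)}"
      using zero by (intro arg_cong[of _ _ "image h"]) auto
    also have "\<dots> = {p \<in> h ` strict_transform ?X. P (snd p = 0)}" by blast
    finally show ?thesis unfolding hT .
  qed
  have hsb: "h ` strict_boundary ?X = strict_boundary ?Y" unfolding sbX sbY by (rule img[of "\<lambda>b. b"])
  have hbp: "h ` blow_preimage ?X = blow_preimage ?Y" unfolding bpX bpY by (rule img[of Not])
  have "bij_betw h (strict_boundary ?X) (strict_boundary ?Y)"
    unfolding bij_betw_def hsb using kh sbX by (auto intro!: inj_on_inverseI[of _ k])
  moreover have "rel_mult ?X p = rel_mult ?Y (h p)" if p: "p \<in> strict_boundary ?X" for p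
    unfolding rel_mult_def using card_germ_components_homeomorphism[OF h, of "blow_preimage ?X" p] p bpX hbp sbX by auto
  ultimately have "matchable (strict_boundary ?X) (rel_mult ?X) (strict_boundary ?Y) (rel_mult ?Y)"
    unfolding matchable_def by blast
  then show ?thesis
    by (rule matchable_pullback[where f = "\<lambda>p. p" and g = "\<lambda>p. p"])
       (use rel_mult_restrict[OF X A(1)] rel_mult_restrict[OF Y B(1)] in \<open>auto simp: bij_betw_def\<close>)
qed

text \<open>Bijections between corresponding fibres combine to one between the total spaces.\<close>

lemma fibrewise_bijection:
  assumes "finite I" "finite J" and \<tau>: "bij_betw \<tau> (p ` I) (q ` J)"
    and card: "\<forall>v\<in>p ` I. card {i\<in>I. p i = v} = card {j\<in>J. q j = \<tau> v}"
  obtains \<pi> where "bij_betw \<pi> I J" "\<And>i. i \<in> I \<Longrightarrow> q (\<pi> i) = \<tau> (p i)"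
proof -
  have "\<forall>v\<in>p ` I. \<exists>f. bij_betw f {i\<in>I. p i = v} {j\<in>J. q j = \<tau> v}"
    using assms card by (intro ballI finite_same_card_bij) auto
  from bchoice[OF this] obtain f where f: "\<And>v. v \<in> p ` I \<Longrightarrow> bij_betw (f v) {i\<in>I. p i = v} {j\<in>J. q j = \<tau> v}" by blast
  define \<pi> where "\<pi> = (\<lambda>i. f (p i) i)"
  have \<pi>: "\<pi> i \<in> J" "q (\<pi> i) = \<tau> (p i)" if i: "i \<in> I" for i
    using bij_betwE[OF f[of "p i"]] i by (auto simp: \<pi>_def)
  have "bij_betw \<pi> I J"
    unfolding bij_betw_def
  proof (intro conjI equalityI subsetI)
    show "inj_on \<pi> I"
    proof (rule inj_onI)
      fix i k assume ik: "i \<in> I" "k \<in> I" "\<pi> i = \<pi> k"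
      then have "\<tau> (p i) = \<tau> (p k)" using \<pi>(2) by metis
      then have "p i = p k" using bij_betw_imp_inj_on[OF \<tau>] ik by (auto dest: inj_onD)
      then show "i = k" using bij_betw_imp_inj_on[OF f[of "p i"]] ik by (auto simp: \<pi>_def dest: inj_onD)
    qed
  next
    fix j assume "j \<in> \<pi> ` I" then show "j \<in> J" using \<pi>(1) by blast
  next
    fix j assume j: "j \<in> J"
    then obtain v where v: "v \<in> p ` I" "q j = \<tau> v" using bij_betw_imp_surj_on[OF \<tau>] by blast
    then have "j \<in> f v ` {i\<in>I. p i = v}" using bij_betw_imp_surj_on[OF f[OF v(1)]] j by blast
    then show "j \<in> \<pi> ` I" by (auto simp: \<pi>_def)
  qed
  then show thesis using that \<pi>(2) by blast
qed

lemma conic_arcs_cball: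
  assumes X: "conic_arcs X \<epsilon> I \<gamma>" and "0 \<in> X"
  shows "X \<inter> cball 0 \<epsilon> = insert 0 (\<Union>i\<in>I. (\<lambda>r. r *\<^sub>R \<gamma> i r) ` {0..\<epsilon>})"
proof -
  note D = conic_arcsD[OF X]
  have "insert 0 ((\<lambda>r. r *\<^sub>R \<gamma> i r) ` {0..\<epsilon>}) = insert 0 ((\<lambda>r. r *\<^sub>R \<gamma> i r) ` {0<..\<epsilon>})" for i
  proof -
    have "{0..\<epsilon>} = insert 0 {0<..\<epsilon>}" using D(1) by auto
    then show ?thesis by simp
  qed
  then have "insert 0 (\<Union>i\<in>I. (\<lambda>r. r *\<^sub>R \<gamma> i r) ` {0..\<epsilon>}) = insert 0 (\<Union>i\<in>I. (\<lambda>r. r *\<^sub>R \<gamma> i r) ` {0<..\<epsilon>})" by blast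
  also have "\<dots> = insert 0 (X \<inter> cball 0 \<epsilon> - {0})" unfolding D(6) ..
  also have "\<dots> = X \<inter> cball 0 \<epsilon>" using assms(2) D(1) by auto
  finally show ?thesis ..
qed

lemma strict_transform_conic_cball:
  assumes X: "conic_arcs X \<epsilon> I \<gamma>"
  shows "strict_transform (X \<inter> cball 0 \<epsilon>) = (\<Union>i\<in>I. lift_arc (\<gamma> i) {0..\<epsilon>})"
proof -
  note D = conic_arcsD[OF X]
  let ?X = "X \<inter> cball 0 \<epsilon>"
  have X': "conic_arcs ?X \<epsilon> I \<gamma>" by (rule conic_arcs_cong[OF X]) auto
  have bound: "r \<le> \<epsilon>" if "(q, r) \<in> blow_preimage ?X" for q r
    using that by (auto simp: blow_preimage_def blow_def)
  have bp: "blow_preimage ?X = (\<Union>i\<in>I. lift_arc (\<gamma> i) {0<..\<epsilon>})"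
  proof (rule pair_set_eqI)
    fix q r
    show "(q, r) \<in> blow_preimage ?X \<longleftrightarrow> (q, r) \<in> (\<Union>i\<in>I. lift_arc (\<gamma> i) {0<..\<epsilon>})"
    proof (cases "r \<le> \<epsilon>")
      case True
      then show ?thesis using blow_preimage_conic[OF X' True] by auto
    next
      case False
      then show ?thesis using bound[of q r] by auto
    qed
  qed
  show ?thesis unfolding strict_transform_def bp
  proof
    have "closed (\<Union>i\<in>I. lift_arc (\<gamma> i) {0..\<epsilon>})"
      using D(2,3) by (intro closed_UN ballI compact_imp_closed compact_lift_arc) auto
    then show "closure (\<Union>i\<in>I. lift_arc (\<gamma> i) {0<..\<epsilon>}) \<subseteq> (\<Union>i\<in>I. lift_arc (\<gamma> i) {0..\<epsilon>})"
      by (intro closure_minimal UN_mono) (auto simp: lift_arc_def)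
    have "lift_arc (\<gamma> i) {0..\<epsilon>} \<subseteq> closure (\<Union>i\<in>I. lift_arc (\<gamma> i) {0<..\<epsilon>})" if i: "i \<in> I" for i
    proof -
      have "(\<lambda>r. (\<gamma> i r, r)) ` closure {0<..\<epsilon>} \<subseteq> closure (\<Union>i\<in>I. lift_arc (\<gamma> i) {0<..\<epsilon>})"
      proof (rule image_closure_subset)
        show "continuous_on (closure {0<..\<epsilon>}) (\<lambda>r. (\<gamma> i r, r))"
          using D(1) D(3)[OF i] by (auto intro!: continuous_intros)
        have "(\<lambda>r. (\<gamma> i r, r)) ` {0<..\<epsilon>} \<subseteq> (\<Union>i\<in>I. lift_arc (\<gamma> i) {0<..\<epsilon>})"
          unfolding lift_arc_def using i by blast
        then show "(\<lambda>r. (\<gamma> i r, r)) ` {0<..\<epsilon>} \<subseteq> closure (\<Union>i\<in>I. lift_arc (\<gamma> i) {0<..\<epsilon>})"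
          using closure_subset by (rule order_trans)
      qed auto
      then show ?thesis using D(1) by (simp add: lift_arc_def)
    qed
    then show "(\<Union>i\<in>I. lift_arc (\<gamma> i) {0..\<epsilon>}) \<subseteq> closure (\<Union>i\<in>I. lift_arc (\<gamma> i) {0<..\<epsilon>})" by blast
  qed
qed

text \<open>Each point of an arc is sent to the point of the matched arc at the same distance from the origin.
  On the strict transforms this is well defined and injective at the end points because arcs have
  a common direction exactly if their images do; a continuous bijection of compact sets is a
  homeomorphism.\<close>

lemma matched_arcs_imp_blow_homeomorphic:
  assumes X: "conic_arcs X \<epsilon> I \<gamma>" and Y: "conic_arcs Y \<epsilon> J \<kappa>" and zero: "0 \<in> X" "0 \<in> Y"
    and \<pi>: "bij_betw \<pi> I J"
    and dirs: "\<And>i k. i \<in> I \<Longrightarrow> k \<in> I \<Longrightarrow> \<gamma> i 0 = \<gamma> k 0 \<longleftrightarrow> \<kappa> (\<pi> i) 0 = \<kappa> (\<pi> k) 0"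
  shows "blow_spherical_homeomorphic X Y"
proof -
  note DX = conic_arcsD[OF X] and DY = conic_arcsD[OF Y]
  let ?X = "X \<inter> cball 0 \<epsilon>" and ?Y = "Y \<inter> cball 0 \<epsilon>"
  have \<pi>J: "\<pi> i \<in> J" if "i \<in> I" for i using bij_betwE[OF \<pi>] that by blast
  define \<iota> where "\<iota> = (\<lambda>p. SOME i. i \<in> I \<and> fst p = \<gamma> i (snd p))"
  define h where "h = (\<lambda>p. (\<kappa> (\<pi> (\<iota> p)) (snd p), snd p))"
  \<comment> \<open>The index chosen by \<open>\<iota>\<close> is ambiguous only over the origin, and there all choices have the same image.\<close>
  have h: "h (\<gamma> i r, r) = (\<kappa> (\<pi> i) r, r)" if i: "i \<in> I" and r: "0 \<le> r" "r \<le> \<epsilon>" for i r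
  proof -
    have "\<iota> (\<gamma> i r, r) \<in> I \<and> \<gamma> i r = \<gamma> (\<iota> (\<gamma> i r, r)) r"
      unfolding \<iota>_def using someI[of "\<lambda>k. k \<in> I \<and> fst (\<gamma> i r, r) = \<gamma> k (snd (\<gamma> i r, r))" i] i by simp
    then obtain k where k: "\<iota> (\<gamma> i r, r) = k" "k \<in> I" "\<gamma> i r = \<gamma> k r" by blast
    have "\<kappa> (\<pi> k) r = \<kappa> (\<pi> i) r"
    proof (cases "r = 0")
      case True
      then show ?thesis using dirs[OF i k(2)] k(3) by simp
    next
      case False
      then show ?thesis using DX(5)[OF i k(2) _ r(2) k(3)] r by simp
    qed
    then show ?thesis by (simp add: h_def k(1))
  qed
  have TX: "strict_transform ?X = (\<Union>i\<in>I. lift_arc (\<gamma> i) {0..\<epsilon>})" by (rule strict_transform_conic_cball[OF X])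
  have TY: "strict_transform ?Y = (\<Union>j\<in>J. lift_arc (\<kappa> j) {0..\<epsilon>})" by (rule strict_transform_conic_cball[OF Y])
  have closed_arc: "closed (lift_arc (\<gamma> i) {0..\<epsilon>})" if "i \<in> I" for i
    using DX(3)[OF that] by (intro compact_imp_closed compact_lift_arc) auto
  have h_on: "continuous_on (lift_arc (\<gamma> i) {0..\<epsilon>}) h" if i: "i \<in> I" for i
  proof -
    have "continuous_on (lift_arc (\<gamma> i) {0..\<epsilon>}) (\<lambda>p. (\<kappa> (\<pi> i) (snd p), snd p))"
      by (intro continuous_intros continuous_on_compose2[OF DY(3)[OF \<pi>J[OF i]]]) (auto simp: lift_arc_def)
    then show ?thesis
      by (rule continuous_on_eq) (use h[OF i] in \<open>auto simp: lift_arc_def\<close>)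
  qed
  have ch: "continuous_on (strict_transform ?X) h"
    unfolding TX using DX(2) closed_arc h_on by (intro continuous_on_closed_Union) auto
  have "compact (strict_transform ?X)"
    unfolding TX using DX(2,3) by (intro compact_UN compact_lift_arc) auto
  moreover have "h ` strict_transform ?X = strict_transform ?Y"
  proof -
    have "h ` lift_arc (\<gamma> i) {0..\<epsilon>} = lift_arc (\<kappa> (\<pi> i)) {0..\<epsilon>}" if i: "i \<in> I" for i
      unfolding lift_arc_def image_image using h[OF i] by (intro image_cong) auto
    then have "h ` strict_transform ?X = (\<Union>i\<in>I. lift_arc (\<kappa> (\<pi> i)) {0..\<epsilon>})"
      unfolding TX image_UN by (intro SUP_cong) auto
    also have "\<dots> = strict_transform ?Y"
      unfolding TY bij_betw_imp_surj_on[OF \<pi>, symmetric] by (simp add: image_image)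
    finally show ?thesis .
  qed
  moreover have "inj_on h (strict_transform ?X)"
  proof (rule inj_onI)
    fix p p' assume "p \<in> strict_transform ?X" "p' \<in> strict_transform ?X" and eq: "h p = h p'"
    then obtain i r k r' where p: "i \<in> I" "0 \<le> r" "r \<le> \<epsilon>" "p = (\<gamma> i r, r)"
      and p': "k \<in> I" "0 \<le> r'" "r' \<le> \<epsilon>" "p' = (\<gamma> k r', r')"
      unfolding TX lift_arc_def by auto
    have e: "r = r'" "\<kappa> (\<pi> i) r = \<kappa> (\<pi> k) r" using eq h p p' by auto
    show "p = p'"
    proof (cases "r = 0")
      case True
      then show ?thesis using dirs[OF p(1) p'(1)] e p p' by simp
    next
      case False
      then have "\<pi> i = \<pi> k" using DY(5)[OF \<pi>J[OF p(1)] \<pi>J[OF p'(1)] _ p(3) e(2)] p(2) by simp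
      then have "i = k" using bij_betw_imp_inj_on[OF \<pi>] p(1) p'(1) by (auto dest: inj_onD)
      then show ?thesis using e p p' by simp
    qed
  qed
  ultimately obtain k where hk: "homeomorphism (strict_transform ?X) (strict_transform ?Y) h k"
    using homeomorphism_compact ch by blast
  define \<phi> where "\<phi> = (\<lambda>x. if x = 0 then 0 else blow (h (blow_inv x)))"
  have nX: "norm (\<gamma> i r) = 1" if "i \<in> I" "0 \<le> r" "r \<le> \<epsilon>" for i r using DX(4) that by blast
  have nY: "norm (\<kappa> (\<pi> i) r) = 1" if "i \<in> I" "0 \<le> r" "r \<le> \<epsilon>" for i r using DY(4) \<pi>J that by blast
  have inv: "blow_inv (r *\<^sub>R q) = (q, r)" if "norm q = 1" "0 < r" for q :: "'z::euclidean_space" and r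
    using that by (simp add: blow_inv_def)
  have \<phi>: "\<phi> (r *\<^sub>R \<gamma> i r) = r *\<^sub>R \<kappa> (\<pi> i) r" if i: "i \<in> I" and r: "0 \<le> r" "r \<le> \<epsilon>" for i r
  proof (cases "r = 0")
    case True
    then show ?thesis by (simp add: \<phi>_def)
  next
    case False
    have "\<gamma> i r \<noteq> 0" using nX[OF i r] by auto
    then show ?thesis using False h[OF i r] inv[OF nX[OF i r]] r by (simp add: \<phi>_def blow_def)
  qed
  have setX: "?X = insert 0 (\<Union>i\<in>I. (\<lambda>r. r *\<^sub>R \<gamma> i r) ` {0..\<epsilon>})" by (rule conic_arcs_cball[OF X zero(1)])
  have setY: "?Y = insert 0 (\<Union>j\<in>J. (\<lambda>r. r *\<^sub>R \<kappa> j r) ` {0..\<epsilon>})" by (rule conic_arcs_cball[OF Y zero(2)])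
  have closedX: "closed ((\<lambda>r. r *\<^sub>R \<gamma> i r) ` {0..\<epsilon>})" if "i \<in> I" for i
    using DX(3)[OF that] by (intro compact_imp_closed compact_continuous_image continuous_intros) auto
  have closedY: "closed ((\<lambda>r. r *\<^sub>R \<kappa> j r) ` {0..\<epsilon>})" if "j \<in> J" for j
    using DY(3)[OF that] by (intro compact_imp_closed compact_continuous_image continuous_intros) auto
  have clX: "closed ?X" unfolding setX using closedX DX(2) by (intro closed_insert closed_UN) auto
  have clY: "closed ?Y" unfolding setY using closedY DY(2) by (intro closed_insert closed_UN) auto
  have "continuous_on ({0} \<union> (\<Union>i\<in>I. (\<lambda>r. r *\<^sub>R \<gamma> i r) ` {0..\<epsilon>})) \<phi>"
  proof (intro continuous_on_closed_Un continuous_on_closed_Union)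
    fix i assume i: "i \<in> I"
    have "continuous_on ((\<lambda>r. r *\<^sub>R \<gamma> i r) ` {0..\<epsilon>}) (\<lambda>x. norm x *\<^sub>R \<kappa> (\<pi> i) (norm x))"
      using nX[OF i] by (intro continuous_intros continuous_on_compose2[OF DY(3)[OF \<pi>J[OF i]]]) auto
    then show "continuous_on ((\<lambda>r. r *\<^sub>R \<gamma> i r) ` {0..\<epsilon>}) \<phi>"
      by (rule continuous_on_eq) (use \<phi>[OF i] nX[OF i] in auto)
    show "closed ((\<lambda>r. r *\<^sub>R \<gamma> i r) ` {0..\<epsilon>})" by (rule closedX[OF i])
  next
    show "closed (\<Union>i\<in>I. (\<lambda>r. r *\<^sub>R \<gamma> i r) ` {0..\<epsilon>})" using closedX DX(2) by (intro closed_UN) auto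
  qed (use DX(2) in auto)
  then have cont: "continuous_on ?X \<phi>" unfolding setX by simp
  have "\<phi> x \<in> ?Y \<and> norm (\<phi> x) = norm x" if x: "x \<in> ?X" for x
  proof (cases "x = 0")
    case True
    then show ?thesis unfolding setY by (simp add: \<phi>_def)
  next
    case False
    then obtain i r where i: "i \<in> I" "0 \<le> r" "r \<le> \<epsilon>" "x = r *\<^sub>R \<gamma> i r" using x unfolding setX by auto
    have "\<phi> x = (\<lambda>r. r *\<^sub>R \<kappa> (\<pi> i) r) r" "r \<in> {0..\<epsilon>}" using \<phi> i by auto
    then have "\<phi> x \<in> ?Y" unfolding setY using \<pi>J[OF i(1)] by blast
    moreover have "norm (\<phi> x) = norm x" using \<phi> i nX nY by simp
    ultimately show ?thesis by blast
  qed
  then have maps: "\<phi> ` ?X \<subseteq> ?Y" "0 \<notin> \<phi> ` (?X - {0})" by (force, force)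
  have X': "conic_arcs ?X \<epsilon> I \<gamma>" by (rule conic_arcs_cong[OF X]) auto
  have "h p = blow_inv (\<phi> (blow p))" if p: "p \<in> strict_transform ?X - strict_boundary ?X" for p
  proof -
    obtain i r where i: "i \<in> I" "0 \<le> r" "r \<le> \<epsilon>" "p = (\<gamma> i r, r)" using p unfolding TX lift_arc_def by auto
    then have "r \<noteq> 0" using p strict_boundary_conic[OF X'] by auto
    then show ?thesis using h i \<phi> inv[OF nY[OF i(1-3)]] by (simp add: blow_def)
  qed
  then have "blow_spherical_homeomorphism ?X ?Y \<phi>"
    unfolding blow_spherical_homeomorphism_def using cont maps hk by (auto simp: \<phi>_def)
  moreover have "0 \<in> interior (cball (0::'a) \<epsilon>)" "0 \<in> interior (cball (0::'c) \<epsilon>)" using DX(1) by simp_all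
  ultimately show ?thesis
    unfolding blow_spherical_homeomorphic_def using clX clY by blast
qed

lemma matchable_imp_blow_homeomorphic:
  assumes X: "conic_arcs X \<epsilon> I \<gamma>" and Y: "conic_arcs Y \<epsilon>' J \<kappa>" and zero: "0 \<in> X" "0 \<in> Y"
    and M: "matchable (strict_boundary X) (rel_mult X) (strict_boundary Y) (rel_mult Y)"
  shows "blow_spherical_homeomorphic X Y"
proof -
  define \<delta> where "\<delta> = min \<epsilon> \<epsilon>'"
  have \<delta>: "0 < \<delta>" "\<delta> \<le> \<epsilon>" "\<delta> \<le> \<epsilon>'" using conic_arcsD(1)[OF X] conic_arcsD(1)[OF Y] by (auto simp: \<delta>_def)
  have X': "conic_arcs X \<delta> I \<gamma>" and Y': "conic_arcs Y \<delta> J \<kappa>"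
    using conic_arcs_mono[OF X \<delta>(1,2)] conic_arcs_mono[OF Y \<delta>(1,3)] .
  let ?p = "\<lambda>i. (\<gamma> i 0, 0 :: real)" and ?q = "\<lambda>j. (\<kappa> j 0, 0 :: real)"
  have bX: "strict_boundary X = ?p ` I" by (rule pair_set_eqI) (auto simp: strict_boundary_conic[OF X])
  have bY: "strict_boundary Y = ?q ` J" by (rule pair_set_eqI) (auto simp: strict_boundary_conic[OF Y])
  obtain \<tau> where \<tau>: "bij_betw \<tau> (?p ` I) (?q ` J)" "\<forall>v\<in>?p ` I. rel_mult X v = rel_mult Y (\<tau> v)"
    using M unfolding matchable_def bX bY by blast
  have "card {i\<in>I. ?p i = v} = card {j\<in>J. ?q j = \<tau> v}" if v: "v \<in> ?p ` I" for v
  proof -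
    obtain w where w: "\<tau> v = (w, 0)" using bij_betwE[OF \<tau>(1)] v by blast
    obtain u where u: "v = (u, 0)" using v by blast
    have "rel_mult X (u, 0) = rel_mult Y (w, 0)" using \<tau>(2) v u w by metis
    then show ?thesis unfolding rel_mult_conic[OF X] rel_mult_conic[OF Y] using u w by simp
  qed
  then have cards: "\<forall>v\<in>?p ` I. card {i\<in>I. ?p i = v} = card {j\<in>J. ?q j = \<tau> v}" by blast
  obtain \<pi> where \<pi>: "bij_betw \<pi> I J" "\<And>i. i \<in> I \<Longrightarrow> ?q (\<pi> i) = \<tau> (?p i)"
    by (rule fibrewise_bijection[OF conic_arcsD(2)[OF X] conic_arcsD(2)[OF Y] \<tau>(1) cards]) (rule that)
  have "\<gamma> i 0 = \<gamma> k 0 \<longleftrightarrow> \<kappa> (\<pi> i) 0 = \<kappa> (\<pi> k) 0" if ik: "i \<in> I" "k \<in> I" for i k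
  proof -
    have "\<gamma> i 0 = \<gamma> k 0 \<longleftrightarrow> ?p i = ?p k" by simp
    also have "\<dots> \<longleftrightarrow> \<tau> (?p i) = \<tau> (?p k)" using bij_betw_imp_inj_on[OF \<tau>(1)] ik by (auto dest!: inj_onD)
    also have "\<dots> \<longleftrightarrow> \<kappa> (\<pi> i) 0 = \<kappa> (\<pi> k) 0" using \<pi>(2)[OF ik(1)] \<pi>(2)[OF ik(2)] by (metis Pair_inject)
    finally show ?thesis .
  qed
  then show ?thesis using matched_arcs_imp_blow_homeomorphic[OF X' Y' zero \<pi>(1)] by blast
qed

section \<open>The tree and the equivalence\<close>

lemma bs_tree_edges_Root:
  "{Root, v} \<in> edges (bs_tree X) \<longleftrightarrow> (\<exists>l\<in>tangent_half_lines X. v = Half_Line l)"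
  by (auto simp: bs_tree_def doubleton_eq_iff)

lemma bs_tree_edges_Half_Line:
  "{Half_Line l, v} \<in> edges (bs_tree X) \<longleftrightarrow>
     l \<in> tangent_half_lines X \<and> (v = Root \<or> (\<exists>c\<in>half_branches_tangent X l. v = Half_Branch l c))"
  by (auto simp: bs_tree_def doubleton_eq_iff)

lemma bs_tree_edges_Half_Branch:
  "{Half_Branch l c, v} \<in> edges (bs_tree X) \<longleftrightarrow>
     l \<in> tangent_half_lines X \<and> c \<in> half_branches_tangent X l \<and> v = Half_Line l"
  by (auto simp: bs_tree_def doubleton_eq_iff)

lemma bs_tree_no_loop: "{Root} \<notin> edges (bs_tree X)"
  using bs_tree_edges_Root[of Root X] by simp

lemma verts_bs_tree:
  "v \<in> verts (bs_tree X) \<longleftrightarrow> v = Root \<or> (\<exists>l\<in>tangent_half_lines X. v = Half_Line l \<or>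
     (\<exists>c\<in>half_branches_tangent X l. v = Half_Branch l c))"
  by (auto simp: bs_tree_def)

lemma root_bs_tree [simp]: "root (bs_tree X) = Root"
  by (simp add: bs_tree_def)

text \<open>The half-lines are the neighbours of the root, and the half-branches tangent to a half-line are
  its neighbours other than the root; both are preserved by an isomorphism that fixes the root.\<close>

lemma rooted_isomorphic_imp_matchable:
  assumes "rooted_isomorphic (bs_tree X) (bs_tree Y)"
  shows "matchable (tangent_half_lines X) (\<lambda>l. card (half_branches_tangent X l))
           (tangent_half_lines Y) (\<lambda>l. card (half_branches_tangent Y l))"
proof -
  obtain f where f: "bij_betw f (verts (bs_tree X)) (verts (bs_tree Y))" "f Root = Root"
    and adj: "\<And>u v. u \<in> verts (bs_tree X) \<Longrightarrow> v \<in> verts (bs_tree X) \<Longrightarrow>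
        {u, v} \<in> edges (bs_tree X) \<longleftrightarrow> {f u, f v} \<in> edges (bs_tree Y)"
    using assms unfolding rooted_isomorphic_def by auto
  have inj: "u = v" if "f u = f v" "u \<in> verts (bs_tree X)" "v \<in> verts (bs_tree X)" for u v
    using bij_betw_imp_inj_on[OF f(1)] that by (auto dest: inj_onD)
  have surj: "\<exists>u\<in>verts (bs_tree X). w = f u" if "w \<in> verts (bs_tree Y)" for w
    using bij_betw_imp_surj_on[OF f(1)] that by blast
  have rootX: "Root \<in> verts (bs_tree X)" by (simp add: verts_bs_tree)
  have lineX: "Half_Line l \<in> verts (bs_tree X)" if "l \<in> tangent_half_lines X" for l
    using that by (auto simp: verts_bs_tree)
  define \<tau> where "\<tau> = (\<lambda>l. SOME l'. l' \<in> tangent_half_lines Y \<and> f (Half_Line l) = Half_Line l')"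
  have \<tau>: "\<tau> l \<in> tangent_half_lines Y" "f (Half_Line l) = Half_Line (\<tau> l)" if l: "l \<in> tangent_half_lines X" for l
  proof -
    have "{Root, f (Half_Line l)} \<in> edges (bs_tree Y)"
      using adj[OF rootX lineX[OF l]] l f(2) by (simp add: bs_tree_edges_Root)
    then have "\<exists>l'. l' \<in> tangent_half_lines Y \<and> f (Half_Line l) = Half_Line l'" by (auto simp: bs_tree_edges_Root)
    from someI_ex[OF this] show "\<tau> l \<in> tangent_half_lines Y" "f (Half_Line l) = Half_Line (\<tau> l)"
      unfolding \<tau>_def by blast+
  qed
  have "bij_betw \<tau> (tangent_half_lines X) (tangent_half_lines Y)"
    unfolding bij_betw_def
  proof (intro conjI equalityI subsetI)
    show "inj_on \<tau> (tangent_half_lines X)"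
    proof (rule inj_onI)
      fix l m assume lm: "l \<in> tangent_half_lines X" "m \<in> tangent_half_lines X" "\<tau> l = \<tau> m"
      then have "f (Half_Line l) = f (Half_Line m)" using \<tau>(2) by simp
      from inj[OF this] lm show "l = m" using lineX by blast
    qed
  next
    fix l assume "l \<in> \<tau> ` tangent_half_lines X" then show "l \<in> tangent_half_lines Y" using \<tau>(1) by blast
  next
    fix l' assume l': "l' \<in> tangent_half_lines Y"
    then have "Half_Line l' \<in> verts (bs_tree Y)" by (auto simp: verts_bs_tree)
    then obtain u where u: "u \<in> verts (bs_tree X)" "Half_Line l' = f u" using surj by blast
    have "{f Root, f u} \<in> edges (bs_tree Y)" using l' f(2) by (simp add: bs_tree_edges_Root flip: u(2))
    then have "{Root, u} \<in> edges (bs_tree X)" using adj[OF rootX u(1)] by simp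
    then obtain l where l: "l \<in> tangent_half_lines X" "u = Half_Line l" by (auto simp: bs_tree_edges_Root)
    then have "l' = \<tau> l" using \<tau>(2)[OF l(1)] u(2) by simp
    then show "l' \<in> \<tau> ` tangent_half_lines X" using l(1) by blast
  qed
  moreover have "card (half_branches_tangent X l) = card (half_branches_tangent Y (\<tau> l))"
    if l: "l \<in> tangent_half_lines X" for l
  proof -
    let ?N = "Half_Branch l ` half_branches_tangent X l" and ?M = "Half_Branch (\<tau> l) ` half_branches_tangent Y (\<tau> l)"
    have NX: "v \<in> ?N \<longleftrightarrow> {Half_Line l, v} \<in> edges (bs_tree X) \<and> v \<noteq> Root" for v
      using l by (auto simp: bs_tree_edges_Half_Line)
    have NY: "v \<in> ?M \<longleftrightarrow> {Half_Line (\<tau> l), v} \<in> edges (bs_tree Y) \<and> v \<noteq> Root" for v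
      using \<tau>(1)[OF l] by (auto simp: bs_tree_edges_Half_Line)
    have vX: "v \<in> verts (bs_tree X)" if "v \<in> ?N" for v using that l by (auto simp: verts_bs_tree)
    have vY: "v \<in> verts (bs_tree Y)" if "v \<in> ?M" for v using that \<tau>(1)[OF l] by (auto simp: verts_bs_tree)
    have key: "u \<in> ?N \<longleftrightarrow> f u \<in> ?M" if u: "u \<in> verts (bs_tree X)" for u
    proof -
      have "u \<noteq> Root \<longleftrightarrow> f u \<noteq> Root" using inj[of u Root] u rootX f(2) by auto
      then show ?thesis unfolding NX NY using adj[OF lineX[OF l] u] \<tau>(2)[OF l] by simp
    qed
    have "bij_betw f ?N ?M"
      unfolding bij_betw_def
    proof (intro conjI equalityI subsetI)
      show "inj_on f ?N" using inj vX by (intro inj_onI) blast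
    next
      fix w assume "w \<in> f ` ?N" then show "w \<in> ?M" using key vX by blast
    next
      fix w assume w: "w \<in> ?M"
      then obtain u where "u \<in> verts (bs_tree X)" "w = f u" using surj vY by blast
      then show "w \<in> f ` ?N" using key w by blast
    qed
    then have "card ?N = card ?M" by (rule bij_betw_same_card)
    then show ?thesis by (simp add: card_image inj_on_def)
  qed
  ultimately show ?thesis unfolding matchable_def by blast
qed

lemma matchable_imp_rooted_isomorphic:
  assumes M: "matchable (tangent_half_lines X) (\<lambda>l. card (half_branches_tangent X l))
           (tangent_half_lines Y) (\<lambda>l. card (half_branches_tangent Y l))"
    and fin: "\<And>l. l \<in> tangent_half_lines X \<Longrightarrow> finite (half_branches_tangent X l)"
      "\<And>l. l \<in> tangent_half_lines Y \<Longrightarrow> finite (half_branches_tangent Y l)"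
  shows "rooted_isomorphic (bs_tree X) (bs_tree Y)"
proof -
  obtain \<tau> where \<tau>: "bij_betw \<tau> (tangent_half_lines X) (tangent_half_lines Y)"
    "\<forall>l\<in>tangent_half_lines X. card (half_branches_tangent X l) = card (half_branches_tangent Y (\<tau> l))"
    using M by (auto simp: matchable_def)
  have \<tau>Y: "\<tau> l \<in> tangent_half_lines Y" if "l \<in> tangent_half_lines X" for l using bij_betwE[OF \<tau>(1)] that by blast
  have "\<forall>l\<in>tangent_half_lines X. \<exists>g. bij_betw g (half_branches_tangent X l) (half_branches_tangent Y (\<tau> l))"
    using fin \<tau>Y \<tau>(2) by (intro ballI finite_same_card_bij) auto
  from bchoice[OF this] obtain g where
    g: "\<And>l. l \<in> tangent_half_lines X \<Longrightarrow> bij_betw (g l) (half_branches_tangent X l) (half_branches_tangent Y (\<tau> l))"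
    by blast
  have gY: "g l c \<in> half_branches_tangent Y (\<tau> l)" if "l \<in> tangent_half_lines X" "c \<in> half_branches_tangent X l" for l c
    using bij_betwE[OF g[OF that(1)]] that(2) by blast
  have inj\<tau>: "\<tau> l = \<tau> m \<longleftrightarrow> l = m" if "l \<in> tangent_half_lines X" "m \<in> tangent_half_lines X" for l m
    using bij_betw_imp_inj_on[OF \<tau>(1)] that by (auto dest: inj_onD)
  have injg: "g l c = g l d \<longleftrightarrow> c = d"
    if "l \<in> tangent_half_lines X" "c \<in> half_branches_tangent X l" "d \<in> half_branches_tangent X l" for l c d
    using bij_betw_imp_inj_on[OF g[OF that(1)]] that by (auto dest: inj_onD)
  define f where "f = (\<lambda>v. case v of Root \<Rightarrow> Root | Half_Line l \<Rightarrow> Half_Line (\<tau> l) | Half_Branch l c \<Rightarrow> Half_Branch (\<tau> l) (g l c))"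
  have f: "f Root = Root" "\<And>l. f (Half_Line l) = Half_Line (\<tau> l)" "\<And>l c. f (Half_Branch l c) = Half_Branch (\<tau> l) (g l c)"
    by (simp_all add: f_def)
  have "bij_betw f (verts (bs_tree X)) (verts (bs_tree Y))"
    unfolding bij_betw_def
  proof (intro conjI equalityI subsetI)
    show "inj_on f (verts (bs_tree X))"
    proof (rule inj_onI)
      fix u v assume "u \<in> verts (bs_tree X)" "v \<in> verts (bs_tree X)" "f u = f v"
      then show "u = v"
        unfolding verts_bs_tree by (elim disjE bexE) (auto simp: f inj\<tau> injg)
    qed
  next
    fix w assume "w \<in> f ` verts (bs_tree X)"
    then obtain u where "u \<in> verts (bs_tree X)" "w = f u" by blast
    then show "w \<in> verts (bs_tree Y)"
      unfolding verts_bs_tree by (elim disjE bexE) (auto simp: f intro: \<tau>Y gY)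
  next
    fix w assume w: "w \<in> verts (bs_tree Y)"
    have pre: "\<exists>l\<in>tangent_half_lines X. l' = \<tau> l" if "l' \<in> tangent_half_lines Y" for l'
      using bij_betw_imp_surj_on[OF \<tau>(1)] that by blast
    have preg: "\<exists>c\<in>half_branches_tangent X l. c' = g l c"
      if "l \<in> tangent_half_lines X" "c' \<in> half_branches_tangent Y (\<tau> l)" for l c'
      using bij_betw_imp_surj_on[OF g[OF that(1)]] that(2) by blast
    have "\<exists>u\<in>verts (bs_tree X). w = f u"
      using w unfolding verts_bs_tree[of w]
    proof (elim disjE bexE)
      assume "w = Root"
      then show ?thesis by (intro bexI[of _ Root]) (auto simp: f verts_bs_tree)
    next
      fix l' assume l': "l' \<in> tangent_half_lines Y" "w = Half_Line l'"
      then obtain l where "l \<in> tangent_half_lines X" "l' = \<tau> l" using pre by blast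
      then show ?thesis using l' by (intro bexI[of _ "Half_Line l"]) (auto simp: f verts_bs_tree)
    next
      fix l' c' assume l': "l' \<in> tangent_half_lines Y" "c' \<in> half_branches_tangent Y l'" "w = Half_Branch l' c'"
      then obtain l where l: "l \<in> tangent_half_lines X" "l' = \<tau> l" using pre by blast
      then obtain c where "c \<in> half_branches_tangent X l" "c' = g l c" using preg l' by blast
      then show ?thesis using l l' by (intro bexI[of _ "Half_Branch l c"]) (auto simp: f verts_bs_tree)
    qed
    then show "w \<in> f ` verts (bs_tree X)" by blast
  qed
  moreover have "{u, v} \<in> edges (bs_tree X) \<longleftrightarrow> {f u, f v} \<in> edges (bs_tree Y)"
    if u: "u \<in> verts (bs_tree X)" and v: "v \<in> verts (bs_tree X)" for u v
    using u v unfolding verts_bs_tree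
    by (elim disjE bexE)
       (auto simp: f bs_tree_no_loop bs_tree_edges_Root bs_tree_edges_Half_Line bs_tree_edges_Half_Branch inj\<tau> injg \<tau>Y gY)
  ultimately show ?thesis unfolding rooted_isomorphic_def using f(1) by (intro exI[of _ f]) auto
qed

theorem theorem4p21:
  fixes X Y :: "(real ^ 2) set"
    and r s :: nat
    and a b :: "nat \<Rightarrow> (real ^ 2) \<times> real"
  assumes "real_analytic_curve X" and "real_analytic_curve Y"
    and "0 \<in> X \<inter> Y"
    and "bij_betw a {1..r} (Smp X)"
    and "bij_betw b {1..s} (Smp Y)"
  shows "(blow_spherical_homeomorphic X Y \<longleftrightarrow>
            (\<exists>\<sigma>. bij_betw \<sigma> {1..r} {1..s}
               \<and> (\<forall>i\<in>{1..r}. rel_mult X (a i) = rel_mult Y (b (\<sigma> i)))))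
       \<and> ((\<exists>\<sigma>. bij_betw \<sigma> {1..r} {1..s}
               \<and> (\<forall>i\<in>{1..r}. rel_mult X (a i) = rel_mult Y (b (\<sigma> i))))
            \<longleftrightarrow> rooted_isomorphic (bs_tree X) (bs_tree Y))"
proof -
  have zero: "0 \<in> X" "0 \<in> Y" using assms(3) by auto
  have dims: "analytic_dim X = 1" "analytic_dim Y = 1" using assms(1,2) by (auto simp: real_analytic_curve_def)
  obtain \<epsilon> and I :: "((real ^ 2) \<times> (real \<Rightarrow> real)) set" and \<gamma> where X: "conic_arcs X \<epsilon> I \<gamma>"
    using conic_arcs_of_curve[OF _ dims(1) zero(1)] assms(1) unfolding real_analytic_curve_def by blast
  obtain \<epsilon>' and J :: "((real ^ 2) \<times> (real \<Rightarrow> real)) set" and \<kappa> where Y: "conic_arcs Y \<epsilon>' J \<kappa>"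
    using conic_arcs_of_curve[OF _ dims(2) zero(2)] assms(2) unfolding real_analytic_curve_def by blast
  let ?M = "matchable (strict_boundary X) (rel_mult X) (strict_boundary Y) (rel_mult Y)"
  let ?L = "matchable (tangent_half_lines X) (\<lambda>l. card (half_branches_tangent X l))
           (tangent_half_lines Y) (\<lambda>l. card (half_branches_tangent Y l))"
  have indices: "(\<exists>\<sigma>. bij_betw \<sigma> {1..r} {1..s} \<and> (\<forall>i\<in>{1..r}. rel_mult X (a i) = rel_mult Y (b (\<sigma> i)))) \<longleftrightarrow> ?M"
    using matchable_transfer[OF assms(4) refl assms(5) refl, of "rel_mult X" "rel_mult Y"]
    unfolding matchable_def Smp_conic[OF X dims(1)] Smp_conic[OF Y dims(2)] .
  have half_line: "bij_betw (\<lambda>p. ray (fst p)) (strict_boundary Z) (tangent_half_lines Z) \<and>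
      (\<forall>p\<in>strict_boundary Z. rel_mult Z p = card (half_branches_tangent Z (ray (fst p))) \<and>
        finite (half_branches_tangent Z (ray (fst p))))"
    if Z: "conic_arcs Z \<epsilon> I \<gamma>" for Z :: "(real ^ 2) set" and \<epsilon> and I :: "((real ^ 2) \<times> (real \<Rightarrow> real)) set" and \<gamma>
  proof -
    have mem: "norm (fst p) = 1 \<and> p = (fst p, 0) \<and> (\<exists>i\<in>I. fst p = \<gamma> i 0)" if "p \<in> strict_boundary Z" for p
      using that strict_boundary_conic[OF Z, of "fst p" "snd p"] conic_arcsD(1,4)[OF Z] by (cases p) auto
    have "inj_on (\<lambda>p. ray (fst p)) (strict_boundary Z)"
    proof (rule inj_onI)
      fix p p' assume pp: "p \<in> strict_boundary Z" "p' \<in> strict_boundary Z" "ray (fst p) = ray (fst p')"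
      then have "fst p = fst p'" using ray_eq_iff mem by blast
      moreover have "snd p = 0" "snd p' = 0" using pp(1,2) by (auto simp: strict_boundary_def)
      ultimately show "p = p'" by (simp add: prod_eq_iff)
    qed
    moreover have "(\<lambda>p. ray (fst p)) ` strict_boundary Z = tangent_half_lines Z"
      unfolding tangent_half_lines_conic[OF Z]
    proof (intro equalityI subsetI)
      fix l assume "l \<in> (\<lambda>p. ray (fst p)) ` strict_boundary Z"
      then show "l \<in> (\<lambda>i. ray (\<gamma> i 0)) ` I" using mem by fastforce
    next
      fix l assume "l \<in> (\<lambda>i. ray (\<gamma> i 0)) ` I"
      then obtain i where "i \<in> I" "l = ray (\<gamma> i 0)" by blast
      then show "l \<in> (\<lambda>p. ray (fst p)) ` strict_boundary Z"
        using strict_boundary_conic[OF Z, of "\<gamma> i 0" 0] by (intro image_eqI[of _ _ "(\<gamma> i 0, 0)"]) auto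
    qed
    moreover have "rel_mult Z p = card (half_branches_tangent Z (ray (fst p))) \<and>
        finite (half_branches_tangent Z (ray (fst p)))" if p: "p \<in> strict_boundary Z" for p
      using card_half_branches_tangent[OF Z, of "fst p"] rel_mult_conic[OF Z, of "fst p"] mem[OF p] by simp
    ultimately show ?thesis unfolding bij_betw_def by blast
  qed
  note hX = half_line[OF X] and hY = half_line[OF Y]
  have lines: "?M \<longleftrightarrow> ?L" using hX hY by (intro matchable_transfer) auto
  have finX: "finite (half_branches_tangent X l)" if "l \<in> tangent_half_lines X" for l
  proof -
    have "l \<in> (\<lambda>p. ray (fst p)) ` strict_boundary X"
      using that bij_betw_imp_surj_on[OF conjunct1[OF hX]] by simp
    then obtain p where "p \<in> strict_boundary X" "l = ray (fst p)" by blast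
    then show ?thesis using conjunct2[OF hX] by simp
  qed
  have finY: "finite (half_branches_tangent Y l)" if "l \<in> tangent_half_lines Y" for l
  proof -
    have "l \<in> (\<lambda>p. ray (fst p)) ` strict_boundary Y"
      using that bij_betw_imp_surj_on[OF conjunct1[OF hY]] by simp
    then obtain p where "p \<in> strict_boundary Y" "l = ray (fst p)" by blast
    then show ?thesis using conjunct2[OF hY] by simp
  qed
  have "blow_spherical_homeomorphic X Y \<longleftrightarrow> ?M"
    using blow_homeomorphic_imp_matchable[OF X Y] matchable_imp_blow_homeomorphic[OF X Y zero] by (rule iffI)
  moreover have "rooted_isomorphic (bs_tree X) (bs_tree Y) \<longleftrightarrow> ?L"
  proof
    assume "rooted_isomorphic (bs_tree X) (bs_tree Y)"
    then show ?L by (rule rooted_isomorphic_imp_matchable)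
  next
    assume ?L
    then show "rooted_isomorphic (bs_tree X) (bs_tree Y)"
      by (rule matchable_imp_rooted_isomorphic[OF _ finX finY])
  qed
  ultimately show ?thesis unfolding indices lines by simp
qed

end
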